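(* Let $n,N\geq 1$, let $\Omega\subset\mathbb{R}^n$ be a bounded Lipschitz domain, $\lambda>0$, and $f\in L^2(\Omega,\mathbb{R}^N)$. For $\mu>1$ let $\Phi_\mu(t):=\int_0^t\int_0^s(1+r)^{-\mu}\,dr\,ds$ for $t\geq 0$, put $\Psi_\mu:=(\mu-1)\Phi_\mu$ (so that $\lim_{t\to\infty}\Psi_\mu'(t)=1$), and let $u_\mu\in BV(\Omega,\mathbb{R}^N)$ be the unique minimizer of $$\mathcal{K}_\mu[w]:=\int_\Omega\Psi_\mu(|\nabla^a w|)\,dx+|\nabla^s w|(\Omega)+\frac{\lambda}{2}\int_\Omega|w-f|^2\,dx,\quad w\in BV(\Omega,\mathbb{R}^N).$$ Then the problem $$\int_\Omega|\nabla w|+\frac{\lambda}{2}\int_\Omega|w-f|^2\,dx\to\min\ \text{ in } BV(\Omega,\mathbb{R}^N)$$ has a unique minimizer $u$, and as $\mu\to\infty$ we have $\|u_\mu-u\|_{L^p(\Omega,\mathbb{R}^N)}\to 0$ for every $p<\frac{n}{n-1}$ (every $p<\infty$ if $n=1$) and $u_\mu\rightharpoonup u$ weakly in $L^2(\Omega,\mathbb{R}^N)$.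
   Context: $|\cdot|$ is the Euclidean norm of vectors and matrices. For $w\in BV(\Omega,\mathbb{R}^N)$, $\nabla w=\nabla^a w\,\mathcal{L}^n+\nabla^s w$ is the Lebesgue decomposition of the matrix-valued measure $\nabla w$ into absolutely continuous part (density $\nabla^a w$) and singular part $\nabla^s w$ w.r.t. Lebesgue measure; $|\nabla^s w|(\Omega)$ is the total variation of $\nabla^s w$ and $\int_\Omega|\nabla w|$ the total variation of $\nabla w$ on $\Omega$. *)

theory Defs
  imports "HOL-Analysis.Analysis"
begin

text \<open>Points of the domain are in real^'n (so n = CARD('n)), values in real^'m (N = CARD('m)).
  Matrices (gradients) are real^'n^'m: row i is the gradient of the i-th component.
  The norm on real^'n^'m is the Euclidean (Frobenius) norm, and the inner product is the
  Frobenius inner product.\<close>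

text \<open>Bounded Lipschitz domain: nonempty open connected bounded set whose boundary is locally
  the graph of a Lipschitz function (in suitably rotated coordinates: e is the direction of
  the last axis, the function gamma is evaluated on the hyperplane orthogonal to e).\<close>
definition lipschitz_domain :: "(real^'n) set \<Rightarrow> bool" where
  "lipschitz_domain \<Omega> \<longleftrightarrow> open \<Omega> \<and> connected \<Omega> \<and> \<Omega> \<noteq> {} \<and>
     (\<forall>x0\<in>frontier \<Omega>. \<exists>r>0. \<exists>e::real^'n. norm e = 1 \<and>
        (\<exists>(\<gamma>::real^'n \<Rightarrow> real) L. L-lipschitz_on UNIV \<gamma> \<and>
           \<Omega> \<inter> ball x0 r = {x \<in> ball x0 r. x \<bullet> e < \<gamma> (x - (x \<bullet> e) *\<^sub>R e)}))"

definition test_fun :: "(real^'n) set \<Rightarrow> (real^'n \<Rightarrow> real^'n^'m) \<Rightarrow> bool" where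
  "test_fun \<Omega> \<phi> \<longleftrightarrow> compact (closure {x. \<phi> x \<noteq> 0}) \<and> closure {x. \<phi> x \<noteq> 0} \<subseteq> \<Omega> \<and>
     (\<forall>x. \<phi> differentiable (at x)) \<and>
     (\<forall>j. continuous_on UNIV (\<lambda>x. frechet_derivative \<phi> (at x) (axis j 1)))"

definition mdiv :: "(real^'n \<Rightarrow> real^'n^'m) \<Rightarrow> real^'n \<Rightarrow> real^'m" where
  "mdiv \<phi> x = (\<chi> i. \<Sum>j\<in>UNIV. frechet_derivative \<phi> (at x) (axis j 1) $ i $ j)"

text \<open>Polar representation of the distributional gradient: \<nabla>w = \<sigma> \<nu> on \<Omega>, where
  \<nu> = |\<nabla>w| is a finite Borel measure concentrated on \<Omega> and |\<sigma>| = 1 \<nu>-a.e.\<close>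
definition grad_repr :: "(real^'n) set \<Rightarrow> (real^'n \<Rightarrow> real^'m) \<Rightarrow> (real^'n) measure
    \<Rightarrow> (real^'n \<Rightarrow> real^'n^'m) \<Rightarrow> bool" where
  "grad_repr \<Omega> w \<nu> \<sigma> \<longleftrightarrow> sets \<nu> = sets borel \<and> finite_measure \<nu> \<and> emeasure \<nu> (UNIV - \<Omega>) = 0 \<and>
     \<sigma> \<in> borel_measurable borel \<and> (AE x in \<nu>. norm (\<sigma> x) = 1) \<and>
     (\<forall>\<phi>. test_fun \<Omega> \<phi> \<longrightarrow>
        (\<integral>x. w x \<bullet> mdiv \<phi> x \<partial>lebesgue_on \<Omega>) = - (\<integral>x. \<phi> x \<bullet> \<sigma> x \<partial>\<nu>))"

definition is_BV :: "(real^'n) set \<Rightarrow> (real^'n \<Rightarrow> real^'m) \<Rightarrow> bool" where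
  "is_BV \<Omega> w \<longleftrightarrow> integrable (lebesgue_on \<Omega>) w \<and> (\<exists>\<nu> \<sigma>. grad_repr \<Omega> w \<nu> \<sigma>)"

text \<open>Lebesgue decomposition of |\<nabla>w| = \<nu>: \<nu> restricted to the complement of a Lebesgue-null
  Borel set Z has density h w.r.t. Lebesgue measure; then \<nabla>^a w = h \<sigma> and
  \<nabla>^s w = \<sigma> (\<nu> restricted to Z), so |\<nabla>^s w|(\<Omega>) = \<nu>(Z).\<close>
definition leb_decomp :: "(real^'n) measure \<Rightarrow> (real^'n) set \<Rightarrow> (real^'n \<Rightarrow> real) \<Rightarrow> bool" where
  "leb_decomp \<nu> Z h \<longleftrightarrow> Z \<in> sets borel \<and> emeasure lborel Z = 0 \<and>
     h \<in> borel_measurable borel \<and> (\<forall>x. 0 \<le> h x) \<and>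
     density \<nu> (indicator (UNIV - Z)) = density lborel (\<lambda>x. ennreal (h x))"

definition Phi :: "real \<Rightarrow> real \<Rightarrow> real" where
  "Phi \<mu> t = integral {0..t} (\<lambda>s. integral {0..s} (\<lambda>r. (1 + r) powr (- \<mu>)))"

definition Psi :: "real \<Rightarrow> real \<Rightarrow> real" where
  "Psi \<mu> t = (\<mu> - 1) * Phi \<mu> t"

definition K_energy :: "real \<Rightarrow> (real^'n) set \<Rightarrow> real \<Rightarrow> (real^'n \<Rightarrow> real^'m)
    \<Rightarrow> (real^'n \<Rightarrow> real^'m) \<Rightarrow> ennreal \<Rightarrow> bool" where
  "K_energy \<mu> \<Omega> lam f w k \<longleftrightarrow> (\<exists>\<nu> \<sigma> Z h. grad_repr \<Omega> w \<nu> \<sigma> \<and> leb_decomp \<nu> Z h \<and>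
     k = (\<integral>\<^sup>+x. ennreal (Psi \<mu> (norm (h x *\<^sub>R \<sigma> x))) \<partial>lebesgue_on \<Omega>)
         + emeasure \<nu> Z
         + ennreal (lam/2) * (\<integral>\<^sup>+x. ennreal ((norm (w x - f x))\<^sup>2) \<partial>lebesgue_on \<Omega>))"

definition TV_energy :: "(real^'n) set \<Rightarrow> real \<Rightarrow> (real^'n \<Rightarrow> real^'m)
    \<Rightarrow> (real^'n \<Rightarrow> real^'m) \<Rightarrow> ennreal \<Rightarrow> bool" where
  "TV_energy \<Omega> lam f w k \<longleftrightarrow> (\<exists>\<nu> \<sigma>. grad_repr \<Omega> w \<nu> \<sigma> \<and>
     k = emeasure \<nu> UNIV + ennreal (lam/2) * (\<integral>\<^sup>+x. ennreal ((norm (w x - f x))\<^sup>2) \<partial>lebesgue_on \<Omega>))"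

definition BV_minimizer :: "(real^'n) set \<Rightarrow> ((real^'n \<Rightarrow> real^'m) \<Rightarrow> ennreal \<Rightarrow> bool)
    \<Rightarrow> (real^'n \<Rightarrow> real^'m) \<Rightarrow> bool" where
  "BV_minimizer \<Omega> E w \<longleftrightarrow> is_BV \<Omega> w \<and>
     (\<forall>v k k'. is_BV \<Omega> v \<longrightarrow> E w k \<longrightarrow> E v k' \<longrightarrow> k \<le> k')"

end

theory Submission
  imports Defs "HOL-Probability.Probability"
begin

text \<open>
  Since \<open>\<Psi>\<^sub>\<mu>(t) \<le> t \<le> \<Psi>\<^sub>\<mu>(t) + 1/(\<mu>-2)\<close>, the energies satisfy
  \<open>K\<^sub>\<mu> \<le> J \<le> K\<^sub>\<mu> + |\<Omega>|/(\<mu>-2)\<close>, where \<open>J\<close> is the total variation energy, so \<open>u\<^sub>\<mu>\<close> minimizes \<open>J\<close> up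
  to \<open>|\<Omega>|/(\<mu>-2)\<close>. The fidelity term makes \<open>J\<close> strongly convex in \<open>L\<^sup>2\<close>; hence almost minimizers
  are Cauchy in \<open>L\<^sup>2\<close>, their limit is the unique minimizer, and \<open>u\<^sub>\<mu>\<close> converges to it strongly
  in \<open>L\<^sup>2\<close>. No compact embedding of \<open>BV\<close> is needed. As \<open>n/(n-1) \<le> 2\<close> for \<open>n \<ge> 2\<close>, this gives all
  the claimed exponents; for \<open>n = 1\<close> one interpolates with a uniform \<open>L\<^sup>\<infinity>\<close> bound, obtained by duality
  from the primitives of mean-zero test functions.

  That the \<open>L\<^sup>2\<close> limit has a gradient measure is a weak compactness statement for measures on a
  compact subset of Euclidean space. It is reduced to Helly's theorem on the real line by pulling
  the measures back along a space-filling curve with a Borel right inverse.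
\<close>

section \<open>The energy density, sums of measures and the Lebesgue decomposition\<close>

text \<open>Membership in BV is given by the existence of a measure and a unit direction, not by a
  supremum over test functions, and both energies are relations between a function and a value.
  Midpoints and limits therefore need a polar representation before they are admissible, while
  cancellation hides the mass of a representation that has been constructed. The two issues are kept
  apart. Representations come from positive measures on pairs (point, direction), whose fibres are
  averaged by Radon-Nikodym. Masses are bounded only by duality: test functions of norm at most one
  recover the mass of every representation. This single fact yields convexity, lower semicontinuity
  and independence of the chosen representation. The constant \<open>1 / (\<mu> - 2)\<close> is the
  supremum of \<open>t - Psi \<mu> t\<close> over \<open>t \<ge> 0\<close>. It is finite exactly
  when \<open>\<mu> > 2\<close>, which is why the comparison of energies starts there; the limit
  \<open>\<mu> \<rightarrow> \<infinity>\<close> does not notice.\<close>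

lemma Psi_0: "Psi \<mu> 0 = 0"
  by (simp add: Psi_def Phi_def)

text \<open>The power is integrated twice; beyond \<open>\<mu> = 2\<close> no logarithm arises and
  the remaining power \<open>2 - \<mu>\<close> is negative. The formula also supplies the
  measurability of \<open>Psi \<mu>\<close> composed with a density.\<close>

lemma Psi_closed_form:
  assumes mu: "\<mu> > 2" and t: "t \<ge> 0"
  shows "Psi \<mu> t = t - (1 - (1 + t) powr (2 - \<mu>)) / (\<mu> - 2)"
proof -
  have inner: "integral {0..s} (\<lambda>r. (1 + r) powr (- \<mu>)) = (1 - (1 + s) powr (1 - \<mu>)) / (\<mu> - 1)"
    if s: "s \<ge> 0" for s
  proof (rule integral_unique)
    have "((\<lambda>r. (1 + r) powr (- \<mu>)) has_integral
        (- ((1 + s) powr (1 - \<mu>) / (\<mu> - 1)) - - ((1 + 0) powr (1 - \<mu>) / (\<mu> - 1)))) {0..s}"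
    proof (rule fundamental_theorem_of_calculus[OF s])
      fix x assume "x \<in> {0..s}"
      then show "((\<lambda>r. - ((1 + r) powr (1 - \<mu>) / (\<mu> - 1))) has_vector_derivative (1 + x) powr (- \<mu>))
          (at x within {0..s})"
        using mu by (auto intro!: derivative_eq_intros simp: has_real_derivative_iff_has_vector_derivative[symmetric])
          (simp add: field_simps)
    qed
    then show "((\<lambda>r. (1 + r) powr (- \<mu>)) has_integral (1 - (1 + s) powr (1 - \<mu>)) / (\<mu> - 1)) {0..s}"
      by (simp add: diff_divide_distrib)
  qed
  have "Phi \<mu> t = integral {0..t} (\<lambda>s. (1 - (1 + s) powr (1 - \<mu>)) / (\<mu> - 1))"
    unfolding Phi_def by (intro integral_cong) (simp add: inner)
  also have "\<dots> = (t + (1 + t) powr (2 - \<mu>) / (\<mu> - 2)) / (\<mu> - 1)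
      - (0 + (1 + 0) powr (2 - \<mu>) / (\<mu> - 2)) / (\<mu> - 1)"
  proof (rule integral_unique, rule fundamental_theorem_of_calculus[OF t])
    fix x assume "x \<in> {0..t}"
    then show "((\<lambda>s. (s + (1 + s) powr (2 - \<mu>) / (\<mu> - 2)) / (\<mu> - 1)) has_vector_derivative
        (1 - (1 + x) powr (1 - \<mu>)) / (\<mu> - 1)) (at x within {0..t})"
      using mu by (auto intro!: derivative_eq_intros simp: has_real_derivative_iff_has_vector_derivative[symmetric])
        (simp add: field_simps)
  qed
  finally show ?thesis
    using mu unfolding Psi_def by (simp add: divide_simps) (simp add: algebra_simps)
qed

text \<open>The gap in the closed form is a number in \<open>[0, 1]\<close> divided by
  \<open>\<mu> - 2\<close>.\<close>

lemma Psi_bounds: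
  assumes mu: "\<mu> > 2" and t: "t \<ge> 0"
  shows "Psi \<mu> t \<le> t" and "t \<le> Psi \<mu> t + 1 / (\<mu> - 2)"
proof -
  have "(1 + t) powr (2 - \<mu>) \<le> 1"
    using mu t powr_mono[of "2 - \<mu>" 0 "1 + t"] by simp
  then show "Psi \<mu> t \<le> t"
    using mu by (simp add: Psi_closed_form[OF mu t] divide_nonneg_pos)
  have "(1 - (1 + t) powr (2 - \<mu>)) / (\<mu> - 2) \<le> 1 / (\<mu> - 2)"
    using mu by (intro divide_right_mono) auto
  then show "t \<le> Psi \<mu> t + 1 / (\<mu> - 2)"
    by (simp add: Psi_closed_form[OF mu t])
qed

section \<open>Sums of two measures on the same sigma-algebra\<close>

definition add_measure :: "'a measure \<Rightarrow> 'a measure \<Rightarrow> 'a measure" where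
  "add_measure M N = measure_of (space M) (sets M) (\<lambda>A. emeasure M A + emeasure N A)"

lemma sets_add_measure [simp, measurable_cong]: "sets (add_measure M N) = sets M"
  by (simp add: add_measure_def)

lemma space_add_measure [simp]: "space (add_measure M N) = space M"
  by (simp add: add_measure_def)

lemma emeasure_add_measure:
  assumes "sets N = sets M" "A \<in> sets M"
  shows "emeasure (add_measure M N) A = emeasure M A + emeasure N A"
proof (rule emeasure_measure_of[OF add_measure_def])
  show "countably_additive (sets (add_measure M N)) (\<lambda>A. emeasure M A + emeasure N A)"
  proof (rule countably_additiveI)
    fix A :: "nat \<Rightarrow> 'a set" assume *: "range A \<subseteq> sets (add_measure M N)" "disjoint_family A"
    then have "(\<Sum>i. emeasure M (A i) + emeasure N (A i)) = (\<Sum>i. emeasure M (A i)) + (\<Sum>i. emeasure N (A i))"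
      by (intro suminf_add[symmetric]) auto
    also have "\<dots> = emeasure M (\<Union> (range A)) + emeasure N (\<Union> (range A))"
      using * assms by (simp add: suminf_emeasure)
    finally show "(\<Sum>i. emeasure M (A i) + emeasure N (A i)) = emeasure M (\<Union> (range A)) + emeasure N (\<Union> (range A))" .
  qed
qed (use assms sets.space_closed in \<open>auto simp: positive_def\<close>)

lemma nn_integral_add_measure:
  assumes "sets N = sets M" "f \<in> borel_measurable M"
  shows "(\<integral>\<^sup>+x. f x \<partial>add_measure M N) = (\<integral>\<^sup>+x. f x \<partial>M) + (\<integral>\<^sup>+x. f x \<partial>N)"
  using assms(2)
proof (induction rule: borel_measurable_induct)
  case (cong f g)
  then show ?case
    using sets_eq_imp_space_eq[OF assms(1)] by (simp cong: nn_integral_cong_simp)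
next
  case (set A)
  then show ?case using assms(1) by (simp add: emeasure_add_measure)
next
  case (mult u c)
  then have "u \<in> borel_measurable (add_measure M N)" "u \<in> borel_measurable N"
    using assms(1) measurable_cong_sets by (auto cong: measurable_cong_sets)
  with mult show ?case by (simp add: nn_integral_cmult distrib_left)
next
  case (add u v)
  then have "u \<in> borel_measurable (add_measure M N)" "u \<in> borel_measurable N"
    "v \<in> borel_measurable (add_measure M N)" "v \<in> borel_measurable N"
    using assms(1) by (auto cong: measurable_cong_sets)
  with add show ?case by (simp add: nn_integral_add ac_simps)
next
  case (seq U)
  then have m: "\<And>i. U i \<in> borel_measurable (add_measure M N)" "\<And>i. U i \<in> borel_measurable N"
    using assms(1) by (auto cong: measurable_cong_sets)
  have mono: "incseq (\<lambda>i. \<integral>\<^sup>+ x. U i x \<partial>K)" for K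
    using seq by (auto simp: incseq_def le_fun_def intro!: nn_integral_mono)
  show ?case
    using seq m mono unfolding SUP_apply 
    by (simp add: nn_integral_monotone_convergence_SUP ennreal_SUP_add)
qed

lemma integrable_add_measure_iff:
  fixes f :: "'a \<Rightarrow> 'b::{banach, second_countable_topology}"
  assumes "sets N = sets M"
  shows "integrable (add_measure M N) f \<longleftrightarrow> integrable M f \<and> integrable N f"
proof -
  have "f \<in> borel_measurable (add_measure M N) \<longleftrightarrow> f \<in> borel_measurable M"
     "f \<in> borel_measurable N \<longleftrightarrow> f \<in> borel_measurable M"
    using assms by (auto cong: measurable_cong_sets)
  then show ?thesis
    by (auto simp: integrable_iff_bounded nn_integral_add_measure[OF assms])
qed

lemma integral_add_measure:
  fixes f :: "'a \<Rightarrow> real"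
  assumes "sets N = sets M" "integrable M f" "integrable N f"
  shows "(LINT x|add_measure M N. f x) = (LINT x|M. f x) + (LINT x|N. f x)"
proof -
  have [measurable]: "f \<in> borel_measurable M" "f \<in> borel_measurable N" using assms by auto
  have i: "integrable (add_measure M N) f" using integrable_add_measure_iff[OF assms(1)] assms by blast
  have fin: "(\<integral>\<^sup>+x. ennreal (f x) \<partial>K) < \<infinity>" "(\<integral>\<^sup>+x. ennreal (- f x) \<partial>K) < \<infinity>" if "integrable K f" for K
    using that by (auto simp: real_integrable_def top.not_eq_extremum)
  show ?thesis
    using fin[OF assms(2)] fin[OF assms(3)] 
    by (simp add: real_lebesgue_integral_def i assms nn_integral_add_measure[OF assms(1)] enn2real_plus)
qed

lemma finite_measure_add_measure:
  assumes "sets N = sets M" "finite_measure M" "finite_measure N"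
  shows "finite_measure (add_measure M N)"
proof -
  interpret M: finite_measure M by fact
  interpret N: finite_measure N by fact
  show ?thesis
    by (rule finite_measureI)
      (use assms M.emeasure_finite N.emeasure_finite in \<open>auto simp: emeasure_add_measure\<close>)
qed

text \<open>Lebesgue measure has a density \<open>g\<close> with respect to its sum with
  \<open>\<nu>\<close>. The zero set \<open>Z\<close> of \<open>g\<close> is Lebesgue null, and off
  \<open>Z\<close>, where \<open>g > 0\<close>, every Lebesgue null set is null for the sum and so
  for \<open>\<nu>\<close>. A second application of Radon-Nikodym, to \<open>\<nu>\<close> off
  \<open>Z\<close>, gives \<open>h\<close>.\<close>

lemma exists_leb_decomp:
  fixes \<nu> :: "(real^'n) measure"
  assumes sets: "sets \<nu> = sets borel" and fin: "finite_measure \<nu>"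
  shows "\<exists>Z h. leb_decomp \<nu> Z h"
proof -
  let ?A = "add_measure lborel \<nu>"
  have sets': "sets \<nu> = sets lborel" using sets by simp
  interpret \<nu>: finite_measure \<nu> by fact
  have "sigma_finite_measure ?A"
  proof
    have "\<exists>A. countable A \<and> A \<subseteq> sets lborel \<and> \<Union> A = space (lborel::(real^'n) measure)
        \<and> (\<forall>a\<in>A. emeasure lborel a \<noteq> \<infinity>)"
      by (rule lborel.sigma_finite_countable)
    then show "\<exists>A. countable A \<and> A \<subseteq> sets ?A \<and> \<Union> A = space ?A \<and> (\<forall>a\<in>A. emeasure ?A a \<noteq> \<infinity>)"
      using \<nu>.emeasure_finite by (fastforce simp: emeasure_add_measure[OF sets'])
  qed
  then interpret A: sigma_finite_measure ?A .
  have ac: "absolutely_continuous ?A lborel"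
    by (auto simp: absolutely_continuous_def null_sets_def emeasure_add_measure[OF sets'])
  obtain g where g: "g \<in> borel_measurable ?A" "density ?A g = lborel"
    using A.Radon_Nikodym[OF ac] by auto
  have gm[measurable]: "g \<in> borel_measurable borel" using g(1) by (simp cong: measurable_cong_sets)
  define Z where "Z = {x. g x = 0}"
  have Z: "Z \<in> sets borel" unfolding Z_def by measurable
  have Z0: "emeasure lborel Z = 0"
  proof -
    have "emeasure (density ?A g) Z = (\<integral>\<^sup>+x. g x * indicator Z x \<partial>?A)"
      using Z by (intro emeasure_density g) auto
    also have "\<dots> = (\<integral>\<^sup>+x. 0 \<partial>?A)"
      by (intro nn_integral_cong) (auto simp: Z_def indicator_def)
    finally show ?thesis using g(2) by simp
  qed
  let ?\<rho> = "density \<nu> (indicator (UNIV - Z))"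
  have "absolutely_continuous lborel ?\<rho>"
    unfolding absolutely_continuous_def
  proof
    fix N assume N: "N \<in> null_sets (lborel::(real^'n) measure)"
    then have Ns[measurable]: "N \<in> sets borel" by auto
    have "0 = emeasure (density ?A g) N" using N g by auto
    also have "\<dots> = (\<integral>\<^sup>+x. g x * indicator N x \<partial>?A)"
      using Ns by (intro emeasure_density g) auto
    finally have "AE x in ?A. g x * indicator N x = 0"
      by (subst (asm) eq_commute, subst (asm) nn_integral_0_iff_AE)
         (use g(1) in \<open>auto cong: measurable_cong_sets\<close>)
    then have "(\<integral>\<^sup>+x. indicator (N - Z) x \<partial>?A) = (\<integral>\<^sup>+x. 0 \<partial>?A)"
      by (intro nn_integral_cong_AE) (auto elim!: eventually_mono simp: Z_def indicator_def split: if_splits)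
    then have "emeasure ?A (N - Z) = 0" using Ns Z by simp
    then have "emeasure \<nu> (N - Z) = 0" using Ns Z by (simp add: emeasure_add_measure[OF sets'])
    moreover have "emeasure ?\<rho> N = (\<integral>\<^sup>+x. indicator (UNIV - Z) x * indicator N x \<partial>\<nu>)"
      using Ns Z sets by (intro emeasure_density) auto
    moreover have "\<dots> = (\<integral>\<^sup>+x. indicator (N - Z) x \<partial>\<nu>)"
      by (intro nn_integral_cong) (auto simp: indicator_def)
    ultimately show "N \<in> null_sets ?\<rho>" using Ns Z sets by (auto simp: null_sets_def)
  qed
  then obtain H where H[measurable]: "H \<in> borel_measurable lborel" and dH: "density lborel H = ?\<rho>"
    using sigma_finite_measure.Radon_Nikodym[OF lborel.sigma_finite_measure_axioms, of ?\<rho>] sets by auto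
  \<comment> \<open>The decomposition asks for a real-valued density; finiteness of
    \<open>\<nu>\<close> makes \<open>H\<close> finite almost everywhere, so \<open>enn2real\<close>
    changes it only on a null set.\<close>
  have "(\<integral>\<^sup>+x. H x \<partial>lborel) = emeasure (density lborel H) UNIV"
    by (subst emeasure_density) auto
  also have "\<dots> = (\<integral>\<^sup>+x. indicator (UNIV - Z) x \<partial>\<nu>)"
    unfolding dH using Z sets by (subst emeasure_density) auto
  also have "\<dots> \<le> emeasure \<nu> UNIV"
    using Z sets by (simp add: emeasure_mono)
  also have "\<dots> < \<infinity>" by (simp add: less_top[symmetric])
  finally have "AE x in lborel. H x \<noteq> \<infinity>"
    by (intro nn_integral_PInf_AE) auto
  then have "density lborel H = density lborel (\<lambda>x. ennreal (enn2real (H x)))"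
    by (intro density_cong) (auto elim!: eventually_mono simp: top.not_eq_extremum)
  then have "leb_decomp \<nu> Z (\<lambda>x. enn2real (H x))"
    unfolding leb_decomp_def using Z Z0 dH by auto
  then show ?thesis by blast
qed

section \<open>Weak compactness of measures\<close>

text \<open>The 2-periodic wave of Schoenberg's curve, with a clipped cosine in place of the usual
  piecewise linear profile. The shift \<open>1/2\<close> makes it 0 on \<open>[0, 1/3]\<close> and 1
  on \<open>[2/3, 1]\<close>, since the cosine is \<open>1/2\<close> and \<open>-1/2\<close> at the
  inner end points.\<close>

definition schoenberg_wave :: "real \<Rightarrow> real" where
  "schoenberg_wave x = max 0 (min 1 (1/2 - cos (pi * x)))"

lemma schoenberg_wave_bounds: "0 \<le> schoenberg_wave x" "schoenberg_wave x \<le> 1"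
  by (auto simp: schoenberg_wave_def)

lemma schoenberg_wave_shift: "schoenberg_wave (x + 2 * of_nat k) = schoenberg_wave x"
proof -
  have "cos (pi * (x + 2 * of_nat k)) = cos (pi * x)"
    using cos.plus_of_nat[of "pi * x" k] by (simp add: algebra_simps)
  then show ?thesis by (simp add: schoenberg_wave_def)
qed

lemma schoenberg_wave_low:
  assumes "0 \<le> x" "x \<le> 1/3" shows "schoenberg_wave x = 0"
proof -
  have "cos (pi / 3) \<le> cos (pi * x)"
    using assms by (intro cos_monotone_0_pi_le) (auto simp: field_simps)
  then show ?thesis by (simp add: schoenberg_wave_def cos_60)
qed

lemma schoenberg_wave_high:
  assumes "2/3 \<le> x" "x \<le> 1" shows "schoenberg_wave x = 1"
proof -
  have "cos (pi * x) \<le> cos (2 * pi / 3)"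
    using assms by (intro cos_monotone_0_pi_le) (auto simp: field_simps)
  then show ?thesis by (simp add: schoenberg_wave_def cos_120)
qed

text \<open>Greedy digits: \<open>r k\<close> is the remainder after \<open>k\<close> digits,
  rescaled by \<open>2 ^ k\<close>. Doubling and subtracting the digit keeps it in
  \<open>[0, 1]\<close>, so the error \<open>r k * (1/2) ^ k\<close> vanishes. The end point 1 is
  included, with all digits equal to one.\<close>

lemma binary_expansion:
  fixes y :: real
  assumes "0 \<le> y" "y \<le> 1"
  shows "\<exists>a::nat \<Rightarrow> bool. (\<lambda>k. of_bool (a k) * (1/2) ^ Suc k) sums y"
proof -
  define r where "r = rec_nat y (\<lambda>_ z. 2 * z - of_bool (1/2 \<le> z))"
  have r0: "r 0 = y" and rS: "\<And>k. r (Suc k) = 2 * r k - of_bool (1/2 \<le> r k)"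
    by (simp_all add: r_def)
  have rb: "0 \<le> r k \<and> r k \<le> 1" for k
    by (induction k) (use assms in \<open>auto simp: r0 rS\<close>)
  have part: "(\<Sum>i<k. of_bool (1/2 \<le> r i) * (1/2) ^ Suc i) = y - r k * (1/2) ^ k" for k
    by (induction k) (simp_all add: r0 rS field_simps)
  have "(\<lambda>k. r k * (1/2) ^ k) \<longlonglongrightarrow> 0"
  proof (rule tendsto_sandwich[OF _ _ tendsto_const])
    show "\<forall>\<^sub>F k in sequentially. 0 \<le> r k * (1/2) ^ k" using rb by auto
    show "\<forall>\<^sub>F k in sequentially. r k * (1/2) ^ k \<le> (1/2) ^ k" using rb by (simp add: mult_left_le_one_le)
    show "(\<lambda>k. (1/2::real) ^ k) \<longlonglongrightarrow> 0" by (rule LIMSEQ_power_zero) simp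
  qed
  from tendsto_diff[OF tendsto_const[of y] this]
  have "(\<lambda>k. of_bool (1/2 \<le> r k) * (1/2) ^ Suc k) sums y"
    unfolding sums_def part by simp
  then show ?thesis by (rule exI[of _ "\<lambda>k. 1/2 \<le> r k"])
qed

text \<open>The ternary digits of \<open>t\<close> are twice the prescribed binary digits, so multiplication by
  \<open>3 ^ m\<close> moves digit \<open>m\<close> into the leading fractional place up to an even integer.\<close>

lemma schoenberg_wave_digit:
  fixes a :: "nat \<Rightarrow> bool"
  defines "t \<equiv> (\<Sum>i. 2 * of_bool (a i) * (1/3) ^ Suc i)"
  shows "0 \<le> t" "t \<le> 1" "\<And>m. schoenberg_wave (3 ^ m * t) = of_bool (a m)"
proof -
  define c where "c b i = 2 * of_bool (b i) * (1/3::real) ^ Suc i" for b :: "nat \<Rightarrow> bool" and i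
  have geo: "(\<lambda>i. 2 * (1/3::real) ^ Suc i) sums 1"
    using sums_mult[OF geometric_sums[of "1/3::real"], of "2/3"] by simp
  have sm: "summable (c b)" for b
    by (rule summable_comparison_test[OF _ sums_summable[OF geo]]) (auto simp: c_def)
  have ge0: "0 \<le> suminf (c b)" for b
    by (intro suminf_nonneg sm) (simp add: c_def)
  have le1: "suminf (c b) \<le> 1" for b
    using suminf_le[OF _ sm[of b] sums_summable[OF geo]] sums_unique[OF geo] by (simp add: c_def)
  have t: "t = suminf (c a)" unfolding t_def c_def ..
  show "0 \<le> t" "t \<le> 1" using ge0 le1 t by auto
  have first: "suminf (c b) = 2 * of_bool (b 0) / 3 + (1/3) * suminf (c (\<lambda>i. b (Suc i)))" for b
  proof -
    have "suminf (c b) = (\<Sum>i. c b (Suc i)) + c b 0"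
      using suminf_split_head[OF sm[of b]] by simp
    also have "(\<Sum>i. c b (Suc i)) = (\<Sum>i. (1/3) * c (\<lambda>i. b (Suc i)) i)"
      by (simp add: c_def ac_simps)
    also have "\<dots> = (1/3) * suminf (c (\<lambda>i. b (Suc i)))" by (intro suminf_mult sm)
    also have "c b 0 = 2 * of_bool (b 0) / 3" unfolding c_def by simp
    finally show ?thesis by linarith
  qed
  \<comment> \<open>All later digits together contribute at most \<open>1/3\<close>, so the leading
    digit decides between the two plateaus of the wave.\<close>
  have lead: "schoenberg_wave (suminf (c b)) = of_bool (b 0)" for b
    using ge0[of "\<lambda>i. b (Suc i)"] le1[of "\<lambda>i. b (Suc i)"]
    by (cases "b 0") (auto simp: first[of b] intro!: schoenberg_wave_low schoenberg_wave_high)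
  have shift: "\<exists>k::nat. 3 ^ m * suminf (c a) = suminf (c (\<lambda>i. a (m + i))) + 2 * of_nat k" for m
  proof (induction m)
    case (Suc m)
    then obtain k where k: "3 ^ m * suminf (c a) = suminf (c (\<lambda>i. a (m + i))) + 2 * of_nat k" by blast
    have "3 ^ Suc m * suminf (c a) = 3 * suminf (c (\<lambda>i. a (m + i))) + 6 * of_nat k"
      using k by simp
    also have "\<dots> = suminf (c (\<lambda>i. a (Suc m + i))) + 2 * of_nat (of_bool (a m) + 3 * k)"
      by (subst first) simp
    finally show ?case by blast
  qed (auto intro: exI[of _ 0])
  show "schoenberg_wave (3 ^ m * t) = of_bool (a m)" for m
  proof -
    obtain k where "3 ^ m * suminf (c a) = suminf (c (\<lambda>i. a (m + i))) + 2 * of_nat k"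
      using shift by blast
    then show ?thesis using lead[of "\<lambda>i. a (m + i)"] by (simp add: t schoenberg_wave_shift)
  qed
qed

text \<open>Schoenberg's space-filling curve: coordinate \<open>j\<close> reads off the binary digits of \<open>t\<close> in the
  positions \<open>d * k + j\<close>.\<close>

lemma space_filling_curve:
  fixes R :: real
  assumes R: "R > 0"
  shows "\<exists>g :: real \<Rightarrow> 'a::euclidean_space. continuous_on UNIV g \<and> bounded (range g) \<and>
    cball 0 R \<subseteq> g ` {0..1}"
proof -
  define d where "d = DIM('a)"
  obtain e :: "'a \<Rightarrow> nat" where e: "bij_betw e Basis {0..<d}"
    using ex_bij_betw_finite_nat[OF finite_Basis] d_def by blast
  have e_lt: "e b < d" if "b \<in> Basis" for b using e that by (auto simp: bij_betw_def)
  define G where "G j t = (\<Sum>k. schoenberg_wave (3 ^ (d * k + j) * t) * (1/2) ^ Suc k)" for j t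
  have half: "(\<lambda>k. (1/2::real) ^ Suc k) sums 1"
    using power_half_series .
  have tm: "norm (schoenberg_wave x * (1/2) ^ Suc k) \<le> (1/2) ^ Suc k" for x k
    using schoenberg_wave_bounds[of x] by (simp add: mult_left_le_one_le)
  have sumG: "summable (\<lambda>k. schoenberg_wave (3 ^ (d * k + j) * t) * (1/2) ^ Suc k)" for j t
    by (rule summable_comparison_test[OF _ sums_summable[OF half]]) (use tm in blast)
  have contG: "continuous_on UNIV (G j)" for j
  proof -
    have "uniform_limit UNIV (\<lambda>n x. \<Sum>k<n. schoenberg_wave (3 ^ (d * k + j) * x) * (1/2) ^ Suc k) (G j) sequentially"
      unfolding G_def by (rule Weierstrass_m_test[OF tm sums_summable[OF half]])
    moreover have "continuous_on UNIV (\<lambda>x. \<Sum>k<n. schoenberg_wave (3 ^ (d * k + j) * x) * (1/2) ^ Suc k)" for n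
      unfolding schoenberg_wave_def by (intro continuous_intros)
    ultimately show ?thesis
      by (intro uniform_limit_theorem[OF always_eventually]) auto
  qed
  have G_bd: "0 \<le> G j t" "G j t \<le> 1" for j t
  proof -
    show "0 \<le> G j t" unfolding G_def
      by (intro suminf_nonneg sumG) (use schoenberg_wave_bounds in auto)
    have "G j t \<le> (\<Sum>k. (1/2) ^ Suc k)" unfolding G_def
      by (intro suminf_le sumG sums_summable[OF half]) (metis abs_le_D1 real_norm_def tm)
    then show "G j t \<le> 1" using sums_unique[OF half] by simp
  qed
  \<comment> \<open>The unit cube swept out by the coordinates \<open>G\<close> is rescaled to the
    cube \<open>[-R, R]^d\<close>, which contains the ball.\<close>
  define g where "g t = (\<Sum>b\<in>Basis. (2 * R * G (e b) t - R) *\<^sub>R b)" for t :: real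
  have "continuous_on UNIV (g :: real \<Rightarrow> 'a)"
    unfolding g_def by (intro continuous_intros contG)
  moreover have "bounded (range (g :: real \<Rightarrow> 'a))"
  proof (rule boundedI)
    fix x assume "x \<in> range (g :: real \<Rightarrow> 'a)"
    then obtain t where x: "x = g t" by blast
    have "norm x \<le> (\<Sum>b\<in>(Basis::'a set). R)"
      unfolding x g_def
    proof (rule sum_norm_le)
      fix b :: 'a assume "b \<in> Basis"
      have "\<bar>2 * R * G (e b) t - R\<bar> \<le> R"
        using G_bd[of "e b" t] R mult_left_mono[of "G (e b) t" 1 R] by (auto simp: abs_le_iff)
      then show "norm ((2 * R * G (e b) t - R) *\<^sub>R b) \<le> R" using \<open>b \<in> Basis\<close> by simp
    qed
    then show "norm x \<le> R * DIM('a)" by (simp add: mult.commute)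
  qed
  moreover have "cball 0 R \<subseteq> (g :: real \<Rightarrow> 'a) ` {0..1}"
  proof
    fix y :: 'a assume y: "y \<in> cball 0 R"
    define z where "z b = (y \<bullet> b + R) / (2 * R)" for b
    have "\<exists>a::nat \<Rightarrow> bool. (\<lambda>k. of_bool (a k) * (1/2) ^ Suc k) sums z b" if "b \<in> Basis" for b
    proof (rule binary_expansion)
      have "\<bar>y \<bullet> b\<bar> \<le> R" using Basis_le_norm[OF that, of y] y by simp
      then show "0 \<le> z b" "z b \<le> 1" using R by (auto simp: z_def field_simps)
    qed
    then obtain a where a: "\<And>b. b \<in> Basis \<Longrightarrow> (\<lambda>k. of_bool (a b k) * (1/2) ^ Suc k) sums z b"
      by metis
    \<comment> \<open>The digit sequences of all coordinates are interleaved: position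
      \<open>m\<close> holds digit \<open>m div d\<close> of the coordinate with index
      \<open>m mod d\<close>.\<close>
    define A where "A m = a (inv_into Basis e (m mod d)) (m div d)" for m
    have A: "A (d * k + e b) = a b k" if "b \<in> Basis" for b k
      using e_lt[OF that] e that by (simp add: A_def bij_betw_def inv_into_f_f)
    define t where "t = (\<Sum>i. 2 * of_bool (A i) * (1/3::real) ^ Suc i)"
    note digit = schoenberg_wave_digit[where a = A, folded t_def]
    have "G (e b) t = z b" if "b \<in> Basis" for b
      using sums_unique[OF a[OF that]] by (simp add: G_def digit(3) A[OF that])
    then have "g t = (\<Sum>b\<in>Basis. (y \<bullet> b) *\<^sub>R b)"
      using R unfolding g_def by (intro sum.cong) (auto simp: z_def)
    then have "y = g t" by (simp add: euclidean_representation)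
    then show "y \<in> g ` {0..1}" using digit(1,2) by auto
  qed
  ultimately show ?thesis by blast
qed

text \<open>The least preimage is a Borel choice: apart from the points off the curve, where
  \<open>s\<close> is 0, a sublevel set of \<open>s\<close> is the compact image of an initial
  segment of the parameter interval.\<close>

lemma measurable_section_of_curve:
  fixes g :: "real \<Rightarrow> 'a::euclidean_space"
  assumes g: "continuous_on UNIV g"
  shows "\<exists>s. s \<in> borel_measurable borel \<and> (\<forall>y. 0 \<le> s y \<and> s y \<le> 1) \<and> (\<forall>y \<in> g ` {0..1}. g (s y) = y)"
proof -
  define T where "T y = {t\<in>{0..1}. g t = y}" for y
  define s where "s y = (if y \<in> g ` {0..1} then Inf (T y) else 0)" for y
  have comp: "compact (g ` {a..b})" for a b
    using g by (intro compact_continuous_image) (auto intro: continuous_on_subset)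
  have cl: "closed (T y)" for y
  proof -
    have "closed ({0..1} \<inter> g -` {y})"
      using g by (intro continuous_closed_preimage) (auto intro: continuous_on_subset)
    moreover have "{0..1} \<inter> g -` {y} = T y" by (auto simp: T_def)
    ultimately show ?thesis by simp
  qed
  have sT: "s y \<in> T y" "\<And>t. t \<in> T y \<Longrightarrow> s y \<le> t" if "y \<in> g ` {0..1}" for y
  proof -
    have ne: "T y \<noteq> {}" using that by (auto simp: T_def)
    have bdd: "bdd_below (T y)" by (rule bdd_belowI[of _ 0]) (auto simp: T_def)
    show "s y \<in> T y" using closed_contains_Inf[OF ne bdd cl] that by (simp add: s_def)
    show "\<And>t. t \<in> T y \<Longrightarrow> s y \<le> t" using that bdd by (auto simp: s_def intro: cInf_lower)
  qed
  have "s \<in> borel_measurable borel"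
  proof (rule borel_measurableI_le)
    fix c :: real
    have "{y \<in> space borel. s y \<le> c} = (if c < 0 then {} else g ` {0..min c 1} \<union> (- g ` {0..1}))"
    proof (cases "c < 0")
      case True
      then have "\<not> s y \<le> c" for y
        by (cases "y \<in> g ` {0..1}") (use sT(1)[of y] in \<open>auto simp: T_def s_def\<close>)
      then show ?thesis using True by simp
    next
      case False
      have "s y \<le> c \<longleftrightarrow> y \<in> g ` {0..min c 1} \<union> (- g ` {0..1})" for y
      proof (cases "y \<in> g ` {0..1}")
        case True
        note ys = sT[OF True]
        show ?thesis
        proof
          assume "s y \<le> c"
          with ys(1) have "s y \<in> {0..min c 1}" "g (s y) = y" by (auto simp: T_def)
          then show "y \<in> g ` {0..min c 1} \<union> (- g ` {0..1})" by (metis UnI1 image_eqI)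
        next
          assume "y \<in> g ` {0..min c 1} \<union> (- g ` {0..1})"
          then obtain t where "t \<in> {0..min c 1}" "y = g t" using True by blast
          then have "s y \<le> t" by (intro ys(2)) (auto simp: T_def)
          with \<open>t \<in> {0..min c 1}\<close> show "s y \<le> c" by auto
        qed
      qed (use False in \<open>auto simp: s_def\<close>)
      then show ?thesis using False by auto
    qed
    also have "\<dots> \<in> sets borel"
      using borel_compact[OF comp[of 0 "min c 1"]] borel_compact[OF comp[of 0 1]] by auto
    finally show "{y \<in> space borel. s y \<le> c} \<in> sets borel" .
  qed
  moreover have "0 \<le> s y \<and> s y \<le> 1" for y
    by (cases "y \<in> g ` {0..1}") (use sT(1)[of y] in \<open>auto simp: T_def s_def\<close>)
  moreover have "\<forall>y\<in>g ` {0..1}. g (s y) = y"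
    using sT(1) by (auto simp: T_def)
  ultimately show ?thesis by blast
qed

text \<open>The curve is bounded on the whole line, so \<open>\<phi> \<circ> g\<close> is bounded
  and continuous for every continuous \<open>\<phi>\<close>. Hence weak convergence of the pulled
  back measures also handles unbounded integrands, such as the pairing
  \<open>\<phi> (fst z) \<bullet> snd z\<close> used for gradients.\<close>

lemma prob_measures_on_ball_compact:
  fixes P :: "nat \<Rightarrow> 'a::euclidean_space measure"
  assumes prob: "\<And>k. prob_space (P k)" and sets: "\<And>k. sets (P k) = sets borel"
    and supp: "\<And>k. AE x in P k. norm x \<le> R"
  shows "\<exists>r Q. strict_mono (r :: nat \<Rightarrow> nat) \<and> prob_space Q \<and> sets Q = sets borel \<and>
    (\<exists>B. AE x in Q. norm x \<le> B) \<and>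
    (\<forall>\<phi> :: 'a \<Rightarrow> real. continuous_on UNIV \<phi> \<longrightarrow> (\<lambda>k. \<integral>x. \<phi> x \<partial>P (r k)) \<longlonglongrightarrow> (LINT x|Q. \<phi> x))"
proof -
  \<comment> \<open>The maximum with 1 provides the positive radius that the curve needs.\<close>
  obtain g :: "real \<Rightarrow> 'a" where g: "continuous_on UNIV g" "bounded (range g)" "cball 0 (max R 1) \<subseteq> g ` {0..1}"
    using space_filling_curve[of "max R 1", where 'a='a] by (auto simp: less_max_iff_disj)
  obtain s where [measurable]: "s \<in> borel_measurable borel" and s01: "\<And>y. 0 \<le> s y" "\<And>y. s y \<le> 1"
    and gs: "\<And>y. y \<in> g ` {0..1} \<Longrightarrow> g (s y) = y"
    using measurable_section_of_curve[OF g(1)] by blast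
  have gm[measurable]: "g \<in> borel_measurable borel" using g(1) by (rule borel_measurable_continuous_onI)
  have sm[measurable]: "s \<in> borel_measurable (P k)" for k using sets by (simp cong: measurable_cong_sets)
  define M where "M k = distr (P k) borel s" for k
  have rd: "real_distribution (M k)" for k
    unfolding M_def real_distribution_def real_distribution_axioms_def
    using prob_space.prob_space_distr[OF prob sm] by simp
  have "tight M"
    unfolding tight_def
  proof (intro conjI allI impI rd)
    fix \<epsilon> :: real assume "\<epsilon> > 0"
    \<comment> \<open>Tightness is stated with intervals open on the left, so the interval starts
      below 0, a value that \<open>s\<close> may take.\<close>
    have "measure (M n) {-1<..1} = 1" for n
    proof -
      interpret prob_space "P n" by (rule prob)
      have "-1 < s x" for x using s01(1)[of x] by linarith
      then have "s -` {-1<..1} = UNIV" using s01 by auto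
      then show ?thesis
        using prob_space sets_eq_imp_space_eq[OF sets[of n]] by (simp add: M_def measure_distr)
    qed
    then show "\<exists>a b. a < b \<and> (\<forall>n. 1 - \<epsilon> < measure (M n) {a<..b})"
      using \<open>\<epsilon> > 0\<close> by (intro exI[of _ "-1"] exI[of _ 1]) auto
  qed
  from tight_imp_convergent_subsubsequence[OF this strict_mono_id]
  obtain r L where r: "strict_mono r" and L: "real_distribution L" and wc: "weak_conv_m (M \<circ> r) L"
    by (auto simp: comp_def)
  interpret L: real_distribution L by fact
  define Q where "Q = distr L borel g"
  have pQ: "prob_space Q" unfolding Q_def by (intro L.prob_space_distr) simp
  obtain B where B: "\<And>t. norm (g t) \<le> B" using g(2) by (auto simp: bounded_iff)
  have "AE x in Q. norm x \<le> B" unfolding Q_def using B by (subst AE_distr_iff) auto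
  moreover have "(\<lambda>k. \<integral>x. \<phi> x \<partial>P (r k)) \<longlonglongrightarrow> (LINT x|Q. \<phi> x)"
    if \<phi>: "continuous_on UNIV \<phi>" for \<phi> :: "'a \<Rightarrow> real"
  proof -
    have [measurable]: "\<phi> \<in> borel_measurable borel" using \<phi> by (rule borel_measurable_continuous_onI)
    have "compact (closure (range g))" using g(2) by (simp add: compact_closure)
    then have "compact (\<phi> ` closure (range g))" 
      using \<phi> by (intro compact_continuous_image) (auto intro: continuous_on_subset)
    then have "bounded (\<phi> ` closure (range g))" by (rule compact_imp_bounded)
    then have "bounded (\<phi> ` range g)"
      by (rule bounded_subset) (intro image_mono closure_subset)
    then obtain C where C: "\<And>t. norm (\<phi> (g t)) \<le> C"
      unfolding bounded_iff by blast
    have "(\<lambda>k. \<integral>t. \<phi> (g t) \<partial>(M \<circ> r) k) \<longlonglongrightarrow> (LINT t|L. \<phi> (g t))"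
    proof (rule weak_conv_imp_integral_bdd_continuous_conv[OF _ L wc _ C])
      show "real_distribution ((M \<circ> r) n)" for n using rd by simp
      have "continuous_on UNIV (\<phi> \<circ> g)"
        using \<phi> g(1) by (intro continuous_on_compose) (auto intro: continuous_on_subset)
      then show "isCont (\<lambda>t. \<phi> (g t)) x" for x 
        by (simp add: continuous_on_eq_continuous_at comp_def)
    qed
    moreover have "(\<integral>t. \<phi> (g t) \<partial>(M \<circ> r) k) = (\<integral>x. \<phi> x \<partial>P (r k))" for k
    proof -
      have "(\<integral>t. \<phi> (g t) \<partial>(M \<circ> r) k) = (\<integral>x. \<phi> (g (s x)) \<partial>P (r k))"
        by (simp add: M_def integral_distr)
      also have "\<dots> = (\<integral>x. \<phi> x \<partial>P (r k))"
      proof (rule integral_cong_AE)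
        show "AE x in P (r k). \<phi> (g (s x)) = \<phi> x"
          using supp[of "r k"]
        proof eventually_elim
          case (elim x)
          then have "x \<in> cball 0 (max R 1)" by simp
          then show ?case using gs g(3) by auto
        qed
      qed (use sets in \<open>simp_all cong: measurable_cong_sets\<close>)
      finally show ?thesis .
    qed
    moreover have "(LINT t|L. \<phi> (g t)) = (LINT x|Q. \<phi> x)"
      by (simp add: Q_def integral_distr)
    ultimately show ?thesis by simp
  qed
  ultimately show ?thesis using r pQ by (intro exI[of _ r] exI[of _ Q]) (auto simp: Q_def)
qed

section \<open>Polar representation of vector measures\<close>

lemma integrable_bounded_mult:
  fixes f g :: "'a \<Rightarrow> real"
  assumes "integrable M f" "g \<in> borel_measurable M" "\<And>x. \<bar>g x\<bar> \<le> B"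
  shows "integrable M (\<lambda>x. g x * f x)"
proof (rule Bochner_Integration.integrable_bound)
  show "integrable M (\<lambda>x. B * f x)" using assms by simp
  show "AE x in M. norm (g x * f x) \<le> norm (B * f x)"
    using order_trans[OF assms(3) abs_ge_self] by (auto simp: abs_mult intro!: always_eventually mult_right_mono)
qed (use assms in auto)

text \<open>\<open>d\<close> is the conditional expectation of \<open>y\<close> given
  \<open>X\<close>, seen as a function on the target space: the image of \<open>y N\<close> under
  \<open>X\<close> is absolutely continuous with respect to the image of \<open>N\<close>.\<close>

lemma pushforward_density_nonneg:
  fixes y :: "'a \<Rightarrow> real" and X :: "'a \<Rightarrow> 'b::topological_space"
  assumes N: "finite_measure N" and X[measurable]: "X \<in> borel_measurable N"
    and y: "integrable N y" "\<And>x. 0 \<le> y x"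
  shows "\<exists>d. d \<in> borel_measurable borel \<and> integrable (distr N borel X) d \<and>
    (\<forall>\<psi>\<in>borel_measurable borel.
      (LINT x|N. \<psi> (X x) * y x) = (LINT x|distr N borel X. \<psi> x * d x))"
proof -
  interpret N: finite_measure N by fact
  have ym[measurable]: "y \<in> borel_measurable N" using y by auto
  define \<beta> where "\<beta> = distr N borel X"
  define \<rho> where "\<rho> = distr (density N (\<lambda>x. ennreal (y x))) borel X"
  have s\<beta>[simp, measurable_cong]: "sets \<beta> = sets borel" by (simp add: \<beta>_def)
  have Xd[measurable]: "X \<in> borel_measurable (density N (\<lambda>x. ennreal (y x)))" by simp
  interpret \<beta>: finite_measure \<beta> unfolding \<beta>_def by (rule N.finite_measure_distr) simp
  have "absolutely_continuous \<beta> \<rho>"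
    unfolding absolutely_continuous_def
  proof
    fix A assume "A \<in> null_sets \<beta>"
    then have A: "A \<in> sets borel" "emeasure N (X -` A \<inter> space N) = 0"
      by (auto simp: \<beta>_def null_sets_def emeasure_distr)
    then have "X -` A \<inter> space N \<in> null_sets N" by auto
    then have "AE x in N. x \<notin> X -` A \<inter> space N" by (rule AE_not_in)
    then have "emeasure (density N (\<lambda>x. ennreal (y x))) (X -` A \<inter> space N) = 0"
      using A by (subst emeasure_density) (auto simp: nn_integral_0_iff_AE elim: eventually_mono)
    then show "A \<in> null_sets \<rho>" using A by (auto simp: \<rho>_def null_sets_def emeasure_distr)
  qed
  then obtain H where H: "H \<in> borel_measurable \<beta>" "density \<beta> H = \<rho>"
    using \<beta>.Radon_Nikodym[of \<rho>] by (auto simp: \<rho>_def)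
  have [measurable]: "H \<in> borel_measurable borel" using H(1) by simp
  have "(\<integral>\<^sup>+x. H x \<partial>\<beta>) = emeasure (density \<beta> H) UNIV"
    using sets_eq_imp_space_eq[OF s\<beta>] by (subst emeasure_density) auto
  also have "\<dots> = (\<integral>\<^sup>+x. ennreal (y x) \<partial>N)"
    unfolding H(2) \<rho>_def by (simp add: emeasure_distr emeasure_density cong: nn_integral_cong)
  also have "\<dots> < \<infinity>" using y by (simp add: real_integrable_def less_top)
  finally have fin: "(\<integral>\<^sup>+x. H x \<partial>\<beta>) < \<infinity>" .
  then have Hfin: "AE x in \<beta>. H x \<noteq> \<infinity>" by (intro nn_integral_PInf_AE) auto
  define d where "d x = enn2real (H x)" for x
  have [measurable]: "d \<in> borel_measurable borel" unfolding d_def by measurable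
  have ae: "AE x in \<beta>. H x = ennreal (d x)"
    using Hfin by eventually_elim (simp add: d_def less_top)
  have \<rho>: "\<rho> = density \<beta> (\<lambda>x. ennreal (d x))"
    unfolding H(2)[symmetric] using ae by (intro density_cong) auto
  have "integrable \<beta> d"
  proof (rule integrableI_nonneg)
    have "(\<integral>\<^sup>+x. ennreal (d x) \<partial>\<beta>) = (\<integral>\<^sup>+x. H x \<partial>\<beta>)"
      using ae by (intro nn_integral_cong_AE) auto
    then show "(\<integral>\<^sup>+x. ennreal (d x) \<partial>\<beta>) < \<infinity>" using fin by simp
  qed (auto simp: d_def)
  moreover have "(LINT x|N. \<psi> (X x) * y x) = (LINT x|\<beta>. \<psi> x * d x)"
    if [measurable]: "\<psi> \<in> borel_measurable borel" for \<psi>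
  proof -
    have "(LINT x|\<beta>. \<psi> x * d x) = (LINT x|\<rho>. \<psi> x)"
      unfolding \<rho> by (subst integral_density) (auto simp: d_def mult.commute)
    also have "\<dots> = (\<integral>x. \<psi> (X x) \<partial>density N (\<lambda>x. ennreal (y x)))"
      unfolding \<rho>_def by (rule integral_distr) auto
    also have "\<dots> = (LINT x|N. \<psi> (X x) * y x)"
      using y(2) by (subst integral_density) (auto simp: mult.commute)
    finally show ?thesis by simp
  qed
  ultimately show ?thesis unfolding \<beta>_def by (intro exI[of _ d]) auto
qed

text \<open>Positive and negative parts are treated separately; the bound on \<open>\<psi>\<close>
  makes both products integrable, so the two identities may be subtracted.\<close>

lemma pushforward_density:
  fixes y :: "'a \<Rightarrow> real" and X :: "'a \<Rightarrow> 'b::topological_space"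
  assumes N: "finite_measure N" and X[measurable]: "X \<in> borel_measurable N"
    and y: "integrable N y"
  shows "\<exists>d. d \<in> borel_measurable borel \<and> integrable (distr N borel X) d \<and>
    (\<forall>\<psi> B. \<psi> \<in> borel_measurable borel \<longrightarrow> (\<forall>x. \<bar>\<psi> x\<bar> \<le> B) \<longrightarrow>
      (LINT x|N. \<psi> (X x) * y x) = (LINT x|distr N borel X. \<psi> x * d x))"
proof -
  let ?p = "\<lambda>x. max 0 (y x)" and ?n = "\<lambda>x. max 0 (- y x)"
  have i: "integrable N ?p" "integrable N ?n" using y by auto
  obtain p where p: "p \<in> borel_measurable borel" "integrable (distr N borel X) p"
    "\<And>\<psi>. \<psi> \<in> borel_measurable borel \<Longrightarrow>
      (LINT x|N. \<psi> (X x) * ?p x) = (LINT x|distr N borel X. \<psi> x * p x)"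
    using pushforward_density_nonneg[OF N X i(1)] by auto
  obtain n where n: "n \<in> borel_measurable borel" "integrable (distr N borel X) n"
    "\<And>\<psi>. \<psi> \<in> borel_measurable borel \<Longrightarrow>
      (LINT x|N. \<psi> (X x) * ?n x) = (LINT x|distr N borel X. \<psi> x * n x)"
    using pushforward_density_nonneg[OF N X i(2)] by auto
  have "(LINT x|N. \<psi> (X x) * y x) = (LINT x|distr N borel X. \<psi> x * (p x - n x))"
    if [measurable]: "\<psi> \<in> borel_measurable borel" and B: "\<And>x. \<bar>\<psi> x\<bar> \<le> B" for \<psi> B
  proof -
    have "(LINT x|N. \<psi> (X x) * y x) = (LINT x|N. \<psi> (X x) * ?p x - \<psi> (X x) * ?n x)"
      by (intro Bochner_Integration.integral_cong) (auto simp: max_def)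
    also have "\<dots> = (LINT x|N. \<psi> (X x) * ?p x) - (LINT x|N. \<psi> (X x) * ?n x)"
      by (intro Bochner_Integration.integral_diff integrable_bounded_mult[OF i(1), of _ B]
          integrable_bounded_mult[OF i(2), of _ B]) (use B in auto)
    also have "\<dots> = (LINT x|distr N borel X. \<psi> x * p x) - (LINT x|distr N borel X. \<psi> x * n x)"
      using p(3)[OF that(1)] n(3)[OF that(1)] by simp
    also have "\<dots> = (LINT x|distr N borel X. \<psi> x * p x - \<psi> x * n x)"
      by (intro Bochner_Integration.integral_diff[symmetric] integrable_bounded_mult[OF p(2), of _ B]
          integrable_bounded_mult[OF n(2), of _ B]) (use B in auto)
    finally show ?thesis by (simp add: right_diff_distrib)
  qed
  then show ?thesis using p(1,2) n(1,2) by (intro exI[of _ "\<lambda>x. p x - n x"]) auto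
qed

text \<open>Conditioning each component of \<open>snd\<close> on \<open>fst\<close> replaces every
  fibre of \<open>N\<close> by its barycentre \<open>D\<close>. The vector measure with density
  \<open>D\<close> then splits into its length, which gives \<open>\<nu>\<close>, and its direction
  \<open>sgn D\<close>. The indicator of \<open>\<Omega>\<close> concentrates \<open>\<nu>\<close>
  there and is invisible to integrands vanishing off \<open>\<Omega>\<close>. Opposite directions in
  a fibre may cancel, so no claim is made about the mass of \<open>\<nu>\<close>.\<close>

lemma polar_representation:
  fixes N :: "('a::euclidean_space \<times> 'b::euclidean_space) measure" and \<Omega> :: "'a set"
  assumes fin: "finite_measure N" and sets[measurable_cong]: "sets N = sets borel"
    and snd: "integrable N snd" and \<Omega>[measurable]: "\<Omega> \<in> sets borel"
  shows "\<exists>\<nu> \<sigma>. sets \<nu> = sets borel \<and> finite_measure \<nu> \<and> emeasure \<nu> (UNIV - \<Omega>) = 0 \<and>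
    \<sigma> \<in> borel_measurable borel \<and> (AE x in \<nu>. norm (\<sigma> x) = 1) \<and>
    (\<forall>\<phi> B. \<phi> \<in> borel_measurable borel \<longrightarrow> (\<forall>x. norm (\<phi> x) \<le> B) \<longrightarrow> (\<forall>x. x \<notin> \<Omega> \<longrightarrow> \<phi> x = 0) \<longrightarrow>
       (LINT z|N. \<phi> (fst z) \<bullet> snd z) = (LINT x|\<nu>. \<phi> x \<bullet> \<sigma> x))"
proof -
  have fm[measurable]: "fst \<in> borel_measurable N" and sm[measurable]: "snd \<in> borel_measurable N"
    by (auto simp: borel_prod[symmetric] measurable_cong_sets[OF sets refl])
  define \<beta> where "\<beta> = distr N borel (fst :: 'a \<times> 'b \<Rightarrow> 'a)"
  have s\<beta>[simp, measurable_cong]: "sets \<beta> = sets borel" by (simp add: \<beta>_def)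
  have "\<forall>b. \<exists>d. d \<in> borel_measurable borel \<and> integrable \<beta> d \<and>
    (\<forall>\<psi> B. \<psi> \<in> borel_measurable borel \<longrightarrow> (\<forall>x. \<bar>\<psi> x\<bar> \<le> B) \<longrightarrow>
      (LINT z|N. \<psi> (fst z) * (snd z \<bullet> b)) = (LINT x|\<beta>. \<psi> x * d x))"
    unfolding \<beta>_def by (intro allI pushforward_density[OF fin fm]) (use snd in simp)
  from choice[OF this] obtain d where d_all: "\<forall>b. d b \<in> borel_measurable borel \<and> integrable \<beta> (d b) \<and>
    (\<forall>\<psi> B. \<psi> \<in> borel_measurable borel \<longrightarrow> (\<forall>x. \<bar>\<psi> x\<bar> \<le> B) \<longrightarrow>
      (LINT z|N. \<psi> (fst z) * (snd z \<bullet> b)) = (LINT x|\<beta>. \<psi> x * d b x))"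
    ..
  have d: "d b \<in> borel_measurable borel" "integrable \<beta> (d b)"
    "\<psi> \<in> borel_measurable borel \<Longrightarrow> (\<And>x. \<bar>\<psi> x\<bar> \<le> B) \<Longrightarrow>
      (LINT z|N. \<psi> (fst z) * (snd z \<bullet> b)) = (LINT x|\<beta>. \<psi> x * d b x)" for b \<psi> B
    using d_all[rule_format, of b] by blast+
  note d(1)[measurable]
  define D where "D x = indicat_real \<Omega> x *\<^sub>R (\<Sum>b\<in>Basis. d b x *\<^sub>R b)" for x
  have [measurable]: "D \<in> borel_measurable borel" unfolding D_def by measurable
  have Di: "integrable \<beta> D"
    unfolding D_def by (intro integrable_mult_indicator Bochner_Integration.integrable_sum integrable_scaleR_left d(2)) simp
  define \<nu> where "\<nu> = density \<beta> (\<lambda>x. ennreal (norm (D x)))"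
  define \<sigma> where "\<sigma> x = sgn (D x)" for x
  have [measurable]: "\<sigma> \<in> borel_measurable borel" unfolding \<sigma>_def sgn_div_norm by measurable
  have "finite_measure \<nu>"
  proof (rule finite_measureI)
    have "emeasure \<nu> (space \<nu>) = (\<integral>\<^sup>+x. ennreal (norm (D x)) \<partial>\<beta>)"
      unfolding \<nu>_def using sets_eq_imp_space_eq[OF s\<beta>] by (subst emeasure_density) (auto intro!: nn_integral_cong)
    then show "emeasure \<nu> (space \<nu>) \<noteq> \<infinity>" using Di by (auto simp: integrable_iff_bounded)
  qed
  moreover have "emeasure \<nu> (UNIV - \<Omega>) = 0"
  proof -
    have "emeasure \<nu> (UNIV - \<Omega>) = (\<integral>\<^sup>+x. ennreal (norm (D x)) * indicator (UNIV - \<Omega>) x \<partial>\<beta>)"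
      unfolding \<nu>_def by (subst emeasure_density) auto
    also have "\<dots> = (\<integral>\<^sup>+x. 0 \<partial>\<beta>)" by (intro nn_integral_cong) (auto simp: D_def indicator_def)
    finally show ?thesis by simp
  qed
  \<comment> \<open>\<open>\<nu>\<close> does not charge the zeros of \<open>D\<close>, the only
    points where \<open>sgn D\<close> is not a unit vector.\<close>
  moreover have "AE x in \<nu>. norm (\<sigma> x) = 1"
    unfolding \<nu>_def by (subst AE_density) (auto simp: \<sigma>_def norm_sgn)
  moreover have "(LINT z|N. \<phi> (fst z) \<bullet> snd z) = (LINT x|\<nu>. \<phi> x \<bullet> \<sigma> x)"
    if \<phi>[measurable]: "\<phi> \<in> borel_measurable borel" and B: "\<And>x. norm (\<phi> x) \<le> B"
      and \<phi>0: "\<And>x. x \<notin> \<Omega> \<Longrightarrow> \<phi> x = 0" for \<phi> B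
  proof -
    have Bb: "\<bar>\<phi> x \<bullet> b\<bar> \<le> B" if "b \<in> Basis" for x b
      using Basis_le_norm[OF that, of "\<phi> x"] B[of x] by linarith
    have "(LINT z|N. \<phi> (fst z) \<bullet> snd z) = (LINT z|N. (\<Sum>b\<in>Basis. (\<phi> (fst z) \<bullet> b) * (snd z \<bullet> b)))"
      by (simp add: euclidean_inner[symmetric])
    also have "\<dots> = (\<Sum>b\<in>Basis. (LINT z|N. (\<phi> (fst z) \<bullet> b) * (snd z \<bullet> b)))"
      by (intro Bochner_Integration.integral_sum integrable_bounded_mult[where B=B]) (use snd Bb in auto)
    also have "\<dots> = (\<Sum>b\<in>Basis. (LINT x|\<beta>. (\<phi> x \<bullet> b) * d b x))"
      by (intro sum.cong refl d(3)[where B=B]) (use Bb in auto)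
    also have "\<dots> = (LINT x|\<beta>. (\<Sum>b\<in>Basis. (\<phi> x \<bullet> b) * d b x))"
      by (intro Bochner_Integration.integral_sum[symmetric] integrable_bounded_mult[where B=B]) (use d(2) Bb in auto)
    also have "\<dots> = (LINT x|\<beta>. norm (D x) * (\<phi> x \<bullet> \<sigma> x))"
    proof (intro Bochner_Integration.integral_cong refl)
      fix x
      have "norm (D x) * (\<phi> x \<bullet> \<sigma> x) = \<phi> x \<bullet> (norm (D x) *\<^sub>R sgn (D x))" by (simp add: \<sigma>_def)
      also have "norm (D x) *\<^sub>R sgn (D x) = D x" by (cases "D x = 0") (simp_all add: sgn_div_norm)
      also have "\<phi> x \<bullet> D x = (\<Sum>b\<in>Basis. (\<phi> x \<bullet> b) * d b x)"
        using \<phi>0[of x] by (cases "x \<in> \<Omega>") (auto simp: D_def inner_sum_right mult.commute)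
      finally show "(\<Sum>b\<in>Basis. (\<phi> x \<bullet> b) * d b x) = norm (D x) * (\<phi> x \<bullet> \<sigma> x)" by simp
    qed
    also have "\<dots> = (LINT x|\<nu>. \<phi> x \<bullet> \<sigma> x)"
      unfolding \<nu>_def by (subst integral_density) auto
    finally show ?thesis .
  qed
  ultimately show ?thesis by (intro exI[of _ \<nu>] exI[of _ \<sigma>]) (auto simp: \<nu>_def)
qed

section \<open>Bump functions and the total mass\<close>

abbreviation supp :: "('a::topological_space \<Rightarrow> 'b::zero) \<Rightarrow> 'a set" where
  "supp f \<equiv> closure {x. f x \<noteq> 0}"

text \<open>The gradient is an explicit continuous field, which makes closure under sums and
  compositions direct; bumps are translated to \<open>frechet_derivative\<close> only once, in
  \<open>test_fun_sum\<close>.\<close>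

definition C1_scalar :: "('a::euclidean_space \<Rightarrow> real) \<Rightarrow> bool" where
  "C1_scalar f \<longleftrightarrow> (\<exists>G. continuous_on UNIV G \<and> (\<forall>x. (f has_derivative (\<lambda>h. G x \<bullet> h)) (at x)))"

lemma C1_scalarI:
  "continuous_on UNIV G \<Longrightarrow> (\<And>x. (f has_derivative (\<lambda>h. G x \<bullet> h)) (at x)) \<Longrightarrow> C1_scalar f"
  by (auto simp: C1_scalar_def)

lemma C1_scalar_continuous: "C1_scalar f \<Longrightarrow> continuous_on UNIV f"
  by (auto simp: C1_scalar_def continuous_on_eq_continuous_at dest: has_derivative_continuous)

text \<open>Squaring removes the kink of the positive part: at 0 the difference quotient is at most
  \<open>\<bar>h\<bar>\<close>. This is a continuously differentiable substitute for truncation, and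
  test functions need no more regularity.\<close>

lemma has_derivative_pos_part_squared:
  "((\<lambda>t::real. (max 0 t)\<^sup>2) has_real_derivative 2 * max 0 t) (at t)"
proof -
  consider "t < 0" | "t = 0" | "t > 0" by linarith
  then show ?thesis
  proof cases
    case 1
    have "((\<lambda>t. 0::real) has_real_derivative 2 * max 0 t) (at t)" using 1 by (simp add: max_def)
    then show ?thesis
      by (rule DERIV_cong_ev[THEN iffD1, rotated -1, OF _ refl _ refl])
        (use 1 in \<open>auto intro!: eventually_mono[OF eventually_nhds_in_open[of "{..<0}" t]]\<close>)
  next
    case 3
    have "((\<lambda>t. t\<^sup>2) has_real_derivative 2 * max 0 t) (at t)"
      using 3 by (auto intro!: derivative_eq_intros simp: max_def)
    then show ?thesis
      by (rule DERIV_cong_ev[THEN iffD1, rotated -1, OF _ refl _ refl])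
        (use 3 in \<open>auto intro!: eventually_mono[OF eventually_nhds_in_open[of "{0<..}" t]]\<close>)
  next
    case 2
    have "((\<lambda>h. ((max 0 (0 + h))\<^sup>2 - (max 0 0)\<^sup>2) / h) \<longlongrightarrow> 0) (at (0::real))"
    proof (rule Lim_null_comparison[OF always_eventually])
      show "\<forall>h::real. norm (((max 0 (0 + h))\<^sup>2 - (max 0 0)\<^sup>2) / h) \<le> \<bar>h\<bar>"
        by (auto simp: max_def power2_eq_square)
      show "((\<lambda>h::real. \<bar>h\<bar>) \<longlongrightarrow> 0) (at 0)" by (rule tendsto_rabs_zero) (rule tendsto_ident_at)
    qed
    then show ?thesis using 2 by (simp add: DERIV_def)
  qed
qed

lemma C1_scalar_pos_part_squared:
  assumes "C1_scalar f" shows "C1_scalar (\<lambda>x. (max 0 (f x))\<^sup>2)"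
proof -
  obtain G where G: "continuous_on UNIV G" "\<And>x. (f has_derivative (\<lambda>h. G x \<bullet> h)) (at x)"
    using assms by (auto simp: C1_scalar_def)
  show ?thesis
  proof (rule C1_scalarI)
    show "continuous_on UNIV (\<lambda>x. (2 * max 0 (f x)) *\<^sub>R G x)"
      using C1_scalar_continuous[OF assms] G(1) by (intro continuous_intros)
    show "((\<lambda>x. (max 0 (f x))\<^sup>2) has_derivative (\<lambda>h. ((2 * max 0 (f x)) *\<^sub>R G x) \<bullet> h)) (at x)" for x
      using has_derivative_compose[OF G(2)[of x] has_derivative_pos_part_squared[of "f x", unfolded has_field_derivative_def]]
      by simp
  qed
qed

lemma C1_scalar_affine:
  assumes "C1_scalar f" shows "C1_scalar (\<lambda>x. a + b * f x)"
proof -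
  obtain G where G: "continuous_on UNIV G" "\<And>x. (f has_derivative (\<lambda>h. G x \<bullet> h)) (at x)"
    using assms by (auto simp: C1_scalar_def)
  show ?thesis
    by (rule C1_scalarI[where G="\<lambda>x. b *\<^sub>R G x"])
      (auto intro!: continuous_intros G(1) derivative_eq_intros G(2))
qed

lemma C1_scalar_sum:
  assumes "\<And>i. i \<in> I \<Longrightarrow> C1_scalar (f i)" shows "C1_scalar (\<lambda>x. \<Sum>i\<in>I. f i x)"
proof -
  obtain G where G: "\<And>i. i \<in> I \<Longrightarrow> continuous_on UNIV (G i)"
    "\<And>i x. i \<in> I \<Longrightarrow> (f i has_derivative (\<lambda>h. G i x \<bullet> h)) (at x)"
    using assms unfolding C1_scalar_def by metis
  show ?thesis
  proof (rule C1_scalarI)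
    show "continuous_on UNIV (\<lambda>x. \<Sum>i\<in>I. G i x)" by (intro continuous_intros G(1))
    show "((\<lambda>x. \<Sum>i\<in>I. f i x) has_derivative (\<lambda>h. (\<Sum>i\<in>I. G i x) \<bullet> h)) (at x)" for x
      unfolding inner_sum_left by (intro has_derivative_sum G(2))
  qed
qed

text \<open>Finitely many balls inside \<open>U\<close> cover \<open>K\<close>. The sum
  \<open>g\<close> of the squared positive parts of \<open>(r c)^2 - |x - c|^2\<close> vanishes off
  these balls and, by compactness, is at least some \<open>m > 0\<close> on \<open>K\<close>. Then
  \<open>1 - (max 0 (1 - g/m))^2\<close> is 1 where \<open>g \<ge> m\<close> and 0 where
  \<open>g = 0\<close>.\<close>

lemma C1_bump:
  fixes K U :: "'a::euclidean_space set"
  assumes K: "compact K" and U: "open U" and KU: "K \<subseteq> U"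
  shows "\<exists>\<eta>. C1_scalar \<eta> \<and> (\<forall>x. 0 \<le> \<eta> x \<and> \<eta> x \<le> 1) \<and> (\<forall>x\<in>K. \<eta> x = 1) \<and>
    compact (supp \<eta>) \<and> supp \<eta> \<subseteq> U"
proof -
  have "\<exists>r>0. cball x r \<subseteq> U" if "x \<in> K" for x
    using U KU that open_contains_cball by blast
  then obtain r where r: "\<And>x. x \<in> K \<Longrightarrow> r x > 0" "\<And>x. x \<in> K \<Longrightarrow> cball x (r x) \<subseteq> U" by metis
  obtain C where C: "C \<subseteq> K" "finite C" "K \<subseteq> (\<Union>c\<in>C. ball c (r c))"
    by (rule compactE_image[OF K, of K "\<lambda>c. ball c (r c)"]) (use r(1) in auto)
  define g where "g x = (\<Sum>c\<in>C. (max 0 ((r c)\<^sup>2 - (norm (x - c))\<^sup>2))\<^sup>2)" for x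
  have "C1_scalar (\<lambda>x. (r c)\<^sup>2 - (norm (x - c))\<^sup>2)" for c
  proof (rule C1_scalarI[where G="\<lambda>x. (-2) *\<^sub>R (x - c)"])
    show "((\<lambda>x. (r c)\<^sup>2 - (norm (x - c))\<^sup>2) has_derivative (\<lambda>h. ((-2) *\<^sub>R (x - c)) \<bullet> h)) (at x)" for x
      unfolding power2_norm_eq_inner
      by (auto intro!: derivative_eq_intros simp: inner_commute algebra_simps)
  qed (intro continuous_intros)
  then have C1g: "C1_scalar g" unfolding g_def
    by (intro C1_scalar_sum C1_scalar_pos_part_squared)
  have g0: "0 \<le> g x" for x unfolding g_def by (intro sum_nonneg) simp
  have gK: "0 < g x" if x: "x \<in> K" for x
  proof -
    obtain c where c: "c \<in> C" "norm (x - c) < r c" using C(3) x by (auto simp: dist_norm norm_minus_commute)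
    have "(norm (x - c))\<^sup>2 < (r c)\<^sup>2" using c(2) by (intro power_strict_mono) auto
    then show ?thesis unfolding g_def using c(1) C(2) by (intro sum_pos2[of _ c]) auto
  qed
  have gS: "x \<in> (\<Union>c\<in>C. cball c (r c))" if "g x \<noteq> 0" for x
  proof (rule ccontr)
    assume no: "x \<notin> (\<Union>c\<in>C. cball c (r c))"
    have "(max 0 ((r c)\<^sup>2 - (norm (x - c))\<^sup>2))\<^sup>2 = 0" if c: "c \<in> C" for c
    proof -
      have "r c < norm (x - c)" "0 < r c" using no c C(1) r(1) by (auto simp: dist_norm norm_minus_commute)
      then have "(r c)\<^sup>2 \<le> (norm (x - c))\<^sup>2" by (intro power_mono) auto
      then show ?thesis by simp
    qed
    then have "g x = 0" unfolding g_def by simp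
    with that show False by simp
  qed
  have "\<exists>m>0. \<forall>x\<in>K. m \<le> g x"
  proof (cases "K = {}")
    case False
    then obtain z where "z \<in> K" "\<And>x. x \<in> K \<Longrightarrow> g z \<le> g x"
      using continuous_attains_inf[OF K False, of g] C1_scalar_continuous[OF C1g] continuous_on_subset by blast
    then show ?thesis using gK by blast
  qed (auto intro: exI[of _ 1])
  then obtain m where m: "m > 0" "\<And>x. x \<in> K \<Longrightarrow> m \<le> g x" by blast
  define \<eta> where "\<eta> x = 1 + (-1) * (max 0 (1 + (-1/m) * g x))\<^sup>2" for x
  have "C1_scalar \<eta>" unfolding \<eta>_def by (intro C1_scalar_affine C1_scalar_pos_part_squared C1g)
  moreover have "0 \<le> \<eta> x \<and> \<eta> x \<le> 1" for x
  proof -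
    have "max 0 (1 + (-1/m) * g x) \<le> 1" "0 \<le> max 0 (1 + (-1/m) * g x)" using g0[of x] m by auto
    then have "(max 0 (1 + (-1/m) * g x))\<^sup>2 \<le> 1" by (rule power_le_one[rotated])
    then show ?thesis by (simp add: \<eta>_def)
  qed
  moreover have "\<forall>x\<in>K. \<eta> x = 1"
  proof
    fix x assume "x \<in> K"
    then have "1 + (-1/m) * g x \<le> 0" using m by (simp add: field_simps)
    then show "\<eta> x = 1" by (simp add: \<eta>_def max_def)
  qed
  moreover have "supp \<eta> \<subseteq> (\<Union>c\<in>C. cball c (r c))"
    by (rule closure_minimal) (use gS C(2) in \<open>force simp: \<eta>_def\<close>, use C(2) in auto)
  moreover have "(\<Union>c\<in>C. cball c (r c)) \<subseteq> U" using r(2) C(1) by blast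
  moreover have "compact (\<Union>c\<in>C. cball c (r c))" using C(2) by auto
  ultimately show ?thesis
    by (meson closure_subset compact_closure compact_imp_bounded bounded_subset subset_trans)
qed

text \<open>Open Voronoi cells: \<open>U i\<close> consists of the points strictly closer to
  \<open>K i\<close> than to every other \<open>K j\<close>. The sets must be nonempty because
  \<open>infdist\<close> to the empty set is 0 by convention.\<close>

lemma disjoint_open_nbhds:
  fixes K :: "'i \<Rightarrow> 'a::euclidean_space set"
  assumes fin: "finite I" and K: "\<And>i. i \<in> I \<Longrightarrow> compact (K i)" "\<And>i. i \<in> I \<Longrightarrow> K i \<noteq> {}"
    and disj: "disjoint_family_on K I"
  shows "\<exists>U. (\<forall>i\<in>I. open (U i) \<and> K i \<subseteq> U i) \<and> disjoint_family_on U I"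
proof -
  define U where "U i = (\<Inter>j\<in>I - {i}. {x. infdist x (K i) < infdist x (K j)})" for i
  have "open (U i)" if "i \<in> I" for i
    unfolding U_def using fin by (intro open_INT) (auto intro!: open_Collect_less continuous_intros)
  moreover have "K i \<subseteq> U i" if "i \<in> I" for i
    unfolding U_def
  proof (intro subsetI INT_I CollectI)
    fix x j assume x: "x \<in> K i" and "j \<in> I - {i}"
    then have j: "j \<in> I" "j \<noteq> i" by auto
    then have "x \<notin> K j" using disj that x by (auto simp: disjoint_family_on_def)
    then have "0 < infdist x (K j)"
      using K j by (metis compact_imp_closed in_closed_iff_infdist_zero infdist_nonneg less_eq_real_def)
    then show "infdist x (K i) < infdist x (K j)" using x by simp
  qed
  moreover have "disjoint_family_on U I"
    unfolding disjoint_family_on_def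
  proof (intro ballI impI equals0I)
    fix i j x assume "i \<in> I" "j \<in> I" "i \<noteq> j" "x \<in> U i \<inter> U j"
    then have "infdist x (K i) < infdist x (K j)" "infdist x (K j) < infdist x (K i)"
      unfolding U_def by blast+
    then show False by simp
  qed
  ultimately show ?thesis by blast
qed

lemma test_fun_sum:
  fixes c :: "'i \<Rightarrow> real^'n^'m" and \<eta> :: "'i \<Rightarrow> real^'n \<Rightarrow> real"
  assumes fin: "finite I" and C1: "\<And>i. i \<in> I \<Longrightarrow> C1_scalar (\<eta> i)"
    and cp: "\<And>i. i \<in> I \<Longrightarrow> compact (supp (\<eta> i))"
    and sub: "\<And>i. i \<in> I \<Longrightarrow> supp (\<eta> i) \<subseteq> \<Omega>"
  shows "test_fun \<Omega> (\<lambda>x. \<Sum>i\<in>I. \<eta> i x *\<^sub>R c i)"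
proof -
  let ?\<phi> = "\<lambda>x. \<Sum>i\<in>I. \<eta> i x *\<^sub>R c i"
  obtain G where G: "\<And>i. i \<in> I \<Longrightarrow> continuous_on UNIV (G i)"
    "\<And>i x. i \<in> I \<Longrightarrow> (\<eta> i has_derivative (\<lambda>h. G i x \<bullet> h)) (at x)"
    using C1 unfolding C1_scalar_def by metis
  have der: "(?\<phi> has_derivative (\<lambda>h. \<Sum>i\<in>I. (G i x \<bullet> h) *\<^sub>R c i)) (at x)" for x
    by (intro has_derivative_sum has_derivative_scaleR_left G(2))
  have supp: "supp ?\<phi> \<subseteq> (\<Union>i\<in>I. supp (\<eta> i))"
  proof (rule closure_minimal)
    show "{x. ?\<phi> x \<noteq> 0} \<subseteq> (\<Union>i\<in>I. supp (\<eta> i))"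
    proof
      fix x assume "x \<in> {x. ?\<phi> x \<noteq> 0}"
      then obtain i where "i \<in> I" "\<eta> i x \<noteq> 0" by (force intro: ccontr sum.neutral)
      then show "x \<in> (\<Union>i\<in>I. supp (\<eta> i))"
        using closure_subset[of "{x. \<eta> i x \<noteq> 0}"] by blast
    qed
  qed (use fin in auto)
  show ?thesis
    unfolding test_fun_def
  proof (intro conjI allI)
    have "compact (\<Union>i\<in>I. supp (\<eta> i))" using fin cp by auto
    then show "compact (supp ?\<phi>)" 
      using supp by (meson closure_subset compact_closure compact_imp_bounded bounded_subset subset_trans)
    show "supp ?\<phi> \<subseteq> \<Omega>" using supp sub by blast
    show "?\<phi> differentiable at x" for x using der differentiable_def by blast
    have "frechet_derivative ?\<phi> (at x) = (\<lambda>h. \<Sum>i\<in>I. (G i x \<bullet> h) *\<^sub>R c i)" for x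
      using frechet_derivative_at[OF der] by simp
    then show "continuous_on UNIV (\<lambda>x. frechet_derivative ?\<phi> (at x) (axis j 1))" for j
      by (simp, intro continuous_intros G(1))
  qed
qed

text \<open>By inner regularity \<open>\<sigma>\<close> is nearly constant on each of finitely many disjoint compact sets
  carrying almost all of \<open>\<nu>\<close>; bumps with disjoint supports glue these constants to a test function.\<close>

lemma mass_le_of_test_functions:
  fixes \<nu> :: "(real^'n) measure" and \<sigma> :: "real^'n \<Rightarrow> real^'n^'m"
  assumes \<Omega>: "open \<Omega>" and sets[measurable_cong]: "sets \<nu> = sets borel" and fin: "finite_measure \<nu>"
    and conc: "emeasure \<nu> (UNIV - \<Omega>) = 0" and \<sigma>[measurable]: "\<sigma> \<in> borel_measurable borel"
    and \<sigma>1: "AE x in \<nu>. norm (\<sigma> x) = 1"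
    and le: "\<And>\<phi>. test_fun \<Omega> \<phi> \<Longrightarrow> (\<forall>x. norm (\<phi> x) \<le> 1) \<Longrightarrow> (LINT x|\<nu>. \<phi> x \<bullet> \<sigma> x) \<le> C"
  shows "measure \<nu> UNIV \<le> C"
proof (rule field_le_epsilon)
  fix e :: real assume e: "e > 0"
  interpret \<nu>: finite_measure \<nu> by fact
  have sp: "space \<nu> = UNIV" using sets_eq_imp_space_eq[OF sets] by simp
  define m where "m = measure \<nu> UNIV"
  have m0: "m \<ge> 0" by (simp add: m_def)
  \<comment> \<open>The final loss is \<open>d * m\<close> from replacing \<open>\<sigma>\<close> by
    constants plus \<open>2 * d\<close> from the uncovered set, hence \<open>d * (m + 2) = e\<close>
    in total.\<close>
  define d where "d = e / (m + 2)"
  have d: "d > 0" using e m0 by (simp add: d_def)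
  obtain c where c: "c \<subseteq> cball 0 1" "finite c" "(cball 0 1 :: (real^'n^'m) set) \<subseteq> (\<Union>y\<in>c. ball y d)"
    by (rule compactE_image[OF compact_cball, of "cball 0 1" "\<lambda>y. ball y d" 0 1]) (use d in auto)
  obtain f :: "nat \<Rightarrow> real^'n^'m" and n where f: "c = f ` {..<n}"
    using finite_imp_nat_seg_image_inj_on[OF c(2)] by (metis lessThan_def)
  \<comment> \<open>Each point is assigned to the first ball of the cover that contains
    \<open>\<sigma> x\<close>, which makes the pieces disjoint.\<close>
  define A where "A i = \<Omega> \<inter> \<sigma> -` (ball (f i) d - (\<Union>j<i. ball (f j) d))" for i
  have [measurable]: "\<Omega> \<in> sets borel" using \<Omega> by simp
  have A[measurable]: "A i \<in> sets borel" for i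
  proof -
    have "\<sigma> -` (ball (f i) d - (\<Union>j<i. ball (f j) d)) \<inter> space borel \<in> sets borel"
      by (rule measurable_sets[OF \<sigma>]) auto
    then show ?thesis unfolding A_def by auto
  qed
  have Adisj: "A i \<inter> A j = {}" if "i \<noteq> j" for i j
    using that by (cases "i < j") (auto simp: A_def)
  have Acov: "x \<in> (\<Union>i<n. A i)" if "x \<in> \<Omega>" "norm (\<sigma> x) = 1" for x
  proof -
    have "\<exists>i. i < n \<and> \<sigma> x \<in> ball (f i) d" using c(3) that(2) unfolding f by (force simp: subset_iff)
    then obtain i where i: "i < n" "\<sigma> x \<in> ball (f i) d" "\<And>j. j < i \<Longrightarrow> \<not> (j < n \<and> \<sigma> x \<in> ball (f j) d)"
      using exists_least_iff[of "\<lambda>i. i < n \<and> \<sigma> x \<in> ball (f i) d"] by blast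
    then have "x \<in> A i" using that(1) by (auto simp: A_def)
    then show ?thesis using i(1) by blast
  qed
  \<comment> \<open>The \<open>n\<close> pieces share the allowance \<open>d\<close>; dividing by
    \<open>n + 1\<close> also covers \<open>n = 0\<close>.\<close>
  have "\<exists>K. K \<subseteq> A i \<and> compact K \<and> measure \<nu> (A i) < measure \<nu> K + d / (real n + 1)" for i
  proof -
    have pos: "d / (real n + 1) > 0" using d by simp
    have eq: "emeasure \<nu> (A i) = (SUP K \<in> {K. K \<subseteq> A i \<and> compact K}. emeasure \<nu> K)"
      by (rule inner_regular[OF sets]) (use \<nu>.emeasure_finite[of UNIV] sp in auto)
    show ?thesis
    proof (rule ccontr)
      assume *: "\<not> ?thesis"
      have "emeasure \<nu> K \<le> ennreal (measure \<nu> (A i) - d / (real n + 1))" if "K \<subseteq> A i" "compact K" for K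
        using * that by (force simp: \<nu>.emeasure_eq_measure intro!: ennreal_leI)
      then have le: "emeasure \<nu> (A i) \<le> ennreal (measure \<nu> (A i) - d / (real n + 1))"
        by (subst eq, intro SUP_least) auto
      have "\<not> measure \<nu> (A i) < measure \<nu> {} + d / (real n + 1)"
        using *[unfolded not_ex, rule_format, of "{}"] by simp
      then have "measure \<nu> (A i) - d / (real n + 1) \<ge> 0" by simp
      with le have "measure \<nu> (A i) \<le> measure \<nu> (A i) - d / (real n + 1)"
        by (simp add: \<nu>.emeasure_eq_measure)
      with pos show False by simp
    qed
  qed
  then obtain K where K: "\<And>i. K i \<subseteq> A i" "\<And>i. compact (K i)"
      "\<And>i. measure \<nu> (A i) < measure \<nu> (K i) + d / (real n + 1)"
    by metis
  have Ks[measurable]: "K i \<in> sets borel" for i using K(2) by (rule borel_compact)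
  \<comment> \<open>Empty compact sets are dropped, since the separation by distances requires
    nonempty ones.\<close>
  define I where "I = {i. i < n \<and> K i \<noteq> {}}"
  have finI: "finite I" by (simp add: I_def)
  have "\<exists>U. (\<forall>i\<in>I. open (U i) \<and> K i \<subseteq> U i) \<and> disjoint_family_on U I"
  proof (rule disjoint_open_nbhds[OF finI])
    show "disjoint_family_on K I"
      unfolding disjoint_family_on_def
    proof (intro ballI impI)
      fix i j :: nat assume "i \<noteq> j"
      from Adisj[OF this] show "K i \<inter> K j = {}" using K(1)[of i] K(1)[of j] by blast
    qed
  qed (use K(2) in \<open>auto simp: I_def\<close>)
  then obtain U where U: "\<And>i. i \<in> I \<Longrightarrow> open (U i)" "\<And>i. i \<in> I \<Longrightarrow> K i \<subseteq> U i" "disjoint_family_on U I"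
    by blast
  have "\<exists>\<eta>. C1_scalar \<eta> \<and> (\<forall>x. 0 \<le> \<eta> x \<and> \<eta> x \<le> 1) \<and> (\<forall>x\<in>K i. \<eta> x = 1) \<and>
    compact (supp \<eta>) \<and> supp \<eta> \<subseteq> U i \<inter> \<Omega>" if "i \<in> I" for i
    by (rule C1_bump[OF K(2)]) (use U that \<Omega> K(1)[of i] in \<open>auto simp: A_def\<close>)
  then have "\<exists>\<eta>. \<forall>i\<in>I. C1_scalar (\<eta> i) \<and> (\<forall>x. 0 \<le> \<eta> i x \<and> \<eta> i x \<le> 1) \<and> (\<forall>x\<in>K i. \<eta> i x = 1) \<and>
    compact (supp (\<eta> i)) \<and> supp (\<eta> i) \<subseteq> U i \<inter> \<Omega>"
    by (intro bchoice ballI)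
  then obtain \<eta> where \<eta>_all: "\<forall>i\<in>I. C1_scalar (\<eta> i) \<and> (\<forall>x. 0 \<le> \<eta> i x \<and> \<eta> i x \<le> 1) \<and> (\<forall>x\<in>K i. \<eta> i x = 1) \<and>
    compact (supp (\<eta> i)) \<and> supp (\<eta> i) \<subseteq> U i \<inter> \<Omega>" ..
  have \<eta>: "C1_scalar (\<eta> i)" "0 \<le> \<eta> i x \<and> \<eta> i x \<le> 1" "x \<in> K i \<Longrightarrow> \<eta> i x = 1"
    "compact (supp (\<eta> i))" "supp (\<eta> i) \<subseteq> U i \<inter> \<Omega>" if "i \<in> I" for i x
    using bspec[OF \<eta>_all that] by simp_all
  define \<phi> where "\<phi> x = (\<Sum>i\<in>I. \<eta> i x *\<^sub>R f i)" for x
  have test: "test_fun \<Omega> \<phi>"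
    unfolding \<phi>_def by (rule test_fun_sum[OF finI]) (use \<eta> in simp_all)
  have f1: "norm (f i) \<le> 1" if "i \<in> I" for i using c(1) that unfolding f I_def by auto
  have single: "\<phi> x = \<eta> i x *\<^sub>R f i" if "i \<in> I" "\<eta> i x \<noteq> 0" for x i
  proof -
    have U': "x \<in> U j" if "j \<in> I" "\<eta> j x \<noteq> 0" for j
      using \<eta>(5)[OF that(1)] closure_subset[of "{x. \<eta> j x \<noteq> 0}"] that(2) by auto
    have "\<eta> j x = 0" if "j \<in> I" "j \<noteq> i" for j
      using U'[OF that(1)] U'[OF \<open>i \<in> I\<close> \<open>\<eta> i x \<noteq> 0\<close>] U(3) that \<open>i \<in> I\<close>
      by (auto simp: disjoint_family_on_def)
    then have "\<phi> x = (\<Sum>j\<in>{i}. \<eta> j x *\<^sub>R f j)"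
      unfolding \<phi>_def using that finI by (intro sum.mono_neutral_right) auto
    then show ?thesis by simp
  qed
  have \<phi>1: "norm (\<phi> x) \<le> 1" for x
  proof (cases "\<exists>i\<in>I. \<eta> i x \<noteq> 0")
    case True
    then obtain i where i: "i \<in> I" "\<eta> i x \<noteq> 0" by blast
    show ?thesis using single[OF i] \<eta>(2)[OF i(1), of x] f1[OF i(1)] by (simp add: mult_le_one)
  qed (simp add: \<phi>_def)
  have "continuous_on UNIV \<phi>" unfolding \<phi>_def
    by (intro continuous_intros C1_scalar_continuous \<eta>(1))
  then have [measurable]: "\<phi> \<in> borel_measurable borel" by (rule borel_measurable_continuous_onI)
  define W where "W = (\<Union>i<n. A i) - (\<Union>i<n. K i)"
  have W[measurable]: "W \<in> sets borel" unfolding W_def by measurable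
  \<comment> \<open>On a compact piece \<open>\<phi>\<close> equals \<open>f i\<close>, which is
    within \<open>d\<close> of the unit vector \<open>\<sigma> x\<close>. On the exceptional set
    \<open>W\<close> only \<open>\<phi> x \<bullet> \<sigma> x \<ge> -1\<close> is known, which the
    deduction of 2 absorbs.\<close>
  have lower: "AE x in \<nu>. (1 - d) - 2 * indicator W x \<le> \<phi> x \<bullet> \<sigma> x"
  proof -
    have "AE x in \<nu>. x \<in> \<Omega>"
      using conc sp by (intro AE_I'[of "UNIV - \<Omega>"]) (auto simp: null_sets_def)
    with \<sigma>1 show ?thesis
    proof eventually_elim
      case (elim x)
      have ge: "- 1 \<le> \<phi> x \<bullet> \<sigma> x"
        using Cauchy_Schwarz_ineq2[of "\<phi> x" "\<sigma> x"] \<phi>1[of x] elim(1) by simp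
      show ?case
      proof (cases "x \<in> W")
        case True
        then show ?thesis using ge d by simp
      next
        case False
        then obtain i where i: "i < n" "x \<in> K i" using Acov[OF elim(2) elim(1)] by (auto simp: W_def)
        then have iI: "i \<in> I" by (auto simp: I_def)
        have \<phi>x: "\<phi> x = f i" using single[OF iI, of x] \<eta>(3)[OF iI i(2)] by simp
        have "norm (f i - \<sigma> x) < d" using K(1)[of i] i(2) by (auto simp: A_def dist_norm)
        then have "\<bar>(f i - \<sigma> x) \<bullet> \<sigma> x\<bar> \<le> d"
          using Cauchy_Schwarz_ineq2[of "f i - \<sigma> x" "\<sigma> x"] elim(1) by simp
        moreover have "\<sigma> x \<bullet> \<sigma> x = 1" using elim(1) by (simp add: norm_eq_1)
        ultimately have "1 - d \<le> f i \<bullet> \<sigma> x" by (simp add: inner_diff_left)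
        then show ?thesis using False \<phi>x by simp
      qed
    qed
  qed
  have W_small: "measure \<nu> W \<le> d"
  proof -
    have "measure \<nu> W \<le> measure \<nu> (\<Union>i<n. A i - K i)"
      by (intro \<nu>.finite_measure_mono) (auto simp: W_def)
    also have "\<dots> \<le> (\<Sum>i<n. measure \<nu> (A i - K i))"
      by (intro \<nu>.finite_measure_subadditive_finite) auto
    also have "\<dots> \<le> (\<Sum>i<n. d / (real n + 1))"
    proof (rule sum_mono)
      fix i
      have "measure \<nu> (A i - K i) = measure \<nu> (A i) - measure \<nu> (K i)"
        using K(1)[of i] by (intro \<nu>.finite_measure_Diff) auto
      then show "measure \<nu> (A i - K i) \<le> d / (real n + 1)" using K(3)[of i] by simp
    qed
    also have "\<dots> \<le> d" using d by (simp add: field_simps)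
    finally show ?thesis .
  qed
  have Wi: "integrable \<nu> (indicat_real W)"
    by (rule integrable_real_indicator) (simp_all add: sets less_top[symmetric])
  have "(1 - d) * m - 2 * d \<le> (1 - d) * m - 2 * measure \<nu> W" using W_small by simp
  also have "\<dots> = (LINT x|\<nu>. (1 - d) - 2 * indicator W x)"
    by (subst Bochner_Integration.integral_diff) (use Wi in \<open>auto simp: m_def sp mult.commute\<close>)
  also have "\<dots> \<le> (LINT x|\<nu>. \<phi> x \<bullet> \<sigma> x)"
  proof (rule integral_mono_AE[OF _ _ lower])
    show "integrable \<nu> (\<lambda>x. 1 - d - 2 * indicat_real W x)" using Wi by simp
    show "integrable \<nu> (\<lambda>x. \<phi> x \<bullet> \<sigma> x)"
    proof (rule \<nu>.integrable_const_bound[of _ 1])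
      show "AE x in \<nu>. norm (\<phi> x \<bullet> \<sigma> x) \<le> 1"
        using \<sigma>1
      proof eventually_elim
        case (elim x)
        then show ?case using Cauchy_Schwarz_ineq2[of "\<phi> x" "\<sigma> x"] \<phi>1[of x] by simp
      qed
    qed simp
  qed
  also have "\<dots> \<le> C" using le test \<phi>1 by blast
  finally have "m - d * (m + 2) \<le> C" by (simp add: algebra_simps)
  moreover have "d * (m + 2) = e" using m0 by (simp add: d_def)
  ultimately show "measure \<nu> UNIV \<le> C + e" by (simp add: m_def)
qed

section \<open>Gradient measures of sums and limits\<close>

lemma test_fun_continuous: "test_fun \<Omega> \<phi> \<Longrightarrow> continuous_on UNIV \<phi>"
  by (auto simp: test_fun_def continuous_on_eq_continuous_at intro: differentiable_imp_continuous_within)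

lemma test_fun_measurable: "test_fun \<Omega> \<phi> \<Longrightarrow> \<phi> \<in> borel_measurable borel"
  by (intro borel_measurable_continuous_onI test_fun_continuous)

lemma test_fun_zero: "test_fun \<Omega> \<phi> \<Longrightarrow> x \<notin> \<Omega> \<Longrightarrow> \<phi> x = 0"
  unfolding test_fun_def using closure_subset[of "{x. \<phi> x \<noteq> 0}"] by blast

lemma bounded_of_support:
  fixes f :: "'a::euclidean_space \<Rightarrow> 'b::real_normed_vector"
  assumes "continuous_on UNIV f" "compact K" "\<And>x. x \<notin> K \<Longrightarrow> f x = 0"
  shows "\<exists>B. \<forall>x. norm (f x) \<le> B"
proof -
  have "bounded (f ` K)"
    using assms by (intro compact_imp_bounded compact_continuous_image) (auto intro: continuous_on_subset)
  then obtain B where "\<And>x. x \<in> K \<Longrightarrow> norm (f x) \<le> B" by (auto simp: bounded_iff)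
  then have "norm (f x) \<le> max B 0" for x using assms(3)[of x] by (cases "x \<in> K") (auto simp: le_max_iff_disj)
  then show ?thesis by blast
qed

lemma test_fun_bounded: "test_fun \<Omega> \<phi> \<Longrightarrow> \<exists>B. \<forall>x. norm (\<phi> x) \<le> B"
  using closure_subset[of "{x. \<phi> x \<noteq> 0}"]
  by (intro bounded_of_support[where K="supp \<phi>"] test_fun_continuous) (auto simp: test_fun_def)

lemma mdiv_continuous: "test_fun \<Omega> \<phi> \<Longrightarrow> continuous_on UNIV (mdiv \<phi>)"
  unfolding mdiv_def test_fun_def by (intro continuous_intros continuous_on_vec_lambda) auto

lemma mdiv_bounded:
  assumes "test_fun \<Omega> \<phi>" shows "\<exists>B. \<forall>x. norm (mdiv \<phi> x) \<le> B"
proof (rule bounded_of_support[OF mdiv_continuous[OF assms]])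
  let ?K = "supp \<phi>"
  show "compact ?K" using assms by (auto simp: test_fun_def)
  fix x assume x: "x \<notin> ?K"
  have "(\<phi> has_derivative (\<lambda>h. 0)) (at x)"
  proof (rule has_derivative_transform_within_open[OF has_derivative_const[of 0]])
    show "open (- ?K)" "x \<in> - ?K" using x by auto
    show "\<And>y. y \<in> - ?K \<Longrightarrow> 0 = \<phi> y" using closure_subset[of "{x. \<phi> x \<noteq> 0}"] by auto
  qed
  then have "frechet_derivative \<phi> (at x) = (\<lambda>h. 0)" using frechet_derivative_at by metis
  then show "mdiv \<phi> x = 0" by (simp add: mdiv_def vec_eq_iff)
qed

lemma borel_measurable_lebesgue_on:
  "f \<in> borel_measurable borel \<Longrightarrow> f \<in> borel_measurable (lebesgue_on \<Omega>)"
  by (intro measurable_restrict_space1 measurable_completion) simp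

lemma integrable_inner_bounded:
  fixes w h :: "'a \<Rightarrow> 'b::euclidean_space"
  assumes "integrable M w" "h \<in> borel_measurable M" "\<And>x. norm (h x) \<le> B"
  shows "integrable M (\<lambda>x. w x \<bullet> h x)"
proof (rule Bochner_Integration.integrable_bound)
  show "integrable M (\<lambda>x. B * norm (w x))" using assms by simp
  have "norm (w x \<bullet> h x) \<le> norm (B * norm (w x))" for x
  proof -
    have "\<bar>w x \<bullet> h x\<bar> \<le> norm (w x) * B"
      using Cauchy_Schwarz_ineq2[of "w x" "h x"] mult_left_mono[OF assms(3)[of x] norm_ge_zero[of "w x"]] by linarith
    also have "\<dots> \<le> \<bar>B * norm (w x)\<bar>" by (simp add: mult.commute)
    finally show ?thesis by simp
  qed
  then show "AE x in M. norm (w x \<bullet> h x) \<le> norm (B * norm (w x))" by blast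
qed (use assms in auto)

lemma integrable_mdiv:
  assumes "test_fun \<Omega> \<phi>" "integrable (lebesgue_on \<Omega>) w"
  shows "integrable (lebesgue_on \<Omega>) (\<lambda>x. w x \<bullet> mdiv \<phi> x)"
proof -
  obtain B where "\<And>x. norm (mdiv \<phi> x) \<le> B" using mdiv_bounded[OF assms(1)] by blast
  then show ?thesis
    using assms by (intro integrable_inner_bounded[where B=B] borel_measurable_lebesgue_on
        borel_measurable_continuous_onI mdiv_continuous[of \<Omega>])
qed

lemma mdiv_pairing_tendsto:
  assumes \<phi>: "test_fun \<Omega> \<phi>" and wk: "\<And>k. integrable (lebesgue_on \<Omega>) (w k)" and w: "integrable (lebesgue_on \<Omega>) v"
    and lim: "(\<lambda>k. \<integral>x. norm (w k x - v x) \<partial>lebesgue_on \<Omega>) \<longlonglongrightarrow> 0"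
  shows "(\<lambda>k. \<integral>x. w k x \<bullet> mdiv \<phi> x \<partial>lebesgue_on \<Omega>) \<longlonglongrightarrow> (LINT x|lebesgue_on \<Omega>. v x \<bullet> mdiv \<phi> x)"
proof -
  obtain B where B: "\<And>x. norm (mdiv \<phi> x) \<le> B" using mdiv_bounded[OF \<phi>] by blast
  have "(\<lambda>k. (LINT x|lebesgue_on \<Omega>. w k x \<bullet> mdiv \<phi> x) - (LINT x|lebesgue_on \<Omega>. v x \<bullet> mdiv \<phi> x)) \<longlonglongrightarrow> 0"
  proof (rule Lim_null_comparison[OF always_eventually])
    show "(\<lambda>k. B * (LINT x|lebesgue_on \<Omega>. norm (w k x - v x))) \<longlonglongrightarrow> 0"
      using tendsto_mult_left[OF lim, of B] by simp
    show "\<forall>k. norm ((LINT x|lebesgue_on \<Omega>. w k x \<bullet> mdiv \<phi> x) - (LINT x|lebesgue_on \<Omega>. v x \<bullet> mdiv \<phi> x))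
        \<le> B * (LINT x|lebesgue_on \<Omega>. norm (w k x - v x))"
    proof
      fix k
      have "(LINT x|lebesgue_on \<Omega>. w k x \<bullet> mdiv \<phi> x) - (LINT x|lebesgue_on \<Omega>. v x \<bullet> mdiv \<phi> x)
        = (LINT x|lebesgue_on \<Omega>. (w k x - v x) \<bullet> mdiv \<phi> x)"
        unfolding inner_diff_left
        by (intro Bochner_Integration.integral_diff[symmetric] integrable_mdiv \<phi> wk w)
      also have "norm \<dots> \<le> (LINT x|lebesgue_on \<Omega>. norm ((w k x - v x) \<bullet> mdiv \<phi> x))"
        by (rule integral_norm_bound)
      also have "\<dots> \<le> (LINT x|lebesgue_on \<Omega>. B * norm (w k x - v x))"
      proof (rule integral_mono)
        fix x
        show "norm ((w k x - v x) \<bullet> mdiv \<phi> x) \<le> B * norm (w k x - v x)"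
          using Cauchy_Schwarz_ineq2[of "w k x - v x" "mdiv \<phi> x"]
            mult_left_mono[OF B[of x] norm_ge_zero[of "w k x - v x"]] by (simp add: mult.commute)
      qed (use wk w in \<open>auto intro!: integrable_mdiv \<phi>\<close>)
      finally show "norm ((LINT x|lebesgue_on \<Omega>. w k x \<bullet> mdiv \<phi> x) - (LINT x|lebesgue_on \<Omega>. v x \<bullet> mdiv \<phi> x))
        \<le> B * (LINT x|lebesgue_on \<Omega>. norm (w k x - v x))" by simp
    qed
  qed
  then show ?thesis by (rule LIM_zero_cancel)
qed

text \<open>Together with \<open>grad_repr_pairing_le\<close> this determines the mass of every
  representation from the function \<open>w\<close> alone. Two representations of the same function
  therefore have equal mass, and bounds on pairings that survive averaging or limits become bounds
  on masses.\<close>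

lemma grad_repr_mass_le:
  assumes "open \<Omega>" "grad_repr \<Omega> w \<nu> \<sigma>"
    and "\<And>\<phi>. test_fun \<Omega> \<phi> \<Longrightarrow> (\<forall>x. norm (\<phi> x) \<le> 1) \<Longrightarrow> - (LINT x|lebesgue_on \<Omega>. w x \<bullet> mdiv \<phi> x) \<le> C"
  shows "measure \<nu> UNIV \<le> C"
  by (rule mass_le_of_test_functions[OF assms(1), of \<nu> \<sigma>])
    (use assms(2,3) in \<open>auto simp: grad_repr_def\<close>)

lemma grad_repr_pairing_le:
  assumes r: "grad_repr \<Omega> w \<nu> \<sigma>" and \<phi>: "test_fun \<Omega> \<phi>" and bd: "\<And>x. norm (\<phi> x) \<le> B"
  shows "- (LINT x|lebesgue_on \<Omega>. w x \<bullet> mdiv \<phi> x) \<le> B * measure \<nu> UNIV"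
proof -
  from r have sets[measurable_cong]: "sets \<nu> = sets borel" and "finite_measure \<nu>"
    and [measurable]: "\<sigma> \<in> borel_measurable borel" and \<sigma>1: "AE x in \<nu>. norm (\<sigma> x) = 1"
    and eq: "(LINT x|lebesgue_on \<Omega>. w x \<bullet> mdiv \<phi> x) = - (LINT x|\<nu>. \<phi> x \<bullet> \<sigma> x)"
    using \<phi> by (auto simp: grad_repr_def)
  interpret \<nu>: finite_measure \<nu> by fact
  have [measurable]: "\<phi> \<in> borel_measurable borel"
    using \<phi> by (rule test_fun_measurable)
  have "AE x in \<nu>. norm (\<phi> x \<bullet> \<sigma> x) \<le> B"
    using \<sigma>1
  proof eventually_elim
    case (elim x)
    then show ?case using Cauchy_Schwarz_ineq2[of "\<phi> x" "\<sigma> x"] bd[of x] by simp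
  qed
  then have "integrable \<nu> (\<lambda>x. \<phi> x \<bullet> \<sigma> x)" "AE x in \<nu>. \<phi> x \<bullet> \<sigma> x \<le> B"
    by (auto intro!: \<nu>.integrable_const_bound[of _ B])
  then have "(LINT x|\<nu>. \<phi> x \<bullet> \<sigma> x) \<le> (LINT x|\<nu>. B)" by (intro integral_mono_AE) auto
  then show ?thesis using eq sets_eq_imp_space_eq[OF sets] by (simp add: mult.commute)
qed

text \<open>The passage from a measure on pairs, where directions over a point may vary in number
  and length, back to a polar representation. Test functions qualify as integrands because they are
  bounded, Borel and zero off \<open>\<Omega>\<close>.\<close>

lemma grad_repr_of_measure:
  fixes N :: "((real^'n) \<times> (real^'n^'m)) measure"
  assumes "open \<Omega>" "finite_measure N" "sets N = sets borel" "integrable N snd"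
    and eq: "\<And>\<phi>. test_fun \<Omega> \<phi> \<Longrightarrow>
      (LINT x|lebesgue_on \<Omega>. w x \<bullet> mdiv \<phi> x) = - (LINT z|N. \<phi> (fst z) \<bullet> snd z)"
  shows "\<exists>\<nu> \<sigma>. grad_repr \<Omega> w \<nu> \<sigma>"
proof -
  obtain \<nu> \<sigma> where r: "sets \<nu> = sets borel \<and> finite_measure \<nu> \<and> emeasure \<nu> (UNIV - \<Omega>) = 0 \<and>
    \<sigma> \<in> borel_measurable borel \<and> (AE x in \<nu>. norm (\<sigma> x) = 1) \<and>
    (\<forall>\<phi> B. \<phi> \<in> borel_measurable borel \<longrightarrow> (\<forall>x. norm (\<phi> x) \<le> B) \<longrightarrow> (\<forall>x. x \<notin> \<Omega> \<longrightarrow> \<phi> x = 0) \<longrightarrow>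
       (LINT z|N. \<phi> (fst z) \<bullet> snd z) = (LINT x|\<nu>. \<phi> x \<bullet> \<sigma> x))"
    using polar_representation[OF assms(2-4), of \<Omega>] assms(1) borel_open by blast
  have "grad_repr \<Omega> w \<nu> \<sigma>"
    unfolding grad_repr_def
  proof (intro conjI allI impI)
    fix \<phi> :: "real^'n \<Rightarrow> real^'n^'m" assume \<phi>: "test_fun \<Omega> \<phi>"
    obtain B where "\<forall>x. norm (\<phi> x) \<le> B" using test_fun_bounded[OF \<phi>] by blast
    moreover have "\<phi> \<in> borel_measurable borel"
      using \<phi> by (rule test_fun_measurable)
    ultimately have "(LINT z|N. \<phi> (fst z) \<bullet> snd z) = (LINT x|\<nu>. \<phi> x \<bullet> \<sigma> x)"
      using r test_fun_zero[OF \<phi>] by blast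
    then show "(LINT x|lebesgue_on \<Omega>. w x \<bullet> mdiv \<phi> x) = - (LINT x|\<nu>. \<phi> x \<bullet> \<sigma> x)"
      using eq[OF \<phi>] by simp
  qed (use r in auto)
  then show ?thesis by blast
qed

text \<open>Encoding \<open>\<sigma> \<nu>\<close> by a positive measure on pairs makes sums and weak limits of vector measures
  accessible through positive measures; a polar representation is recovered by
  \<open>polar_representation\<close>.\<close>

definition graph_measure :: "real \<Rightarrow> 'a::euclidean_space measure \<Rightarrow> ('a \<Rightarrow> 'b::euclidean_space) \<Rightarrow> ('a \<times> 'b) measure" where
  "graph_measure c \<nu> \<sigma> = distr \<nu> borel (\<lambda>x. (x, c *\<^sub>R \<sigma> x))"

lemma measurable_graph [measurable]:
  fixes \<sigma> :: "'a::euclidean_space \<Rightarrow> 'b::euclidean_space"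
  assumes "\<sigma> \<in> borel_measurable borel"
  shows "(\<lambda>x. (x, c *\<^sub>R \<sigma> x)) \<in> borel_measurable borel"
  using assms by (simp add: borel_prod[symmetric])

lemma measurable_fst_snd_borel [measurable]:
  "fst \<in> borel_measurable (borel :: ('a::euclidean_space \<times> 'b::euclidean_space) measure)"
  "snd \<in> borel_measurable (borel :: ('a::euclidean_space \<times> 'b::euclidean_space) measure)"
  by (simp_all add: borel_prod[symmetric])

lemma measurable_test_pairing:
  assumes "test_fun \<Omega> \<phi>"
  shows "(\<lambda>z. \<phi> (fst z) \<bullet> snd z) \<in> borel_measurable borel"
proof -
  have [measurable]: "\<phi> \<in> borel_measurable borel"
    using assms by (rule test_fun_measurable)
  show ?thesis by measurable
qed

section \<open>Gradients encoded as graph measures\<close>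

context
  fixes \<Omega> :: "(real^'n) set" and w :: "real^'n \<Rightarrow> real^'m" and \<nu> \<sigma>
  assumes r: "grad_repr \<Omega> w \<nu> \<sigma>"
begin

lemma sets_grad_repr [measurable_cong]: "sets \<nu> = sets borel"
  and finite_measure_grad_repr: "finite_measure \<nu>"
  and measurable_grad_repr [measurable]: "\<sigma> \<in> borel_measurable borel"
  using r by (auto simp: grad_repr_def)

lemma space_grad_repr: "space \<nu> = UNIV"
  using sets_eq_imp_space_eq[OF sets_grad_repr] by simp

lemma sets_graph_measure: "sets (graph_measure c \<nu> \<sigma>) = sets borel"
  by (simp add: graph_measure_def)

lemma finite_measure_graph_measure: "finite_measure (graph_measure c \<nu> \<sigma>)"
  unfolding graph_measure_def
  by (intro finite_measure.finite_measure_distr finite_measure_grad_repr) measurable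

lemma emeasure_graph_measure: "emeasure (graph_measure c \<nu> \<sigma>) UNIV = emeasure \<nu> UNIV"
  unfolding graph_measure_def by (subst emeasure_distr) (auto simp: space_grad_repr)

lemma AE_graph_measure:
  assumes "open \<Omega>"
  shows "AE z in graph_measure c \<nu> \<sigma>. fst z \<in> \<Omega> \<and> norm (snd z) = \<bar>c\<bar>"
proof -
  have [measurable]: "\<Omega> \<in> sets borel" using assms by simp
  have "AE x in \<nu>. x \<in> \<Omega>"
    using r space_grad_repr by (intro AE_I'[of "UNIV - \<Omega>"]) (auto simp: grad_repr_def null_sets_def)
  moreover have "AE x in \<nu>. norm (\<sigma> x) = 1" using r by (simp add: grad_repr_def)
  ultimately have "AE x in \<nu>. x \<in> \<Omega> \<and> norm (c *\<^sub>R \<sigma> x) = \<bar>c\<bar>" by eventually_elim simp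
  then show ?thesis unfolding graph_measure_def by (subst AE_distr_iff) auto
qed

lemma integrable_snd_graph_measure: "integrable (graph_measure c \<nu> \<sigma>) snd"
proof -
  interpret finite_measure \<nu> by (rule finite_measure_grad_repr)
  have "AE x in \<nu>. norm (c *\<^sub>R \<sigma> x) \<le> \<bar>c\<bar>"
    using r by (auto simp: grad_repr_def elim!: eventually_mono)
  then have "integrable \<nu> (\<lambda>x. c *\<^sub>R \<sigma> x)" by (intro integrable_const_bound[of _ "\<bar>c\<bar>"]) auto
  then show ?thesis unfolding graph_measure_def by (subst integrable_distr_eq) auto
qed

lemma integral_graph_measure:
  assumes "test_fun \<Omega> \<phi>"
  shows "(LINT z|graph_measure c \<nu> \<sigma>. \<phi> (fst z) \<bullet> snd z) = - c * (LINT x|lebesgue_on \<Omega>. w x \<bullet> mdiv \<phi> x)"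
proof -
  have "(LINT z|graph_measure c \<nu> \<sigma>. \<phi> (fst z) \<bullet> snd z) = (LINT x|\<nu>. c * (\<phi> x \<bullet> \<sigma> x))"
    unfolding graph_measure_def using measurable_test_pairing[OF assms] by (subst integral_distr) auto
  then show ?thesis using r assms by (simp add: grad_repr_def)
qed

end

lemma integrable_test_pairing:
  fixes N :: "((real^'n) \<times> (real^'n^'m)) measure"
  assumes \<phi>: "test_fun \<Omega> \<phi>" and N[measurable_cong]: "sets N = sets borel" and snd: "integrable N snd"
  shows "integrable N (\<lambda>z. \<phi> (fst z) \<bullet> snd z)"
proof -
  have [measurable]: "\<phi> \<in> borel_measurable borel"
    using \<phi> by (rule test_fun_measurable)
  obtain B where "\<And>x. norm (\<phi> x) \<le> B" using test_fun_bounded[OF \<phi>] by blast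
  then have "integrable N (\<lambda>z. snd z \<bullet> \<phi> (fst z))"
    by (intro integrable_inner_bounded[OF snd, where B=B]) auto
  then show ?thesis by (simp add: inner_commute)
qed

text \<open>The factor \<open>1/2\<close> sits in the direction component, so the sum of the two
  graph measures represents the gradient of the midpoint. Its mass is not read off this sum:
  convexity follows from testing, since each pairing is the average of two pairings that are bounded
  by the respective masses.\<close>

lemma grad_repr_midpoint:
  fixes v w :: "real^'n \<Rightarrow> real^'m"
  assumes \<Omega>: "open \<Omega>" and r1: "grad_repr \<Omega> v \<nu>\<^sub>1 \<sigma>\<^sub>1" and r2: "grad_repr \<Omega> w \<nu>\<^sub>2 \<sigma>\<^sub>2"
    and v: "integrable (lebesgue_on \<Omega>) v" and w: "integrable (lebesgue_on \<Omega>) w"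
  shows "\<exists>\<nu> \<sigma>. grad_repr \<Omega> (\<lambda>x. (1/2) *\<^sub>R (v x + w x)) \<nu> \<sigma> \<and>
    measure \<nu> UNIV \<le> (measure \<nu>\<^sub>1 UNIV + measure \<nu>\<^sub>2 UNIV) / 2"
proof -
  let ?M = "graph_measure (1/2) \<nu>\<^sub>1 \<sigma>\<^sub>1" and ?M' = "graph_measure (1/2) \<nu>\<^sub>2 \<sigma>\<^sub>2"
  have s: "sets ?M' = sets ?M" using sets_graph_measure[OF r1] sets_graph_measure[OF r2] by simp
  have pair: "(LINT x|lebesgue_on \<Omega>. ((1/2) *\<^sub>R (v x + w x)) \<bullet> mdiv \<phi> x)
      = (1/2) * (LINT x|lebesgue_on \<Omega>. v x \<bullet> mdiv \<phi> x) + (1/2) * (LINT x|lebesgue_on \<Omega>. w x \<bullet> mdiv \<phi> x)"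
    if "test_fun \<Omega> \<phi>" for \<phi>
    using integrable_mdiv[OF that v] integrable_mdiv[OF that w] by (simp add: inner_add_left)
  have "\<exists>\<nu> \<sigma>. grad_repr \<Omega> (\<lambda>x. (1/2) *\<^sub>R (v x + w x)) \<nu> \<sigma>"
  proof (rule grad_repr_of_measure[OF \<Omega>, of "add_measure ?M ?M'"])
    show "finite_measure (add_measure ?M ?M')"
      by (intro finite_measure_add_measure s finite_measure_graph_measure[OF r1] finite_measure_graph_measure[OF r2])
    show "sets (add_measure ?M ?M') = sets borel" using sets_graph_measure[OF r1] by simp
    show "integrable (add_measure ?M ?M') snd"
      using integrable_snd_graph_measure[OF r1] integrable_snd_graph_measure[OF r2]
      by (simp add: integrable_add_measure_iff[OF s])
    fix \<phi> :: "real^'n \<Rightarrow> real^'n^'m" assume \<phi>: "test_fun \<Omega> \<phi>"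
    show "(LINT x|lebesgue_on \<Omega>. ((1/2) *\<^sub>R (v x + w x)) \<bullet> mdiv \<phi> x)
        = - (LINT z|add_measure ?M ?M'. \<phi> (fst z) \<bullet> snd z)"
      unfolding pair[OF \<phi>]
      by (subst integral_add_measure[OF s])
        (auto simp: integral_graph_measure[OF r1 \<phi>] integral_graph_measure[OF r2 \<phi>]
          intro!: integrable_test_pairing[OF \<phi>] sets_graph_measure[OF r1] sets_graph_measure[OF r2]
            integrable_snd_graph_measure[OF r1] integrable_snd_graph_measure[OF r2])
  qed
  then obtain \<nu> \<sigma> where r: "grad_repr \<Omega> (\<lambda>x. (1/2) *\<^sub>R (v x + w x)) \<nu> \<sigma>" by blast
  have "measure \<nu> UNIV \<le> (measure \<nu>\<^sub>1 UNIV + measure \<nu>\<^sub>2 UNIV) / 2"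
  proof (rule grad_repr_mass_le[OF \<Omega> r])
    fix \<phi> :: "real^'n \<Rightarrow> real^'n^'m" assume \<phi>: "test_fun \<Omega> \<phi>" and bd: "\<forall>x. norm (\<phi> x) \<le> 1"
    show "- (LINT x|lebesgue_on \<Omega>. ((1/2) *\<^sub>R (v x + w x)) \<bullet> mdiv \<phi> x)
        \<le> (measure \<nu>\<^sub>1 UNIV + measure \<nu>\<^sub>2 UNIV) / 2"
      using grad_repr_pairing_le[OF r1 \<phi>, of 1] grad_repr_pairing_le[OF r2 \<phi>, of 1] bd
      unfolding pair[OF \<phi>] by simp
  qed
  with r show ?thesis by blast
qed

text \<open>Weak compactness is applied to the graph measures; the missing mass is put at \<open>(0, 0)\<close>,
  where it does not contribute to the gradient.\<close>

lemma grad_repr_limit: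
  fixes w :: "nat \<Rightarrow> real^'n \<Rightarrow> real^'m"
  assumes \<Omega>: "open \<Omega>" "bounded \<Omega>" and r: "\<And>k. grad_repr \<Omega> (w k) (\<nu> k) (\<sigma> k)"
    and C: "\<And>k. measure (\<nu> k) UNIV \<le> C"
    and lim: "\<And>\<phi>. test_fun \<Omega> \<phi> \<Longrightarrow>
      (\<lambda>k. \<integral>x. w k x \<bullet> mdiv \<phi> x \<partial>lebesgue_on \<Omega>) \<longlonglongrightarrow> (LINT x|lebesgue_on \<Omega>. v x \<bullet> mdiv \<phi> x)"
  shows "\<exists>\<nu> \<sigma>. grad_repr \<Omega> v \<nu> \<sigma>"
proof -
  \<comment> \<open>A positive common upper bound of the masses: after filling up to
    \<open>D\<close>, division by \<open>D\<close> gives probability measures.\<close>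
  define D where "D = max C 1"
  have D: "D > 0" "\<And>k. measure (\<nu> k) UNIV \<le> D" using C by (auto simp: D_def le_max_iff_disj)
  let ?G = "\<lambda>k. graph_measure 1 (\<nu> k) (\<sigma> k)"
  let ?\<delta> = "\<lambda>k. density (return borel (0 :: (real^'n) \<times> (real^'n^'m))) (\<lambda>_. ennreal (D - measure (\<nu> k) UNIV))"
  define A where "A k = add_measure (?G k) (?\<delta> k)" for k
  define P where "P k = density (A k) (\<lambda>_. ennreal (1 / D))" for k
  have sG: "sets (?\<delta> k) = sets (?G k)" for k using sets_graph_measure[OF r] by simp
  have sA[measurable_cong]: "sets (A k) = sets borel" for k
    using sets_graph_measure[OF r] by (simp add: A_def)
  have spA: "space (A k) = UNIV" for k using sets_eq_imp_space_eq[OF sA] by simp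
  have sP[measurable_cong]: "sets (P k) = sets borel" for k using sA by (simp add: P_def)
  have eA: "emeasure (A k) UNIV = ennreal D" for k
  proof -
    interpret finite_measure "\<nu> k" by (rule finite_measure_grad_repr[OF r])
    have "emeasure (A k) UNIV = emeasure (\<nu> k) UNIV + ennreal (D - measure (\<nu> k) UNIV)"
      unfolding A_def using sets_graph_measure[OF r]
      by (subst emeasure_add_measure[OF sG]) (auto simp: emeasure_graph_measure[OF r] emeasure_density)
    then show ?thesis using D(2)[of k] by (simp add: emeasure_eq_measure ennreal_plus[symmetric] del: ennreal_plus)
  qed
  have prob: "prob_space (P k)" for k
  proof
    have "emeasure (P k) (space (P k)) = ennreal (1 / D) * emeasure (A k) UNIV"
      unfolding P_def using spA sA by (subst emeasure_density_const) auto
    then show "emeasure (P k) (space (P k)) = 1"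
      using D(1) by (simp add: eA ennreal_mult[symmetric])
  qed
  obtain R where R: "\<And>x. x \<in> \<Omega> \<Longrightarrow> norm x \<le> R" using \<Omega>(2) by (auto simp: bounded_iff)
  \<comment> \<open>\<open>R\<close> bounds the point, 1 bounds the unit direction, and the absolute
    value keeps the origin, where the missing mass sits, inside the ball even if \<open>R\<close> is
    negative.\<close>
  have supp: "AE z in P k. norm z \<le> \<bar>R\<bar> + 1" for k
  proof -
    have "AE z in ?G k. norm z \<le> \<bar>R\<bar> + 1"
      using AE_graph_measure[OF r \<Omega>(1), of 1 k]
    proof eventually_elim
      case (elim z)
      then show ?case using norm_Pair_le[of "fst z" "snd z"] R[of "fst z"] by simp
    qed
    moreover have "AE z in ?\<delta> k. norm z \<le> \<bar>R\<bar> + 1"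
      by (subst AE_density) (auto simp: AE_return)
    ultimately have "AE z in A k. norm z \<le> \<bar>R\<bar> + 1"
      unfolding A_def using sets_graph_measure[OF r, of 1 k]
      by (auto simp: AE_iff_nn_integral emeasure_add_measure)
    then show ?thesis unfolding P_def by (subst AE_density) auto
  qed
  from prob_measures_on_ball_compact[of P, OF prob sP supp]
  obtain s Q where s: "strict_mono (s :: nat \<Rightarrow> nat)" and Q: "prob_space Q" "sets Q = sets borel"
    and QB: "\<exists>B. AE x in Q. norm x \<le> B"
    and conv: "\<And>\<phi> :: (real^'n) \<times> (real^'n^'m) \<Rightarrow> real. continuous_on UNIV \<phi> \<Longrightarrow>
      (\<lambda>k. \<integral>x. \<phi> x \<partial>P (s k)) \<longlonglongrightarrow> (LINT x|Q. \<phi> x)"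
    by blast
  obtain B where B: "AE x in Q. norm x \<le> B" using QB by blast
  interpret Q: prob_space Q by (rule Q(1))
  note Q(2)[measurable_cong]
  have snd: "integrable Q snd"
  proof (rule Q.integrable_const_bound[of _ B])
    show "AE z in Q. norm (snd z) \<le> B"
      using B
    proof eventually_elim
      case (elim z)
      then show ?case using norm_snd_le[of "snd z" "fst z"] by simp
    qed
  qed measurable
  define N where "N = density Q (\<lambda>_. ennreal D)"
  show ?thesis
  proof (rule grad_repr_of_measure[OF \<Omega>(1), of N])
    show "finite_measure N"
      unfolding N_def by (rule finite_measureI) (auto simp: emeasure_density_const ennreal_mult_eq_top_iff)
    show sN: "sets N = sets borel" using Q(2) by (simp add: N_def)
    show sndN: "integrable N snd"
      unfolding N_def using D(1) snd by (subst integrable_density) auto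
    fix \<phi> :: "real^'n \<Rightarrow> real^'n^'m" assume \<phi>: "test_fun \<Omega> \<phi>"
    note [measurable] = measurable_test_pairing[OF \<phi>]
    have "continuous_on UNIV (\<lambda>z :: (real^'n) \<times> (real^'n^'m). \<phi> (fst z) \<bullet> snd z)"
      by (intro continuous_intros continuous_on_compose2[OF test_fun_continuous[OF \<phi>]]) auto
    from conv[OF this]
    have "(\<lambda>k. \<integral>z. \<phi> (fst z) \<bullet> snd z \<partial>P (s k)) \<longlonglongrightarrow> (LINT z|Q. \<phi> (fst z) \<bullet> snd z)" .
    moreover have "(LINT z|P k. \<phi> (fst z) \<bullet> snd z) = (- 1 / D) * (LINT x|lebesgue_on \<Omega>. w k x \<bullet> mdiv \<phi> x)" for k
    proof -
      have "(LINT z|P k. \<phi> (fst z) \<bullet> snd z) = (1 / D) * (LINT z|A k. \<phi> (fst z) \<bullet> snd z)"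
        unfolding P_def using D(1) by (subst integral_density) auto
      also have "(LINT z|A k. \<phi> (fst z) \<bullet> snd z)
          = (LINT z|?G k. \<phi> (fst z) \<bullet> snd z) + (LINT z|?\<delta> k. \<phi> (fst z) \<bullet> snd z)"
        unfolding A_def
      proof (rule integral_add_measure[OF sG])
        show "integrable (?G k) (\<lambda>z. \<phi> (fst z) \<bullet> snd z)"
          by (rule integrable_test_pairing[OF \<phi> sets_graph_measure[OF r] integrable_snd_graph_measure[OF r]])
        show "integrable (?\<delta> k) (\<lambda>z. \<phi> (fst z) \<bullet> snd z)"
          using D(2)[of k] by (subst integrable_density) (auto simp: integrable_iff_bounded nn_integral_return)
      qed
      also have "(LINT z|?\<delta> k. \<phi> (fst z) \<bullet> snd z) = 0"
        using D(2)[of k] by (subst integral_density) (auto simp: integral_return)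
      finally show ?thesis by (simp add: integral_graph_measure[OF r \<phi>])
    qed
    ultimately have "(\<lambda>k. (- 1 / D) * (LINT x|lebesgue_on \<Omega>. w (s k) x \<bullet> mdiv \<phi> x)) \<longlonglongrightarrow> (LINT z|Q. \<phi> (fst z) \<bullet> snd z)"
      by simp
    moreover have "(\<lambda>k. (- 1 / D) * (LINT x|lebesgue_on \<Omega>. w (s k) x \<bullet> mdiv \<phi> x)) \<longlonglongrightarrow> (- 1 / D) * (LINT x|lebesgue_on \<Omega>. v x \<bullet> mdiv \<phi> x)"
      using LIMSEQ_subseq_LIMSEQ[OF lim[OF \<phi>] s] by (intro tendsto_mult_left) (simp add: comp_def)
    ultimately have "(LINT z|Q. \<phi> (fst z) \<bullet> snd z) = (- 1 / D) * (LINT x|lebesgue_on \<Omega>. v x \<bullet> mdiv \<phi> x)"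
      by (rule LIMSEQ_unique)
    moreover have "(LINT z|N. \<phi> (fst z) \<bullet> snd z) = D * (LINT z|Q. \<phi> (fst z) \<bullet> snd z)"
      unfolding N_def using D(1) by (subst integral_density) auto
    ultimately show "(LINT x|lebesgue_on \<Omega>. v x \<bullet> mdiv \<phi> x) = - (LINT z|N. \<phi> (fst z) \<bullet> snd z)"
      using D(1) by simp
  qed
qed

section \<open>Almost minimizers\<close>

lemma norm_diff_squared_le: "(norm (a - b))\<^sup>2 \<le> 2 * (norm a)\<^sup>2 + 2 * (norm b)\<^sup>2"
  for a b :: "'a::real_inner"
proof -
  have "0 \<le> (norm (a + b))\<^sup>2" by simp
  then show ?thesis by (simp add: power2_norm_eq_inner inner_add inner_diff inner_commute)
qed

lemma integrable_norm_diff_squared: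
  fixes a b :: "'a \<Rightarrow> 'b::euclidean_space"
  assumes "a \<in> borel_measurable M" "b \<in> borel_measurable M"
    "integrable M (\<lambda>x. (norm (a x))\<^sup>2)" "integrable M (\<lambda>x. (norm (b x))\<^sup>2)"
  shows "integrable M (\<lambda>x. (norm (a x - b x))\<^sup>2)"
proof (rule Bochner_Integration.integrable_bound)
  show "integrable M (\<lambda>x. 2 * (norm (a x))\<^sup>2 + 2 * (norm (b x))\<^sup>2)" using assms by simp
  show "AE x in M. norm ((norm (a x - b x))\<^sup>2) \<le> norm (2 * (norm (a x))\<^sup>2 + 2 * (norm (b x))\<^sup>2)"
    using norm_diff_squared_le[of "a _" "b _"] by (intro always_eventually) simp
qed (use assms in measurable)

lemma integrable_inner_L2:
  fixes a b :: "'a \<Rightarrow> 'b::euclidean_space"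
  assumes "a \<in> borel_measurable M" "b \<in> borel_measurable M"
    "integrable M (\<lambda>x. (norm (a x))\<^sup>2)" "integrable M (\<lambda>x. (norm (b x))\<^sup>2)"
  shows "integrable M (\<lambda>x. a x \<bullet> b x)"
proof (rule Bochner_Integration.integrable_bound)
  show "integrable M (\<lambda>x. (norm (a x))\<^sup>2 + (norm (b x))\<^sup>2)" using assms by simp
  have "\<bar>u \<bullet> v\<bar> \<le> (norm u)\<^sup>2 + (norm v)\<^sup>2" for u v :: 'b
    using Cauchy_Schwarz_ineq2[of u v] sum_squares_bound[of "norm u" "norm v"]
      mult_nonneg_nonneg[of "norm u" "norm v"] by simp
  then show "AE x in M. norm (a x \<bullet> b x) \<le> norm ((norm (a x))\<^sup>2 + (norm (b x))\<^sup>2)"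
    by (intro always_eventually) simp
qed (use assms in measurable)

lemma (in finite_measure) integrable_of_L2:
  fixes a :: "'a \<Rightarrow> 'b::euclidean_space"
  assumes "a \<in> borel_measurable M" "integrable M (\<lambda>x. (norm (a x))\<^sup>2)"
  shows "integrable M a"
proof (rule Bochner_Integration.integrable_bound)
  show "integrable M (\<lambda>x. 1 + (norm (a x))\<^sup>2)" using assms by simp
  have "norm u \<le> 1 + (norm u)\<^sup>2" for u :: 'b
    using sum_squares_bound[of 1 "norm u"] norm_ge_zero[of u] by (simp del: norm_ge_zero)
  then show "AE x in M. norm (a x) \<le> norm (1 + (norm (a x))\<^sup>2)"
    by (intro always_eventually) simp
qed (use assms in measurable)

text \<open>The discriminant argument applied to the integral of \<open>|a - t b|^2\<close>, a
  nonnegative quadratic polynomial in \<open>t\<close>.\<close>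

lemma integral_Cauchy_Schwarz:
  fixes a b :: "'a \<Rightarrow> 'b::euclidean_space"
  assumes m: "a \<in> borel_measurable M" "b \<in> borel_measurable M"
    and i: "integrable M (\<lambda>x. (norm (a x))\<^sup>2)" "integrable M (\<lambda>x. (norm (b x))\<^sup>2)"
  shows "\<bar>\<integral>x. a x \<bullet> b x \<partial>M\<bar> \<le> sqrt (LINT x|M. (norm (a x))\<^sup>2) * sqrt (LINT x|M. (norm (b x))\<^sup>2)"
proof -
  define A where "A = (LINT x|M. (norm (a x))\<^sup>2)"
  define B where "B = (LINT x|M. (norm (b x))\<^sup>2)"
  define I where "I = (LINT x|M. a x \<bullet> b x)"
  have A0: "0 \<le> A" and B0: "0 \<le> B" by (simp_all add: A_def B_def)
  note ii = integrable_inner_L2[OF m i]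
  have quad: "0 \<le> A - 2 * t * I + t\<^sup>2 * B" for t
  proof -
    have "0 \<le> (LINT x|M. (norm (a x - t *\<^sub>R b x))\<^sup>2)" by simp
    also have "\<dots> = (LINT x|M. (norm (a x))\<^sup>2 - 2 * t * (a x \<bullet> b x) + t\<^sup>2 * (norm (b x))\<^sup>2)"
      by (intro Bochner_Integration.integral_cong)
        (auto simp: dot_square_norm[symmetric] inner_diff inner_commute power2_eq_square[of t] algebra_simps)
    also have "\<dots> = A - 2 * t * I + t\<^sup>2 * B"
      using i ii by (simp add: A_def B_def I_def)
    finally show ?thesis .
  qed
  have "I\<^sup>2 \<le> A * B"
  proof (cases "B = 0")
    case True
    have "I = 0"
    proof (rule ccontr)
      assume "I \<noteq> 0"
      \<comment> \<open>With \<open>B = 0\<close> the polynomial is affine, and this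
        \<open>t\<close> gives it the value \<open>-1\<close>.\<close>
      then show False using quad[of "(A + 1) / (2 * I)"] True A0 by (simp add: field_simps)
    qed
    then show ?thesis using True by simp
  next
    case False
    then have "B > 0" using B0 by simp
    then show ?thesis using quad[of "I / B"] by (simp add: field_simps power2_eq_square)
  qed
  then have "\<bar>I\<bar> \<le> sqrt (A * B)" using real_le_rsqrt[of "\<bar>I\<bar>"] by simp
  then show ?thesis by (simp add: real_sqrt_mult A_def B_def I_def)
qed

lemma (in finite_measure) integral_norm_le_L2:
  fixes a :: "'a \<Rightarrow> 'b::euclidean_space"
  assumes "a \<in> borel_measurable M" "integrable M (\<lambda>x. (norm (a x))\<^sup>2)"
  shows "(LINT x|M. norm (a x)) \<le> sqrt (measure M (space M)) * sqrt (LINT x|M. (norm (a x))\<^sup>2)"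
  using integral_Cauchy_Schwarz[of "\<lambda>_. 1::real" M "\<lambda>x. norm (a x)"] assms by simp

text \<open>Finite fidelity is included so that the energy is a real number and can be subtracted.
  The representation is a parameter because the mass is available only through it.\<close>

definition TV_competitor :: "(real^'n) set \<Rightarrow> (real^'n \<Rightarrow> real^'m) \<Rightarrow> (real^'n \<Rightarrow> real^'m)
    \<Rightarrow> (real^'n) measure \<Rightarrow> (real^'n \<Rightarrow> real^'n^'m) \<Rightarrow> bool" where
  "TV_competitor \<Omega> f w \<nu> \<sigma> \<longleftrightarrow> integrable (lebesgue_on \<Omega>) w \<and>
     integrable (lebesgue_on \<Omega>) (\<lambda>x. (norm (w x - f x))\<^sup>2) \<and> grad_repr \<Omega> w \<nu> \<sigma>"

definition TV_value :: "(real^'n) set \<Rightarrow> real \<Rightarrow> (real^'n \<Rightarrow> real^'m) \<Rightarrow> (real^'n \<Rightarrow> real^'m)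
    \<Rightarrow> (real^'n) measure \<Rightarrow> real" where
  "TV_value \<Omega> lam f w \<nu> = measure \<nu> UNIV + lam / 2 * (LINT x|lebesgue_on \<Omega>. (norm (w x - f x))\<^sup>2)"

definition almost_min :: "(real^'n) set \<Rightarrow> real \<Rightarrow> (real^'n \<Rightarrow> real^'m) \<Rightarrow> real
    \<Rightarrow> (real^'n \<Rightarrow> real^'m) \<Rightarrow> bool" where
  "almost_min \<Omega> lam f \<epsilon> w \<longleftrightarrow> (\<exists>\<nu> \<sigma>. TV_competitor \<Omega> f w \<nu> \<sigma> \<and>
     (\<forall>v \<nu>' \<sigma>'. TV_competitor \<Omega> f v \<nu>' \<sigma>' \<longrightarrow> TV_value \<Omega> lam f w \<nu> \<le> TV_value \<Omega> lam f v \<nu>' + \<epsilon>))"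

text \<open>For the null measure the unit length condition is vacuous. The zero function thus
  becomes a competitor of finite energy, the reference for all a priori bounds.\<close>

lemma grad_repr_zero:
  "grad_repr \<Omega> (\<lambda>_. 0) (null_measure borel) (\<lambda>_. 0)"
  by (auto simp: grad_repr_def intro!: finite_measureI AE_I'[of UNIV])

lemma leb_decomp_null_measure: "leb_decomp (null_measure borel) {} (\<lambda>_. 0)"
proof -
  have "density (null_measure borel) (indicator (UNIV - {})) = density lborel (\<lambda>x::real^'n. ennreal 0)"
    by (rule measure_eqI) (auto simp: emeasure_density nn_integral_null_measure)
  then show ?thesis by (simp add: leb_decomp_def)
qed

section \<open>Distance and limits of almost minimizers\<close>

locale denoising =
  fixes \<Omega> :: "(real^'n) set" and lam :: real and f :: "real^'n \<Rightarrow> real^'m"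
  assumes op: "open \<Omega>" and bd: "bounded \<Omega>" and lam: "lam > 0"
    and fm: "f \<in> borel_measurable (lebesgue_on \<Omega>)"
    and f2: "integrable (lebesgue_on \<Omega>) (\<lambda>x. (norm (f x))\<^sup>2)"
begin

abbreviation "M \<equiv> lebesgue_on \<Omega>"
abbreviation "TV \<equiv> TV_value \<Omega> lam f"
abbreviation "competitor \<equiv> TV_competitor \<Omega> f"
abbreviation "amin \<equiv> almost_min \<Omega> lam f"

lemma space_M: "space M = \<Omega>" by simp

lemma Omega_lmeasurable: "\<Omega> \<in> lmeasurable"
  using op bd by (simp add: lmeasurable_open)

sublocale M: finite_measure M
proof
  have "emeasure M (space M) = emeasure lebesgue \<Omega>"
    using fmeasurableD[OF Omega_lmeasurable] unfolding space_M by (subst emeasure_restrict_space) auto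
  then show "emeasure M (space M) \<noteq> \<infinity>"
    using fmeasurableD2[OF Omega_lmeasurable] by (simp only: infinity_ennreal_def not_False_eq_True)
qed

lemma competitor_zero: "competitor (\<lambda>_. 0) (null_measure borel) (\<lambda>_. 0)"
  using f2 grad_repr_zero by (simp add: TV_competitor_def)

lemma competitor_measurable:
  "competitor w \<nu> \<sigma> \<Longrightarrow> w \<in> borel_measurable M"
  by (auto simp: TV_competitor_def)

lemma competitor_integrable_sq:
  assumes "competitor w \<nu> \<sigma>"
  shows "integrable M (\<lambda>x. (norm (w x))\<^sup>2)"
proof -
  have "integrable M (\<lambda>x. (norm ((w x - f x) - - f x))\<^sup>2)"
    by (rule integrable_norm_diff_squared) (use assms fm f2 in \<open>auto simp: TV_competitor_def\<close>)
  then show ?thesis by simp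
qed

lemma competitor_integrable_diff:
  assumes "competitor v \<nu> \<sigma>" "competitor w \<nu>' \<sigma>'"
  shows "integrable M (\<lambda>x. (norm (v x - w x))\<^sup>2)"
  using assms competitor_measurable competitor_integrable_sq by (intro integrable_norm_diff_squared) auto

text \<open>By the parallelogram identity the midpoint of \<open>v\<close> and \<open>w\<close> has
  energy below their average by at least \<open>lam / 8\<close> times the squared distance. Almost
  minimality of \<open>v\<close> and \<open>w\<close> against the midpoint leaves at most
  \<open>(\<epsilon> + \<epsilon>') / 2\<close> for this gain, which gives the factor 4.\<close>

lemma almost_min_dist:
  assumes v: "amin \<epsilon> v" and w: "amin \<epsilon>' w"
  shows "(LINT x|M. (norm (v x - w x))\<^sup>2) \<le> 4 * (\<epsilon> + \<epsilon>') / lam"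
proof -
  obtain \<nu> \<sigma> where r1: "competitor v \<nu> \<sigma>"
    and m1: "\<And>u \<nu>' \<sigma>'. competitor u \<nu>' \<sigma>' \<Longrightarrow> TV v \<nu> \<le> TV u \<nu>' + \<epsilon>"
    using v unfolding almost_min_def by blast
  obtain \<nu>' \<sigma>' where r2: "competitor w \<nu>' \<sigma>'"
    and m2: "\<And>u \<nu>'' \<sigma>''. competitor u \<nu>'' \<sigma>'' \<Longrightarrow> TV w \<nu>' \<le> TV u \<nu>'' + \<epsilon>'"
    using w unfolding almost_min_def by blast
  let ?z = "\<lambda>x. (1/2) *\<^sub>R (v x + w x)"
  obtain \<nu>'' \<sigma>'' where r3: "grad_repr \<Omega> ?z \<nu>'' \<sigma>''"
    and mass: "measure \<nu>'' UNIV \<le> (measure \<nu> UNIV + measure \<nu>' UNIV) / 2"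
    using grad_repr_midpoint[OF op, of v \<nu> \<sigma> w \<nu>' \<sigma>'] r1 r2 by (auto simp: TV_competitor_def)
  have par: "(norm (?z x - f x))\<^sup>2 = (1/2) * (norm (v x - f x))\<^sup>2 + (1/2) * (norm (w x - f x))\<^sup>2 - (1/4) * (norm (v x - w x))\<^sup>2" for x
    by (simp add: power2_norm_eq_inner inner_add inner_diff inner_commute algebra_simps)
  have iv: "integrable M (\<lambda>x. (norm (v x - f x))\<^sup>2)" "integrable M (\<lambda>x. (norm (w x - f x))\<^sup>2)"
    using r1 r2 by (auto simp: TV_competitor_def)
  note id = competitor_integrable_diff[OF r1 r2]
  have c3: "competitor ?z \<nu>'' \<sigma>''"
    unfolding TV_competitor_def par using r1 r2 r3 iv id by (auto simp: TV_competitor_def)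
  have int: "(LINT x|M. (norm (?z x - f x))\<^sup>2) = (1/2) * (LINT x|M. (norm (v x - f x))\<^sup>2)
      + (1/2) * (LINT x|M. (norm (w x - f x))\<^sup>2) - (1/4) * (LINT x|M. (norm (v x - w x))\<^sup>2)"
    unfolding par using iv id by simp
  have "TV ?z \<nu>'' \<le> (TV v \<nu> + TV w \<nu>') / 2
      - lam / 8 * (LINT x|M. (norm (v x - w x))\<^sup>2)"
    unfolding TV_value_def int using mass by (simp add: field_simps)
  with m1[OF c3] m2[OF c3] have "lam / 4 * (LINT x|M. (norm (v x - w x))\<^sup>2) \<le> \<epsilon> + \<epsilon>'" by argo
  then show ?thesis using lam by (simp add: field_simps)
qed

text \<open>A subsequence converges almost everywhere, and Fatou's lemma turns its limit into an L^2
  limit of the whole sequence with the same rate. Minimality of the limit is checked against one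
  test function at a time, where the pairing is continuous in L^1; passing to the mass only at the
  end gives lower semicontinuity.\<close>

lemma almost_min_limit:
  fixes w :: "nat \<Rightarrow> real^'n \<Rightarrow> real^'m"
  assumes am: "\<And>k. amin (\<epsilon> k) (w k)" and dec: "decseq \<epsilon>" and lim: "\<epsilon> \<longlonglongrightarrow> 0"
  shows "\<exists>u. amin 0 u"
proof -
  have "\<forall>k. \<exists>p. competitor (w k) (fst p) (snd p) \<and>
     (\<forall>v \<nu>' \<sigma>'. competitor v \<nu>' \<sigma>' \<longrightarrow> TV (w k) (fst p) \<le> TV v \<nu>' + \<epsilon> k)"
    using am unfolding almost_min_def by (metis fst_conv snd_conv)
  from choice[OF this] obtain p where p: "\<And>k. competitor (w k) (fst (p k)) (snd (p k))"
    "\<And>k v \<nu>' \<sigma>'. competitor v \<nu>' \<sigma>' \<Longrightarrow> TV (w k) (fst (p k)) \<le> TV v \<nu>' + \<epsilon> k"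
    by blast
  define \<nu> where "\<nu> k = fst (p k)" for k
  define \<sigma> where "\<sigma> k = snd (p k)" for k
  note comp = p(1)[folded \<nu>_def \<sigma>_def] and mini = p(2)[folded \<nu>_def]
  have wi: "integrable M (w k)" for k using comp by (simp add: TV_competitor_def)
  have wm[measurable]: "w k \<in> borel_measurable M" for k using wi by auto
  note [measurable] = fm
  have \<epsilon>0: "0 \<le> \<epsilon> k" for k using decseq_ge[OF dec lim] .
  have dist: "(LINT x|M. (norm (w i x - w j x))\<^sup>2) \<le> 8 * \<epsilon> k / lam" if "i \<ge> k" "j \<ge> k" for i j k
  proof -
    have "(LINT x|M. (norm (w i x - w j x))\<^sup>2) \<le> 4 * (\<epsilon> i + \<epsilon> j) / lam" by (rule almost_min_dist[OF am am])
    also have "\<dots> \<le> 8 * \<epsilon> k / lam"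
      using decseqD[OF dec that(1)] decseqD[OF dec that(2)] lam by (intro divide_right_mono) auto
    finally show ?thesis .
  qed
  define S where "S = sqrt (measure M (space M))"
  have lim8: "(\<lambda>k. S * sqrt (8 * \<epsilon> k / lam)) \<longlonglongrightarrow> 0"
  proof -
    have "(\<lambda>k. S * sqrt (8 * \<epsilon> k / lam)) \<longlonglongrightarrow> S * sqrt (8 * 0 / lam)"
      using lam by (intro tendsto_intros lim) auto
    then show ?thesis by simp
  qed
  \<comment> \<open>Finite measure turns the L^2 Cauchy estimate into an L^1 one, from which an
    almost everywhere Cauchy subsequence is extracted.\<close>
  obtain r where r: "strict_mono r" "AE x in M. Cauchy (\<lambda>i. w (r i) x)"
  proof (rule cauchy_L1_AE_cauchy_subseq[OF wi])
    fix e :: real assume "e > 0"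
    with order_tendstoD(2)[OF lim8] obtain N where N: "S * sqrt (8 * \<epsilon> N / lam) < e"
      by (auto simp: eventually_sequentially)
    have "(LINT x|M. norm (w i x - w j x)) < e" if "i \<ge> N" "j \<ge> N" for i j
    proof -
      have "(LINT x|M. norm (w i x - w j x)) \<le> S * sqrt (LINT x|M. (norm (w i x - w j x))\<^sup>2)"
        unfolding S_def by (rule M.integral_norm_le_L2) (use competitor_integrable_diff[OF comp comp] in auto)
      also have "\<dots> \<le> S * sqrt (8 * \<epsilon> N / lam)"
        using dist[OF that] by (intro mult_left_mono) (auto simp: S_def)
      finally show ?thesis using N by simp
    qed
    then show "\<exists>N. \<forall>i\<ge>N. \<forall>j\<ge>N. (LINT x|M. norm (w i x - w j x)) < e" by blast
  qed blast
  define u where "u x = lim (\<lambda>i. w (r i) x)" for x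
  have um[measurable]: "u \<in> borel_measurable M" unfolding u_def by (rule borel_measurable_lim_metric) simp
  have ae: "AE x in M. (\<lambda>i. w (r i) x) \<longlonglongrightarrow> u x"
    using r(2) by eventually_elim (simp add: u_def Cauchy_convergent_iff convergent_LIMSEQ_iff)
  have nn: "(\<integral>\<^sup>+x. ennreal ((norm (w k x - u x))\<^sup>2) \<partial>M) \<le> ennreal (8 * \<epsilon> k / lam)" for k
  proof -
    have "(\<integral>\<^sup>+x. ennreal ((norm (w k x - u x))\<^sup>2) \<partial>M)
        = (\<integral>\<^sup>+x. liminf (\<lambda>i. ennreal ((norm (w k x - w (r i) x))\<^sup>2)) \<partial>M)"
    proof (rule nn_integral_cong_AE)
      show "AE x in M. ennreal ((norm (w k x - u x))\<^sup>2) = liminf (\<lambda>i. ennreal ((norm (w k x - w (r i) x))\<^sup>2))"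
        using ae
      proof eventually_elim
        case (elim x)
        then have "(\<lambda>i. ennreal ((norm (w k x - w (r i) x))\<^sup>2)) \<longlonglongrightarrow> ennreal ((norm (w k x - u x))\<^sup>2)"
          by (intro tendsto_intros tendsto_ennrealI)
        then show ?case by (intro lim_imp_Liminf[symmetric]) auto
      qed
    qed
    also have "\<dots> \<le> liminf (\<lambda>i. \<integral>\<^sup>+x. ennreal ((norm (w k x - w (r i) x))\<^sup>2) \<partial>M)"
      by (rule nn_integral_liminf) simp
    also have "\<dots> \<le> limsup (\<lambda>i. \<integral>\<^sup>+x. ennreal ((norm (w k x - w (r i) x))\<^sup>2) \<partial>M)"
      by (rule Liminf_le_Limsup) simp
    also have "\<dots> \<le> ennreal (8 * \<epsilon> k / lam)"
    proof (rule Limsup_bounded)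
      show "\<forall>\<^sub>F i in sequentially. (\<integral>\<^sup>+x. ennreal ((norm (w k x - w (r i) x))\<^sup>2) \<partial>M) \<le> ennreal (8 * \<epsilon> k / lam)"
        unfolding eventually_sequentially
      proof (intro exI[of _ k] allI impI)
        fix i assume "k \<le> i"
        then have "k \<le> r i" using seq_suble[OF r(1), of i] by simp
        then show "(\<integral>\<^sup>+x. ennreal ((norm (w k x - w (r i) x))\<^sup>2) \<partial>M) \<le> ennreal (8 * \<epsilon> k / lam)"
          using dist[of k k "r i"] competitor_integrable_diff[OF comp comp]
          by (subst nn_integral_eq_integral) (auto intro!: ennreal_leI)
      qed
    qed
    finally show ?thesis .
  qed
  have i2: "integrable M (\<lambda>x. (norm (w k x - u x))\<^sup>2)" for k
    using le_less_trans[OF nn[of k] ennreal_less_top] by (intro integrableI_nonneg) auto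
  have d2: "(LINT x|M. (norm (w k x - u x))\<^sup>2) \<le> 8 * \<epsilon> k / lam" for k
    using nn[of k] lam \<epsilon>0[of k] by (simp add: nn_integral_eq_integral[OF i2])
  have uf: "integrable M (\<lambda>x. (norm (u x - f x))\<^sup>2)"
  proof -
    have "integrable M (\<lambda>x. (norm ((w 0 x - f x) - (w 0 x - u x)))\<^sup>2)"
      by (rule integrable_norm_diff_squared) (use comp[of 0] i2[of 0] in \<open>auto simp: TV_competitor_def\<close>)
    then show ?thesis by simp
  qed
  have ui: "integrable M u"
  proof -
    have "integrable M (\<lambda>x. w 0 x - u x)" by (rule M.integrable_of_L2) (use i2[of 0] in auto)
    from Bochner_Integration.integrable_diff[OF wi[of 0] this] show ?thesis by simp
  qed
  have L1: "(\<lambda>k. \<integral>x. norm (w k x - u x) \<partial>M) \<longlonglongrightarrow> 0"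
  proof (rule tendsto_sandwich[OF _ _ tendsto_const lim8])
    show "\<forall>\<^sub>F k in sequentially. 0 \<le> (LINT x|M. norm (w k x - u x))" by simp
    have "(LINT x|M. norm (w k x - u x)) \<le> S * sqrt (8 * \<epsilon> k / lam)" for k
    proof -
      have "(LINT x|M. norm (w k x - u x)) \<le> S * sqrt (LINT x|M. (norm (w k x - u x))\<^sup>2)"
        unfolding S_def by (rule M.integral_norm_le_L2) (use i2 in auto)
      also have "\<dots> \<le> S * sqrt (8 * \<epsilon> k / lam)"
        using d2[of k] by (intro mult_left_mono) (auto simp: S_def)
      finally show ?thesis .
    qed
    then show "\<forall>\<^sub>F k in sequentially. (LINT x|M. norm (w k x - u x)) \<le> S * sqrt (8 * \<epsilon> k / lam)" by simp
  qed
  have pair: "(\<lambda>k. \<integral>x. w k x \<bullet> mdiv \<phi> x \<partial>M) \<longlonglongrightarrow> (LINT x|M. u x \<bullet> mdiv \<phi> x)" if "test_fun \<Omega> \<phi>" for \<phi>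
    by (rule mdiv_pairing_tendsto[OF that wi ui L1])
  have rk: "grad_repr \<Omega> (w k) (\<nu> k) (\<sigma> k)" for k using comp by (simp add: TV_competitor_def)
  \<comment> \<open>Comparison with the zero function gives the uniform mass bound required by weak
    compactness; monotonicity replaces \<open>\<epsilon> k\<close> by
    \<open>\<epsilon> 0\<close>.\<close>
  have "measure (\<nu> k) UNIV \<le> TV (\<lambda>_. 0) (null_measure borel) + \<epsilon> 0" for k
  proof -
    have "measure (\<nu> k) UNIV \<le> TV (w k) (\<nu> k)" using lam by (simp add: TV_value_def)
    also have "\<dots> \<le> TV (\<lambda>_. 0) (null_measure borel) + \<epsilon> k" by (rule mini[OF competitor_zero])
    finally show ?thesis using decseqD[OF dec, of 0 k] by simp
  qed
  from grad_repr_limit[OF op bd rk this pair] obtain \<nu>0 \<sigma>0 where r0: "grad_repr \<Omega> u \<nu>0 \<sigma>0" by blast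
  have c0: "competitor u \<nu>0 \<sigma>0" using r0 ui uf by (simp add: TV_competitor_def)
  have cross: "(\<lambda>k. \<integral>x. (w k x - u x) \<bullet> (u x - f x) \<partial>M) \<longlonglongrightarrow> 0"
  proof (rule Lim_null_comparison[OF always_eventually])
    define G where "G = sqrt (LINT x|M. (norm (u x - f x))\<^sup>2)"
    have "(\<lambda>k. sqrt (8 * \<epsilon> k / lam) * G) \<longlonglongrightarrow> sqrt (8 * 0 / lam) * G"
      using lam by (intro tendsto_intros lim) auto
    then show "(\<lambda>k. sqrt (8 * \<epsilon> k / lam) * G) \<longlonglongrightarrow> 0" by simp
    show "\<forall>k. norm (LINT x|M. (w k x - u x) \<bullet> (u x - f x)) \<le> sqrt (8 * \<epsilon> k / lam) * G"
    proof
      fix k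
      have "\<bar>\<integral>x. (w k x - u x) \<bullet> (u x - f x) \<partial>M\<bar> \<le> sqrt (LINT x|M. (norm (w k x - u x))\<^sup>2) * G"
        unfolding G_def by (rule integral_Cauchy_Schwarz) (use i2 uf in auto)
      also have "\<dots> \<le> sqrt (8 * \<epsilon> k / lam) * G"
        using d2[of k] by (intro mult_right_mono) (auto simp: G_def)
      finally show "norm (LINT x|M. (w k x - u x) \<bullet> (u x - f x)) \<le> sqrt (8 * \<epsilon> k / lam) * G" by simp
    qed
  qed
  \<comment> \<open>Expanding the square around \<open>u\<close> and dropping
    \<open>|w k - u|^2\<close> leaves a bound affine in \<open>w k\<close>, so only the cross term
    has to be passed to the limit.\<close>
  have lower: "(LINT x|M. (norm (u x - f x))\<^sup>2) + 2 * (LINT x|M. (w k x - u x) \<bullet> (u x - f x))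
      \<le> (LINT x|M. (norm (w k x - f x))\<^sup>2)" for k
  proof -
    have ic: "integrable M (\<lambda>x. (w k x - u x) \<bullet> (u x - f x))"
      by (rule integrable_inner_L2) (use i2 uf in auto)
    have "(LINT x|M. (norm (u x - f x))\<^sup>2 + 2 * ((w k x - u x) \<bullet> (u x - f x))) \<le> (LINT x|M. (norm (w k x - f x))\<^sup>2)"
    proof (rule integral_mono)
      show "integrable M (\<lambda>x. (norm (w k x - f x))\<^sup>2)" using comp by (simp add: TV_competitor_def)
      fix x
      have "0 \<le> (norm (w k x - u x))\<^sup>2" by simp
      then show "(norm (u x - f x))\<^sup>2 + 2 * ((w k x - u x) \<bullet> (u x - f x)) \<le> (norm (w k x - f x))\<^sup>2"
        by (simp add: power2_norm_eq_inner inner_diff inner_commute algebra_simps)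
    qed (use uf ic in auto)
    then show ?thesis using uf ic by simp
  qed
  have "TV u \<nu>0 \<le> TV v \<nu>'" if v: "competitor v \<nu>' \<sigma>'" for v \<nu>' \<sigma>'
  proof -
    let ?E = "TV v \<nu>'" and ?I = "\<integral>x. (norm (u x - f x))\<^sup>2 \<partial>M"
    have "measure \<nu>0 UNIV \<le> ?E - lam / 2 * ?I"
    proof (rule grad_repr_mass_le[OF op r0])
      fix \<phi> :: "real^'n \<Rightarrow> real^'n^'m" assume \<phi>: "test_fun \<Omega> \<phi>" and b: "\<forall>x. norm (\<phi> x) \<le> 1"
      have "- (LINT x|M. w k x \<bullet> mdiv \<phi> x)
          \<le> ?E + \<epsilon> k - lam / 2 * (?I + 2 * (LINT x|M. (w k x - u x) \<bullet> (u x - f x)))" for k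
      proof -
        have "- (LINT x|M. w k x \<bullet> mdiv \<phi> x) \<le> measure (\<nu> k) UNIV"
          using grad_repr_pairing_le[OF rk \<phi>, of 1 k] b by simp
        also have "\<dots> \<le> ?E + \<epsilon> k - lam / 2 * (LINT x|M. (norm (w k x - f x))\<^sup>2)"
          using mini[OF v, of k] unfolding TV_value_def by simp
        also have "\<dots> \<le> ?E + \<epsilon> k - lam / 2 * (?I + 2 * (LINT x|M. (w k x - u x) \<bullet> (u x - f x)))"
          using mult_left_mono[OF lower[of k], of "lam / 2"] lam by simp
        finally show ?thesis .
      qed
      moreover have "(\<lambda>k. ?E + \<epsilon> k - lam / 2 * (?I + 2 * (LINT x|M. (w k x - u x) \<bullet> (u x - f x))))
          \<longlonglongrightarrow> ?E + 0 - lam / 2 * (?I + 2 * 0)"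
        by (intro tendsto_intros lim cross)
      moreover have "(\<lambda>k. - (LINT x|M. w k x \<bullet> mdiv \<phi> x)) \<longlonglongrightarrow> - (LINT x|M. u x \<bullet> mdiv \<phi> x)"
        by (intro tendsto_intros pair \<phi>)
      ultimately show "- (LINT x|M. u x \<bullet> mdiv \<phi> x) \<le> ?E - lam / 2 * ?I"
        by (intro LIMSEQ_le[where X="\<lambda>k. - (LINT x|M. w k x \<bullet> mdiv \<phi> x)"]) auto
    qed
    then show ?thesis by (simp add: TV_value_def)
  qed
  then have "amin 0 u" using c0 unfolding almost_min_def by auto
  then show ?thesis by blast
qed

end

section \<open>Comparison of the energies\<close>

context denoising
begin

lemma AE_M_of_AE_lborel:
  assumes "AE x in lborel. P x" shows "AE x in M. P x"
proof (subst AE_restrict_space_iff)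
  show "\<Omega> \<inter> space lebesgue \<in> sets lebesgue" using fmeasurableD[OF Omega_lmeasurable] by simp
  show "AE x in lebesgue. x \<in> \<Omega> \<longrightarrow> P x"
    using AE_completion[OF assms] by eventually_elim simp
qed

lemma nn_integral_M:
  assumes [measurable]: "g \<in> borel_measurable borel"
  shows "(\<integral>\<^sup>+x. g x \<partial>M) = (\<integral>\<^sup>+x. g x * indicator \<Omega> x \<partial>lborel)"
proof -
  have "(\<integral>\<^sup>+x. g x \<partial>M) = (\<integral>\<^sup>+x. g x * indicator \<Omega> x \<partial>lebesgue)"
    using fmeasurableD[OF Omega_lmeasurable] by (subst nn_integral_restrict_space) auto
  also have "\<dots> = (\<integral>\<^sup>+x. g x * indicator \<Omega> x \<partial>lborel)"
    by (rule nn_integral_completion)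
  finally show ?thesis .
qed

text \<open>Splitting along \<open>Z\<close> leaves the integral of \<open>h\<close> over the whole
  space; as \<open>\<nu>\<close> does not charge the complement of \<open>\<Omega>\<close>,
  \<open>h\<close> has no mass there and the integral reduces to \<open>\<Omega>\<close>.\<close>

lemma leb_decomp_mass:
  fixes w :: "real^'n \<Rightarrow> real^'m"
  assumes r: "grad_repr \<Omega> w \<nu> \<sigma>" and d: "leb_decomp \<nu> Z h"
  shows "emeasure \<nu> UNIV = emeasure \<nu> Z + (\<integral>\<^sup>+x. ennreal (h x) \<partial>M)"
    and "AE x in M. norm (h x *\<^sub>R \<sigma> x) = h x"
proof -
  have s\<nu>[simp, measurable_cong]: "sets \<nu> = sets borel" by (rule sets_grad_repr[OF r])
  note measurable_grad_repr[OF r, measurable]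
  have conc: "emeasure \<nu> (UNIV - \<Omega>) = 0" and \<sigma>1: "AE x in \<nu>. norm (\<sigma> x) = 1"
    using r unfolding grad_repr_def by blast+
  have Z[measurable]: "Z \<in> sets borel" and h[measurable]: "h \<in> borel_measurable borel" and h0: "\<And>x. 0 \<le> h x"
    and eq: "density \<nu> (indicator (UNIV - Z)) = density lborel (\<lambda>x. ennreal (h x))"
    using d by (auto simp: leb_decomp_def)
  have [measurable]: "\<Omega> \<in> sets borel" using op by simp
  have out: "emeasure \<nu> (A - Z) = (\<integral>\<^sup>+x. ennreal (h x) * indicator A x \<partial>lborel)"
    if [measurable]: "A \<in> sets borel" for A
  proof -
    have "emeasure \<nu> (A - Z) = (\<integral>\<^sup>+x. indicator (A - Z) x \<partial>\<nu>)"
      by (subst nn_integral_indicator) auto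
    also have "\<dots> = (\<integral>\<^sup>+x. indicator (UNIV - Z) x * indicator A x \<partial>\<nu>)"
      by (intro nn_integral_cong) (auto simp: indicator_def)
    also have "\<dots> = emeasure (density \<nu> (indicator (UNIV - Z))) A"
      by (subst emeasure_density) (auto intro: borel_measurable_indicator)
    also have "\<dots> = (\<integral>\<^sup>+x. ennreal (h x) * indicator A x \<partial>lborel)"
      unfolding eq by (subst emeasure_density) auto
    finally show ?thesis .
  qed
  have "(\<integral>\<^sup>+x. ennreal (h x) * indicator (UNIV - \<Omega>) x \<partial>lborel) = emeasure \<nu> (UNIV - \<Omega> - Z)"
    by (rule out[symmetric]) simp
  also have "\<dots> \<le> emeasure \<nu> (UNIV - \<Omega>)"
    by (intro emeasure_mono) (auto simp del: Diff_UNIV)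
  also have "\<dots> = 0" by (rule conc)
  finally have zero: "(\<integral>\<^sup>+x. ennreal (h x) * indicator (UNIV - \<Omega>) x \<partial>lborel) = 0" by simp
  have "emeasure \<nu> UNIV = emeasure \<nu> Z + emeasure \<nu> (UNIV - Z)"
    by (subst plus_emeasure) auto
  also have "emeasure \<nu> (UNIV - Z) = (\<integral>\<^sup>+x. ennreal (h x) * indicator \<Omega> x + ennreal (h x) * indicator (UNIV - \<Omega>) x \<partial>lborel)"
    by (subst out) (auto intro!: nn_integral_cong simp: indicator_def)
  also have "\<dots> = (\<integral>\<^sup>+x. ennreal (h x) \<partial>M)"
    by (subst nn_integral_add) (auto simp: zero nn_integral_M)
  finally show "emeasure \<nu> UNIV = emeasure \<nu> Z + (\<integral>\<^sup>+x. ennreal (h x) \<partial>M)" .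
  \<comment> \<open>The unit length of \<open>\<sigma>\<close> is known only for
    \<open>\<nu>\<close>-almost every point. It transfers to Lebesgue measure where
    \<open>h > 0\<close>, and where \<open>h = 0\<close> both sides vanish.\<close>
  have "AE x in density \<nu> (indicator (UNIV - Z)). norm (\<sigma> x) = 1"
    using \<sigma>1 by (subst AE_density) (auto intro: borel_measurable_indicator elim: eventually_mono)
  then have "AE x in lborel. 0 < ennreal (h x) \<longrightarrow> norm (\<sigma> x) = 1"
    unfolding eq by (subst (asm) AE_density) auto
  then show "AE x in M. norm (h x *\<^sub>R \<sigma> x) = h x"
  proof (intro AE_M_of_AE_lborel, eventually_elim)
    case (elim x)
    then show ?case using h0[of x] by (cases "h x = 0") auto
  qed
qed

text \<open>The singular parts agree, so only the absolutely continuous parts are compared; their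
  integrands differ by at most \<open>1 / (\<mu> - 2)\<close> on a set of finite measure.\<close>

lemma Psi_energy_bounds:
  fixes w :: "real^'n \<Rightarrow> real^'m"
  assumes r: "grad_repr \<Omega> w \<nu> \<sigma>" and d: "leb_decomp \<nu> Z h" and mu: "\<mu> > 2"
  shows "(\<integral>\<^sup>+x. ennreal (Psi \<mu> (norm (h x *\<^sub>R \<sigma> x))) \<partial>M) + emeasure \<nu> Z \<le> emeasure \<nu> UNIV"
    and "emeasure \<nu> UNIV \<le> (\<integral>\<^sup>+x. ennreal (Psi \<mu> (norm (h x *\<^sub>R \<sigma> x))) \<partial>M) + emeasure \<nu> Z
       + ennreal (measure M \<Omega> / (\<mu> - 2))"
proof -
  have h[measurable]: "h \<in> borel_measurable borel" and h0: "\<And>x. 0 \<le> h x"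
    using d by (auto simp: leb_decomp_def)
  have hM[measurable]: "h \<in> borel_measurable M" using h by (rule borel_measurable_lebesgue_on)
  note mass = leb_decomp_mass[OF r d]
  have psi: "(\<integral>\<^sup>+x. ennreal (Psi \<mu> (norm (h x *\<^sub>R \<sigma> x))) \<partial>M) = (\<integral>\<^sup>+x. ennreal (Psi \<mu> (h x)) \<partial>M)"
    using mass(2) by (intro nn_integral_cong_AE) (auto elim!: eventually_mono)
  have "(\<integral>\<^sup>+x. ennreal (Psi \<mu> (h x)) \<partial>M) \<le> (\<integral>\<^sup>+x. ennreal (h x) \<partial>M)"
    by (intro nn_integral_mono ennreal_leI Psi_bounds mu h0)
  then show "(\<integral>\<^sup>+x. ennreal (Psi \<mu> (norm (h x *\<^sub>R \<sigma> x))) \<partial>M) + emeasure \<nu> Z \<le> emeasure \<nu> UNIV"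
    unfolding psi mass(1) by (simp add: add.commute add_left_mono)
  have pm[measurable]: "(\<lambda>x. Psi \<mu> (h x)) \<in> borel_measurable M"
    unfolding Psi_closed_form[OF mu h0] by measurable
  have "(\<integral>\<^sup>+x. ennreal (h x) \<partial>M) \<le> (\<integral>\<^sup>+x. ennreal (Psi \<mu> (h x)) + ennreal (1 / (\<mu> - 2)) \<partial>M)"
  proof (rule nn_integral_mono)
    fix x
    have "ennreal (h x) \<le> ennreal (Psi \<mu> (h x) + 1 / (\<mu> - 2))" by (intro ennreal_leI Psi_bounds mu h0)
    also have "\<dots> \<le> ennreal (Psi \<mu> (h x)) + ennreal (1 / (\<mu> - 2))"
      by (cases "Psi \<mu> (h x) \<ge> 0")
        (use mu in \<open>auto simp: ennreal_neg ennreal_plus[symmetric] simp del: ennreal_plus intro!: ennreal_leI\<close>)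
    finally show "ennreal (h x) \<le> ennreal (Psi \<mu> (h x)) + ennreal (1 / (\<mu> - 2))" .
  qed
  also have "\<dots> = (\<integral>\<^sup>+x. ennreal (Psi \<mu> (h x)) \<partial>M) + ennreal (1 / (\<mu> - 2)) * emeasure M \<Omega>"
    by (subst nn_integral_add) auto
  also have "ennreal (1 / (\<mu> - 2)) * emeasure M \<Omega> = ennreal (measure M \<Omega> / (\<mu> - 2))"
    using mu by (simp add: M.emeasure_eq_measure ennreal_mult[symmetric])
  finally show "emeasure \<nu> UNIV \<le> (\<integral>\<^sup>+x. ennreal (Psi \<mu> (norm (h x *\<^sub>R \<sigma> x))) \<partial>M) + emeasure \<nu> Z
       + ennreal (measure M \<Omega> / (\<mu> - 2))"
    unfolding psi mass(1) by (simp add: add_left_mono ac_simps)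
qed

section \<open>Minimizers as almost minimizers\<close>

lemma nn_integral_fidelity:
  assumes "integrable M (\<lambda>x. (norm (w x - f x))\<^sup>2)"
  shows "ennreal (lam / 2) * (\<integral>\<^sup>+x. ennreal ((norm (w x - f x))\<^sup>2) \<partial>M)
    = ennreal (lam / 2 * (LINT x|M. (norm (w x - f x))\<^sup>2))"
  using lam by (subst nn_integral_eq_integral[OF assms]) (auto simp: ennreal_mult[symmetric])

lemma integrable_fidelity:
  assumes "integrable M w" "ennreal (lam / 2) * (\<integral>\<^sup>+x. ennreal ((norm (w x - f x))\<^sup>2) \<partial>M) < \<infinity>"
  shows "integrable M (\<lambda>x. (norm (w x - f x))\<^sup>2)"
proof (rule integrableI_nonneg)
  show "(\<integral>\<^sup>+x. ennreal ((norm (w x - f x))\<^sup>2) \<partial>M) < \<infinity>"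
    using assms(2) lam by (auto simp: ennreal_mult_less_top)
qed (use assms(1) fm in auto)

lemma emeasure_eq_TV_value:
  assumes "competitor w \<nu> \<sigma>"
  shows "emeasure \<nu> UNIV + ennreal (lam / 2) * (\<integral>\<^sup>+x. ennreal ((norm (w x - f x))\<^sup>2) \<partial>M)
    = ennreal (TV w \<nu>)"
proof -
  have r: "grad_repr \<Omega> w \<nu> \<sigma>" and i: "integrable M (\<lambda>x. (norm (w x - f x))\<^sup>2)"
    using assms by (auto simp: TV_competitor_def)
  interpret finite_measure \<nu> by (rule finite_measure_grad_repr[OF r])
  show ?thesis
    unfolding nn_integral_fidelity[OF i] TV_value_def emeasure_eq_measure using lam
    by (subst ennreal_plus) auto
qed

lemma TV_value_nonneg: "0 \<le> TV w \<nu>"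
  using lam by (simp add: TV_value_def)

lemma is_BV_competitor: "competitor w \<nu> \<sigma> \<Longrightarrow> is_BV \<Omega> w"
  by (auto simp: TV_competitor_def is_BV_def)

text \<open>The zero function has energy equal to the fidelity of \<open>f\<close>, which is finite.
  Only \<open>Psi \<mu> 0 = 0\<close> enters, so every \<open>\<mu>\<close> is covered, including
  those outside the range of the energy comparison.\<close>

lemma K_minimizer_integrable:
  assumes "BV_minimizer \<Omega> (K_energy \<mu> \<Omega> lam f) w"
  shows "integrable M (\<lambda>x. (norm (w x - f x))\<^sup>2)"
proof -
  from assms obtain \<nu> \<sigma> where r: "grad_repr \<Omega> w \<nu> \<sigma>" and wi: "integrable M w"
    by (auto simp: BV_minimizer_def is_BV_def)
  obtain Z h where d: "leb_decomp \<nu> Z h"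
    using exists_leb_decomp[OF sets_grad_repr[OF r] finite_measure_grad_repr[OF r]] by blast
  let ?k = "(\<integral>\<^sup>+x. ennreal (Psi \<mu> (norm (h x *\<^sub>R \<sigma> x))) \<partial>M) + emeasure \<nu> Z
    + ennreal (lam/2) * (\<integral>\<^sup>+x. ennreal ((norm (w x - f x))\<^sup>2) \<partial>M)"
  let ?k' = "ennreal (lam/2) * (\<integral>\<^sup>+x. ennreal ((norm (0 - f x))\<^sup>2) \<partial>M)"
  have "K_energy \<mu> \<Omega> lam f w ?k" using r d unfolding K_energy_def by blast
  moreover have "K_energy \<mu> \<Omega> lam f (\<lambda>_. 0) ?k'"
    unfolding K_energy_def
    by (intro exI[of _ "null_measure borel"] exI[of _ "\<lambda>_. 0"] exI[of _ "{}"] conjI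
        grad_repr_zero leb_decomp_null_measure) (simp add: Psi_0)
  ultimately have "?k \<le> ?k'"
    using assms is_BV_competitor[OF competitor_zero] unfolding BV_minimizer_def by blast
  also have "?k' < \<infinity>"
    using f2 by (simp add: nn_integral_eq_integral ennreal_mult_less_top)
  finally have "?k < \<infinity>" .
  then have "ennreal (lam/2) * (\<integral>\<^sup>+x. ennreal ((norm (w x - f x))\<^sup>2) \<partial>M) < \<infinity>" by simp
  then show ?thesis by (rule integrable_fidelity[OF wi])
qed

text \<open>With \<open>J\<close> the total variation energy, \<open>K\<close> the approximate one
  and \<open>e\<close> the gap: \<open>J(w) \<le> K(w) + e \<le> K(v) + e \<le> J(v) + e\<close>.
  The chain runs in \<open>ennreal\<close> and becomes real only at its end, where both sides are
  finite.\<close>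

lemma K_minimizer_almost_min:
  assumes min: "BV_minimizer \<Omega> (K_energy \<mu> \<Omega> lam f) w" and mu: "\<mu> > 2"
  shows "amin (measure M \<Omega> / (\<mu> - 2)) w"
proof -
  from min obtain \<nu> \<sigma> where r: "grad_repr \<Omega> w \<nu> \<sigma>" and wi: "integrable M w"
    by (auto simp: BV_minimizer_def is_BV_def)
  have c: "competitor w \<nu> \<sigma>" using r wi K_minimizer_integrable[OF min] by (simp add: TV_competitor_def)
  obtain Z h where d: "leb_decomp \<nu> Z h"
    using exists_leb_decomp[OF sets_grad_repr[OF r] finite_measure_grad_repr[OF r]] by blast
  let ?e = "measure M \<Omega> / (\<mu> - 2)"
  let ?F = "\<lambda>v. ennreal (lam/2) * (\<integral>\<^sup>+x. ennreal ((norm (v x - f x))\<^sup>2) \<partial>M)"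
  have e0: "0 \<le> ?e" using mu by simp
  have "TV w \<nu> \<le> TV v \<nu>' + ?e" if v: "competitor v \<nu>' \<sigma>'" for v \<nu>' \<sigma>'
  proof -
    have r': "grad_repr \<Omega> v \<nu>' \<sigma>'" using v by (simp add: TV_competitor_def)
    obtain Z' h' where d': "leb_decomp \<nu>' Z' h'"
      using exists_leb_decomp[OF sets_grad_repr[OF r'] finite_measure_grad_repr[OF r']] by blast
    let ?k = "(\<integral>\<^sup>+x. ennreal (Psi \<mu> (norm (h x *\<^sub>R \<sigma> x))) \<partial>M) + emeasure \<nu> Z"
    let ?k' = "(\<integral>\<^sup>+x. ennreal (Psi \<mu> (norm (h' x *\<^sub>R \<sigma>' x))) \<partial>M) + emeasure \<nu>' Z'"
    have "K_energy \<mu> \<Omega> lam f w (?k + ?F w)" using r d unfolding K_energy_def by blast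
    moreover have "K_energy \<mu> \<Omega> lam f v (?k' + ?F v)" using r' d' unfolding K_energy_def by blast
    ultimately have kk: "?k + ?F w \<le> ?k' + ?F v"
      using min is_BV_competitor[OF v] unfolding BV_minimizer_def by blast
    have "ennreal (TV w \<nu>) = emeasure \<nu> UNIV + ?F w"
      using emeasure_eq_TV_value[OF c] by simp
    also have "\<dots> \<le> (?k + ennreal ?e) + ?F w"
      by (intro add_right_mono Psi_energy_bounds[OF r d mu])
    also have "\<dots> = (?k + ?F w) + ennreal ?e" by (simp add: ac_simps)
    also have "\<dots> \<le> (?k' + ?F v) + ennreal ?e" by (rule add_right_mono[OF kk])
    also have "\<dots> \<le> (emeasure \<nu>' UNIV + ?F v) + ennreal ?e"
      by (intro add_right_mono Psi_energy_bounds[OF r' d' mu])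
    also have "\<dots> = ennreal (TV v \<nu>' + ?e)"
      using emeasure_eq_TV_value[OF v] TV_value_nonneg e0 by (simp add: ennreal_plus)
    finally show ?thesis using TV_value_nonneg[of v \<nu>'] e0 by (subst (asm) ennreal_le_iff) auto
  qed
  then show ?thesis using c unfolding almost_min_def by blast
qed

text \<open>The direction used for uniqueness: two minimizers, both almost minimal with error 0,
  have L^2 distance 0. Comparison with the zero function shows that a minimizer has finite
  fidelity.\<close>

lemma TV_minimizer_almost_min:
  assumes min: "BV_minimizer \<Omega> (TV_energy \<Omega> lam f) w"
  shows "amin 0 w"
proof -
  from min obtain \<nu> \<sigma> where r: "grad_repr \<Omega> w \<nu> \<sigma>" and wi: "integrable M w"
    by (auto simp: BV_minimizer_def is_BV_def)
  let ?F = "\<lambda>v. ennreal (lam/2) * (\<integral>\<^sup>+x. ennreal ((norm (v x - f x))\<^sup>2) \<partial>M)"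
  have E: "TV_energy \<Omega> lam f w (emeasure \<nu> UNIV + ?F w)" using r unfolding TV_energy_def by blast
  have le: "emeasure \<nu> UNIV + ?F w \<le> ennreal (TV v \<nu>')" if v: "competitor v \<nu>' \<sigma>'" for v \<nu>' \<sigma>'
  proof -
    have "grad_repr \<Omega> v \<nu>' \<sigma>'" using v by (simp add: TV_competitor_def)
    then have "TV_energy \<Omega> lam f v (emeasure \<nu>' UNIV + ?F v)" unfolding TV_energy_def by blast
    then have "emeasure \<nu> UNIV + ?F w \<le> emeasure \<nu>' UNIV + ?F v"
      using min E is_BV_competitor[OF v] unfolding BV_minimizer_def by blast
    then show ?thesis by (simp only: emeasure_eq_TV_value[OF v])
  qed
  have "?F w \<le> emeasure \<nu> UNIV + ?F w" by simp
  also have "\<dots> < \<infinity>" using le_less_trans[OF le[OF competitor_zero] ennreal_less_top] by simp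
  finally have "integrable M (\<lambda>x. (norm (w x - f x))\<^sup>2)" by (rule integrable_fidelity[OF wi])
  then have c: "competitor w \<nu> \<sigma>" using r wi by (simp add: TV_competitor_def)
  have "TV w \<nu> \<le> TV v \<nu>' + 0" if v: "competitor v \<nu>' \<sigma>'" for v \<nu>' \<sigma>'
    using le[OF v] unfolding emeasure_eq_TV_value[OF c] using TV_value_nonneg by (simp add: ennreal_le_iff)
  with c show ?thesis unfolding almost_min_def by blast
qed

lemma almost_min_TV_minimizer:
  assumes "amin 0 u"
  shows "BV_minimizer \<Omega> (TV_energy \<Omega> lam f) u"
proof -
  obtain \<nu> \<sigma> where c: "competitor u \<nu> \<sigma>"
    and min: "\<And>v \<nu>' \<sigma>'. competitor v \<nu>' \<sigma>' \<Longrightarrow> TV u \<nu> \<le> TV v \<nu>' + 0"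
    using assms unfolding almost_min_def by blast
  have r: "grad_repr \<Omega> u \<nu> \<sigma>" using c by (simp add: TV_competitor_def)
  have "k \<le> k'" if v: "is_BV \<Omega> v" and k: "TV_energy \<Omega> lam f u k" and k': "TV_energy \<Omega> lam f v k'" for v k k'
  proof (cases "k' = \<infinity>")
    case False
    let ?F = "\<lambda>v. ennreal (lam/2) * (\<integral>\<^sup>+x. ennreal ((norm (v x - f x))\<^sup>2) \<partial>M)"
    obtain \<nu>\<^sub>1 \<sigma>\<^sub>1 where r1: "grad_repr \<Omega> u \<nu>\<^sub>1 \<sigma>\<^sub>1" and k1: "k = emeasure \<nu>\<^sub>1 UNIV + ?F u"
      using k unfolding TV_energy_def by blast
    obtain \<nu>' \<sigma>' where r': "grad_repr \<Omega> v \<nu>' \<sigma>'" and k1': "k' = emeasure \<nu>' UNIV + ?F v"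
      using k' unfolding TV_energy_def by blast
    have "?F v < \<infinity>" using False unfolding k1' by (simp add: less_top)
    then have c': "competitor v \<nu>' \<sigma>'"
      using v r' integrable_fidelity[of v] by (simp add: TV_competitor_def is_BV_def)
    have c1: "competitor u \<nu>\<^sub>1 \<sigma>\<^sub>1" using c r1 by (simp add: TV_competitor_def)
    \<comment> \<open>The value \<open>k\<close> may come from a representation of \<open>u\<close>
      other than the one for which minimality is known; duality compares their masses.\<close>
    have "measure \<nu>\<^sub>1 UNIV \<le> measure \<nu> UNIV"
    proof (rule grad_repr_mass_le[OF op r1])
      fix \<phi> :: "real^'n \<Rightarrow> real^'n^'m" assume "test_fun \<Omega> \<phi>" "\<forall>x. norm (\<phi> x) \<le> 1"
      then show "- (LINT x|M. u x \<bullet> mdiv \<phi> x) \<le> measure \<nu> UNIV"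
        using grad_repr_pairing_le[OF r, of \<phi> 1] by simp
    qed
    then have "TV u \<nu>\<^sub>1 \<le> TV u \<nu>" by (simp add: TV_value_def)
    with min[OF c'] have "TV u \<nu>\<^sub>1 \<le> TV v \<nu>'" by simp
    then show ?thesis
      unfolding k1 k1' emeasure_eq_TV_value[OF c1] emeasure_eq_TV_value[OF c'] by (rule ennreal_leI)
  qed simp
  then show ?thesis using is_BV_competitor[OF c] unfolding BV_minimizer_def by blast
qed

end

section \<open>The one-dimensional sup bound\<close>

text \<open>Zero mean makes the primitive vanish again to the right of \<open>b\<close>, so it is
  compactly supported, and it never exceeds the total integral of
  \<open>\<bar>k\<bar>\<close>.\<close>

lemma primitive_compact_support:
  fixes k :: "real \<Rightarrow> real"
  assumes k: "continuous_on UNIV k" and supp: "\<And>t. t < a \<or> b < t \<Longrightarrow> k t = 0" and ab: "a \<le> b"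
    and mean: "integral UNIV k = 0" and abs_int: "(\<lambda>t. \<bar>k t\<bar>) integrable_on UNIV"
  shows "\<exists>\<psi>. (\<forall>t. (\<psi> has_real_derivative k t) (at t)) \<and> (\<forall>t. t < a \<or> b < t \<longrightarrow> \<psi> t = 0) \<and>
    (\<forall>t. \<bar>\<psi> t\<bar> \<le> integral UNIV (\<lambda>t. \<bar>k t\<bar>))"
proof -
  \<comment> \<open>Starting one unit to the left of \<open>a\<close> puts every
    \<open>t \<ge> a\<close> in the interior of an interval on which the fundamental theorem
    applies.\<close>
  define \<psi> where "\<psi> t = integral {a - 1..t} k" for t
  have ki: "k integrable_on {c..d}" for c d
    using k by (intro integrable_continuous_real) (auto intro: continuous_on_subset)
  have left: "\<psi> t = 0" if "t < a" for t
  proof -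
    have "\<psi> t = integral {a - 1..t} (\<lambda>_. 0)"
      unfolding \<psi>_def by (rule integral_cong) (use supp that in auto)
    then show ?thesis by simp
  qed
  have right: "\<psi> t = 0" if "b < t" for t
  proof -
    have "(k has_integral \<psi> t) {a - 1..t}" unfolding \<psi>_def using ki by (rule integrable_integral)
    then have "(k has_integral \<psi> t) UNIV"
      by (rule has_integral_on_superset) (use supp that ab in auto)
    then show ?thesis using mean by (simp add: integral_unique)
  qed
  have "(\<psi> has_real_derivative k t) (at t)" for t
  proof (cases "t < a")
    case True
    have "((\<lambda>_. 0) has_real_derivative 0) (at t)" by simp
    then have "(\<psi> has_real_derivative 0) (at t)"
      by (rule has_field_derivative_transform_within_open[where S="{..<a}"]) (use True left in auto)
    then show ?thesis using supp True by simp
  next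
    case False
    have "(\<psi> has_real_derivative k t) (at t within {a - 1..t + 1})"
      unfolding \<psi>_def using k False
      by (intro integral_has_real_derivative) (auto intro: continuous_on_subset)
    moreover have "t \<in> interior {a - 1..t + 1}" using False by auto
    ultimately show ?thesis by (metis at_within_interior)
  qed
  moreover have "\<bar>\<psi> t\<bar> \<le> integral UNIV (\<lambda>t. \<bar>k t\<bar>)" for t
  proof -
    have abs: "(\<lambda>t. \<bar>k t\<bar>) integrable_on {a - 1..t}"
      using k by (intro integrable_continuous_real continuous_intros) (auto intro: continuous_on_subset)
    have "\<bar>\<psi> t\<bar> \<le> integral {a - 1..t} (\<lambda>t. \<bar>k t\<bar>)"
      unfolding \<psi>_def using integral_norm_bound_integral[OF ki abs] by simp
    also have "\<dots> \<le> integral UNIV (\<lambda>t. \<bar>k t\<bar>)"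
      by (intro integral_subset_le abs abs_int) auto
    finally show ?thesis .
  qed
  ultimately show ?thesis using left right by blast
qed

locale denoising_1d = denoising \<Omega> lam f
  for \<Omega> :: "(real^'n) set" and lam :: real and f :: "real^'n \<Rightarrow> real^'m" +
  fixes j :: 'n
  assumes one: "(UNIV :: 'n set) = {j}" and conn: "connected \<Omega>" and ne: "\<Omega> \<noteq> {}"
begin

definition \<iota> :: "real \<Rightarrow> real^'n" where "\<iota> t = t *\<^sub>R axis j 1"

lemma iota_component [simp]: "\<iota> t $ j = t"
  by (simp add: \<iota>_def axis_def)

lemma iota_of_component [simp]: "\<iota> (x $ j) = x"
proof -
  have "i = j" for i :: 'n using one by blast
  then show ?thesis by (metis vec_eq_iff iota_component)
qed

lemma continuous_iota: "continuous_on S \<iota>"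
  unfolding \<iota>_def by (intro continuous_intros)

lemma measurable_iota [measurable]: "\<iota> \<in> borel_measurable borel"
  by (intro borel_measurable_continuous_onI continuous_iota)

lemma distr_iota: "distr lborel borel \<iota> = lborel"
proof (rule lborel_eqI[symmetric])
  have "(Basis :: (real^'n) set) = {axis j 1}"
    unfolding Basis_vec_def using one by auto
  then have bas: "Basis = {axis j (1::real)}" .
  fix l u :: "real^'n" assume le: "\<And>b. b \<in> Basis \<Longrightarrow> l \<bullet> b \<le> u \<bullet> b"
  have "\<iota> -` box l u = {l $ j <..< u $ j}"
    by (auto simp: box_def bas inner_axis)
  moreover have "l $ j \<le> u $ j" using le[of "axis j 1"] bas by (simp add: inner_axis)
  ultimately show "emeasure (distr lborel borel \<iota>) (box l u) = (\<Prod>b\<in>Basis. (u - l) \<bullet> b)"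
    by (simp add: emeasure_distr bas inner_axis)
qed simp

lemma integral_M_iota:
  fixes g :: "real^'n \<Rightarrow> real"
  assumes g: "continuous_on UNIV g" and cp: "compact (supp g)" and sub: "supp g \<subseteq> \<Omega>"
  shows "integrable lborel (\<lambda>t. g (\<iota> t))" "integral UNIV (\<lambda>t. g (\<iota> t)) = (LINT x|M. g x)"
proof -
  let ?K = "supp g"
  have gm[measurable]: "g \<in> borel_measurable borel" using g by (rule borel_measurable_continuous_onI)
  have ind: "indicator ?K x *\<^sub>R g x = g x" for x
    using closure_subset[of "{x. g x \<noteq> 0}"] by (auto simp: indicator_def)
  have "integrable lborel (\<lambda>x. indicator ?K x *\<^sub>R g x)"
    using g cp by (intro borel_integrable_compact) (auto intro: continuous_on_subset)
  then have gi: "integrable lborel g" unfolding ind .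
  then have "integrable (distr lborel borel \<iota>) g" unfolding distr_iota .
  then show gti: "integrable lborel (\<lambda>t. g (\<iota> t))" by (subst (asm) integrable_distr_eq) auto
  have "integral UNIV (\<lambda>t. g (\<iota> t)) = (LINT t|lborel. g (\<iota> t))" by (rule integral_lborel[OF gti])
  also have "\<dots> = (LINT x|distr lborel borel \<iota>. g x)" by (rule integral_distr[symmetric]) auto
  also have "\<dots> = (LINT x|lborel. g x)" unfolding distr_iota ..
  also have "\<dots> = (LINT x|lebesgue. g x)" by (rule integral_completion[symmetric]) simp
  also have "\<dots> = (LINT x|lebesgue. indicator \<Omega> x *\<^sub>R g x)"
    using sub closure_subset[of "{x. g x \<noteq> 0}"] by (intro Bochner_Integration.integral_cong) (auto simp: indicator_def)
  also have "\<dots> = (LINT x|M. g x)"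
    using fmeasurableD[OF Omega_lmeasurable] by (intro integral_restrict_space[symmetric]) auto
  finally show "integral UNIV (\<lambda>t. g (\<iota> t)) = (LINT x|M. g x)" .
qed

text \<open>In one dimension \<open>g\<close> is the divergence of its primitive, whose sup norm is
  at most the L^1 norm of \<open>g\<close>. The primitive need not vanish in the gaps of the support
  of \<open>g\<close>; connectedness of \<open>\<Omega>\<close> keeps the whole interval between the
  extreme support points inside the domain.\<close>

lemma mean_zero_pairing:
  fixes g :: "real^'n \<Rightarrow> real" and w :: "real^'n \<Rightarrow> real^'m"
  assumes g: "continuous_on UNIV g" and cp: "compact (supp g)" and sub: "supp g \<subseteq> \<Omega>"
    and mean: "(LINT x|M. g x) = 0" and r: "grad_repr \<Omega> w \<nu> \<sigma>"
  shows "- (LINT x|M. g x * w x $ i) \<le> (LINT x|M. \<bar>g x\<bar>) * measure \<nu> UNIV"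
proof -
  let ?K = "supp g"
  obtain x0 where x0: "x0 \<in> \<Omega>" using ne by blast
  \<comment> \<open>The extra point of \<open>\<Omega>\<close> keeps \<open>S\<close> nonempty when
    \<open>g\<close> vanishes identically.\<close>
  define S where "S = insert (x0 $ j) ((\<lambda>x. x $ j) ` ?K)"
  have S: "compact S" "S \<noteq> {}" unfolding S_def using cp
    by (auto intro!: compact_insert compact_continuous_image continuous_intros)
  have SI: "S \<subseteq> (\<lambda>x. x $ j) ` \<Omega>" using x0 sub by (auto simp: S_def)
  define a where "a = Inf S"
  define b where "b = Sup S"
  have aS: "a \<in> S" unfolding a_def using S by (intro closed_contains_Inf) (auto intro: compact_imp_closed bounded_imp_bdd_below compact_imp_bounded)
  have bS: "b \<in> S" unfolding b_def using S by (intro closed_contains_Sup) (auto intro: compact_imp_closed bounded_imp_bdd_above compact_imp_bounded)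
  have Sab: "a \<le> t \<and> t \<le> b" if "t \<in> S" for t
    unfolding a_def b_def using that S
    by (auto intro!: cInf_lower cSup_upper bounded_imp_bdd_below bounded_imp_bdd_above compact_imp_bounded)
  have "connected ((\<lambda>x. x $ j) ` \<Omega>)" using conn by (intro connected_continuous_image continuous_intros)
  then have iv: "is_interval ((\<lambda>x. x $ j) ` \<Omega>)" by (simp add: is_interval_connected_1)
  have inO: "\<iota> t \<in> \<Omega>" if "a \<le> t" "t \<le> b" for t
  proof -
    have "t \<in> (\<lambda>x. x $ j) ` \<Omega>"
      by (rule mem_is_interval_1_I[OF iv subsetD[OF SI aS] subsetD[OF SI bS] that])
    then show ?thesis by auto
  qed
  let ?k = "\<lambda>t. g (\<iota> t)"
  have k0: "?k t = 0" if "t < a \<or> b < t" for t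
  proof (rule ccontr)
    assume "?k t \<noteq> 0"
    then have "\<iota> t \<in> ?K" using closure_subset[of "{x. g x \<noteq> 0}"] by auto
    then have "t \<in> S" unfolding S_def using image_eqI[of t "\<lambda>x. x $ j" "\<iota> t" ?K] by simp
    then show False using Sab that by force
  qed
  have kc: "continuous_on UNIV ?k"
    using g continuous_iota by (intro continuous_on_compose2[of UNIV g UNIV \<iota>]) auto
  have absg: "continuous_on UNIV (\<lambda>x. \<bar>g x\<bar>)" using g by (intro continuous_intros)
  have supp_abs: "{x. \<bar>g x\<bar> \<noteq> 0} = {x. g x \<noteq> 0}" by auto
  note ig = integral_M_iota[OF g cp sub]
  note iabs = integral_M_iota[OF absg, unfolded supp_abs, OF cp sub]
  have "(\<lambda>t. \<bar>?k t\<bar>) integrable_on UNIV"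
    using has_integral_integral_lborel[OF iabs(1)] by blast
  then have "\<exists>\<psi>. (\<forall>t. (\<psi> has_real_derivative ?k t) (at t)) \<and> (\<forall>t. t < a \<or> b < t \<longrightarrow> \<psi> t = 0) \<and>
    (\<forall>t. \<bar>\<psi> t\<bar> \<le> integral UNIV (\<lambda>t. \<bar>?k t\<bar>))"
    using Sab[OF aS] ig(2) mean by (intro primitive_compact_support kc k0) auto
  then obtain \<psi> where \<psi>': "\<And>t. (\<psi> has_real_derivative ?k t) (at t)"
    and \<psi>0: "\<And>t. t < a \<or> b < t \<Longrightarrow> \<psi> t = 0" and \<psi>b: "\<And>t. \<bar>\<psi> t\<bar> \<le> (LINT x|M. \<bar>g x\<bar>)"
    unfolding iabs(2) by blast
  define E :: "real^'n^'m" where "E = axis i (axis j 1)"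
  define \<phi> where "\<phi> x = \<psi> (x $ j) *\<^sub>R E" for x
  have der: "(\<phi> has_derivative (\<lambda>h. (g x * h $ j) *\<^sub>R E)) (at x)" for x
  proof -
    have "((\<lambda>x. \<psi> (x $ j)) has_derivative (\<lambda>h. g x * h $ j)) (at x)"
      using has_derivative_compose[OF bounded_linear.has_derivative[OF bounded_linear_vec_nth has_derivative_ident] \<psi>'[of "x $ j", unfolded has_field_derivative_def]]
      by simp
    then show ?thesis unfolding \<phi>_def by (rule has_derivative_scaleR_left)
  qed
  have fd: "frechet_derivative \<phi> (at x) = (\<lambda>h. (g x * h $ j) *\<^sub>R E)" for x
    using frechet_derivative_at[OF der] by simp
  have supp: "supp \<phi> \<subseteq> \<iota> ` {a..b}"
  proof (rule closure_minimal)
    show "{x. \<phi> x \<noteq> 0} \<subseteq> \<iota> ` {a..b}"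
    proof
      fix x assume "x \<in> {x. \<phi> x \<noteq> 0}"
      then have "\<psi> (x $ j) \<noteq> 0" by (auto simp: \<phi>_def)
      then have "x $ j \<in> {a..b}" using \<psi>0[of "x $ j"] by force
      then show "x \<in> \<iota> ` {a..b}" by (intro image_eqI[of _ _ "x $ j"]) auto
    qed
    show "closed (\<iota> ` {a..b})"
      by (intro compact_imp_closed compact_continuous_image continuous_iota) simp
  qed
  have test: "test_fun \<Omega> \<phi>"
    unfolding test_fun_def
  proof (intro conjI allI)
    have "compact (\<iota> ` {a..b})" by (intro compact_continuous_image continuous_iota) simp
    then show "compact (supp \<phi>)"
      using supp by (meson closure_subset compact_closure compact_imp_bounded bounded_subset subset_trans)
    show "supp \<phi> \<subseteq> \<Omega>" using supp inO by fastforce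
    show "\<phi> differentiable at x" for x using der differentiable_def by blast
    show "continuous_on UNIV (\<lambda>x. frechet_derivative \<phi> (at x) (axis j' 1))" for j'
      unfolding fd by (intro continuous_intros g)
  qed
  have "mdiv \<phi> x = g x *\<^sub>R axis i 1" for x
    unfolding mdiv_def fd one by (simp add: vec_eq_iff E_def axis_def)
  then have "w x \<bullet> mdiv \<phi> x = g x * w x $ i" for x by (simp add: inner_axis)
  moreover have "norm (\<phi> x) \<le> (LINT x|M. \<bar>g x\<bar>)" for x
    using \<psi>b[of "x $ j"] by (simp add: \<phi>_def E_def norm_eq_sqrt_inner[of "axis i (axis j 1)"] inner_axis_axis)
  ultimately show ?thesis using grad_repr_pairing_le[OF r test] by simp
qed

section \<open>Pairing bounds without the mean-zero condition\<close>

lemma exists_unit_bump: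
  "\<exists>\<eta> :: real^'n \<Rightarrow> real. continuous_on UNIV \<eta> \<and> (\<exists>B. \<forall>x. \<bar>\<eta> x\<bar> \<le> B) \<and> compact (supp \<eta>) \<and>
    supp \<eta> \<subseteq> \<Omega> \<and> (LINT x|M. \<bar>\<eta> x\<bar>) = 1 \<and> (LINT x|M. \<eta> x) = 1"
proof -
  obtain x0 where x0: "x0 \<in> \<Omega>" using ne by blast
  then obtain r where r: "r > 0" "cball x0 r \<subseteq> \<Omega>" using op open_contains_cball by blast
  obtain \<zeta> :: "real^'n \<Rightarrow> real" where \<zeta>: "C1_scalar \<zeta>" "\<And>x. 0 \<le> \<zeta> x \<and> \<zeta> x \<le> 1" "\<And>x. x \<in> cball x0 r \<Longrightarrow> \<zeta> x = 1"
    "compact (supp \<zeta>)" "supp \<zeta> \<subseteq> \<Omega>"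
    using C1_bump[OF compact_cball op r(2)] by blast
  define Z where "Z = (LINT x|M. \<zeta> x)"
  have \<zeta>c: "continuous_on UNIV \<zeta>" using \<zeta>(1) by (rule C1_scalar_continuous)
  have \<zeta>m[measurable]: "\<zeta> \<in> borel_measurable M"
    using \<zeta>c by (intro borel_measurable_lebesgue_on borel_measurable_continuous_onI)
  have \<zeta>i: "integrable M \<zeta>"
    by (rule M.integrable_const_bound[of _ 1]) (use \<zeta>(2) in auto)
  have "Z > 0"
  proof -
    have cb: "cball x0 r \<in> sets M"
      using r(2) by (auto simp: sets_restrict_space_iff fmeasurableD[OF Omega_lmeasurable])
    have "0 < measure lebesgue (cball x0 r)" using r(1) by (simp add: content_cball_pos)
    also have "\<dots> = measure M (cball x0 r)"
      using r(2) fmeasurableD[OF Omega_lmeasurable] by (subst measure_restrict_space) auto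
    also have "\<dots> = (LINT x|M. indicator (cball x0 r) x)" using r(2) by (simp add: Int_absorb2)
    also have "\<dots> \<le> Z"
      unfolding Z_def
    proof (rule integral_mono[OF _ \<zeta>i])
      show "integrable M (indicat_real (cball x0 r))"
        by (rule integrable_real_indicator[OF cb]) (simp add: less_top[symmetric])
      show "indicat_real (cball x0 r) x \<le> \<zeta> x" for x
        using \<zeta>(2)[of x] \<zeta>(3)[of x] by (auto simp: indicator_def)
    qed
    finally show ?thesis .
  qed
  define \<eta> where "\<eta> x = \<zeta> x / Z" for x
  have "{x. \<eta> x \<noteq> 0} = {x. \<zeta> x \<noteq> 0}" using \<open>Z > 0\<close> by (auto simp: \<eta>_def)
  moreover have "continuous_on UNIV \<eta>" unfolding \<eta>_def using \<zeta>c \<open>Z > 0\<close> by (intro continuous_intros) auto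
  moreover have "\<bar>\<eta> x\<bar> \<le> 1 / Z" for x
    using \<zeta>(2)[of x] \<open>Z > 0\<close> by (simp add: \<eta>_def divide_right_mono)
  moreover have "\<bar>\<eta> x\<bar> = \<eta> x" for x using \<zeta>(2)[of x] \<open>Z > 0\<close> by (simp add: \<eta>_def)
  moreover have "(LINT x|M. \<eta> x) = 1" unfolding \<eta>_def using \<open>Z > 0\<close> by (simp add: Z_def)
  ultimately show ?thesis using \<zeta>(4,5) by (intro exI[of _ \<eta>]) auto
qed

text \<open>The mean \<open>c\<close> of \<open>g\<close> is carried by a fixed bump
  \<open>\<eta>\<close> of integral one. The mean-zero difference has L^1 norm at most twice that of
  \<open>g\<close>, hence the factor 2; the term \<open>c \<eta>\<close> costs the sup norm of
  \<open>\<eta>\<close> times the L^1 norm of \<open>w\<close>, hence \<open>C\<close>.\<close>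

lemma exists_pairing_bound:
  "\<exists>C\<ge>0. \<forall>(g :: real^'n \<Rightarrow> real) (w :: real^'n \<Rightarrow> real^'m) \<nu> \<sigma> i.
    continuous_on UNIV g \<longrightarrow> compact (supp g) \<longrightarrow> supp g \<subseteq> \<Omega> \<longrightarrow>
    integrable M w \<longrightarrow> grad_repr \<Omega> w \<nu> \<sigma> \<longrightarrow>
    (LINT x|M. g x * w x $ i) \<le> (C * (LINT x|M. norm (w x)) + 2 * measure \<nu> UNIV) * (LINT x|M. \<bar>g x\<bar>)"
proof -
  obtain \<eta> :: "real^'n \<Rightarrow> real" and B where \<eta>: "continuous_on UNIV \<eta>" "\<And>x. \<bar>\<eta> x\<bar> \<le> B"
    "compact (supp \<eta>)" "supp \<eta> \<subseteq> \<Omega>" "(LINT x|M. \<bar>\<eta> x\<bar>) = 1" "(LINT x|M. \<eta> x) = 1"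
    using exists_unit_bump by blast
  have B0: "0 \<le> B" using \<eta>(2)[of 0] by linarith
  have \<eta>m[measurable]: "\<eta> \<in> borel_measurable M"
    using \<eta>(1) by (intro borel_measurable_lebesgue_on borel_measurable_continuous_onI)
  have \<eta>i: "integrable M \<eta>" by (rule M.integrable_const_bound[of _ B]) (use \<eta>(2) in auto)
  have "(LINT x|M. g x * w x $ i) \<le> (B * (LINT x|M. norm (w x)) + 2 * measure \<nu> UNIV) * (LINT x|M. \<bar>g x\<bar>)"
    if g: "continuous_on UNIV g" and cp: "compact (supp g)" and sub: "supp g \<subseteq> \<Omega>"
      and w: "integrable M w" and r: "grad_repr \<Omega> w \<nu> \<sigma>"
    for g :: "real^'n \<Rightarrow> real" and w :: "real^'n \<Rightarrow> real^'m" and \<nu> \<sigma> i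
  proof -
    have "\<exists>Bg. \<forall>x. norm (g x) \<le> Bg"
      by (rule bounded_of_support[OF g cp]) (use closure_subset[of "{x. g x \<noteq> 0}"] in auto)
    then obtain Bg where Bg: "\<And>x. norm (g x) \<le> Bg" by blast
    have gm[measurable]: "g \<in> borel_measurable M"
      using g by (intro borel_measurable_lebesgue_on borel_measurable_continuous_onI)
    have gi: "integrable M g" by (rule M.integrable_const_bound[of _ Bg]) (use Bg in auto)
    have wi: "integrable M (\<lambda>x. w x $ i)" 
      by (rule integrable_bounded_linear[OF bounded_linear_vec_nth w])
    have gw: "integrable M (\<lambda>x. g x * w x $ i)"
      by (rule integrable_bounded_mult[OF wi gm, of Bg]) (use Bg in auto)
    have \<eta>w: "integrable M (\<lambda>x. \<eta> x * w x $ i)"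
      by (rule integrable_bounded_mult[OF wi \<eta>m, of B]) (use \<eta>(2) in auto)
    define c where "c = (LINT x|M. g x)"
    define L where "L = (LINT x|M. \<bar>g x\<bar>)"
    define W where "W = (LINT x|M. norm (w x))"
    define m where "m = measure \<nu> UNIV"
    have cL: "\<bar>c\<bar> \<le> L" unfolding c_def L_def using integral_norm_bound[of M g] by simp
    have m0: "0 \<le> m" by (simp add: m_def)
    \<comment> \<open>The sign is chosen so that the minus in \<open>mean_zero_pairing\<close> turns
      the \<open>g\<close> part into an upper bound.\<close>
    let ?h = "\<lambda>x. c * \<eta> x - g x"
    have supp: "supp ?h \<subseteq> supp \<eta> \<union> supp g"
      unfolding closure_Un[symmetric] by (intro closure_mono) auto
    have "- (LINT x|M. ?h x * w x $ i) \<le> (LINT x|M. \<bar>?h x\<bar>) * measure \<nu> UNIV"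
    proof (rule mean_zero_pairing[OF _ _ _ _ r])
      show "continuous_on UNIV ?h" using g \<eta>(1) by (intro continuous_intros)
      have "bounded (supp \<eta> \<union> supp g)"
        using cp \<eta>(3) by (simp add: compact_imp_bounded)
      from bounded_subset[OF this supp] show "compact (supp ?h)"
        by (simp add: compact_eq_bounded_closed)
      show "supp ?h \<subseteq> \<Omega>" using supp sub \<eta>(4) by blast
      show "(LINT x|M. ?h x) = 0" using gi \<eta>i \<eta>(6) by (simp add: c_def)
    qed
    moreover have "(LINT x|M. ?h x * w x $ i) = c * (LINT x|M. \<eta> x * w x $ i) - (LINT x|M. g x * w x $ i)"
      using gw \<eta>w by (simp add: left_diff_distrib mult.assoc)
    moreover have "(LINT x|M. \<bar>?h x\<bar>) \<le> 2 * L"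
    proof -
      have "(LINT x|M. \<bar>?h x\<bar>) \<le> (LINT x|M. \<bar>c\<bar> * \<bar>\<eta> x\<bar> + \<bar>g x\<bar>)"
      proof (rule integral_mono)
        show "\<bar>c * \<eta> x - g x\<bar> \<le> \<bar>c\<bar> * \<bar>\<eta> x\<bar> + \<bar>g x\<bar>" for x
          using abs_triangle_ineq4[of "c * \<eta> x" "g x"] by (simp add: abs_mult)
      qed (use gi \<eta>i in auto)
      also have "\<dots> = \<bar>c\<bar> + L" using gi \<eta>i \<eta>(5) by (simp add: L_def)
      finally show ?thesis using cL by simp
    qed
    then have "(LINT x|M. \<bar>?h x\<bar>) * m \<le> 2 * L * m" using m0 by (intro mult_right_mono) auto
    moreover have "c * (LINT x|M. \<eta> x * w x $ i) \<le> L * (B * W)"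
    proof -
      have "\<bar>\<integral>x. \<eta> x * w x $ i \<partial>M\<bar> \<le> (LINT x|M. \<bar>\<eta> x * w x $ i\<bar>)"
        using integral_norm_bound[of M "\<lambda>x. \<eta> x * w x $ i"] by simp
      also have "\<dots> \<le> (LINT x|M. B * norm (w x))"
      proof (rule integral_mono)
        show "\<bar>\<eta> x * w x $ i\<bar> \<le> B * norm (w x)" for x
          unfolding abs_mult using \<eta>(2) component_le_norm_cart[of "w x" i] B0 by (intro mult_mono) auto
      qed (use \<eta>w w in auto)
      finally have "\<bar>\<integral>x. \<eta> x * w x $ i \<partial>M\<bar> \<le> B * W" by (simp add: W_def)
      then have "\<bar>c\<bar> * \<bar>\<integral>x. \<eta> x * w x $ i \<partial>M\<bar> \<le> L * (B * W)" using cL by (intro mult_mono) auto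
      then show ?thesis by (simp add: abs_mult[symmetric])
    qed
    ultimately have "(LINT x|M. g x * w x $ i) \<le> L * (B * W) + 2 * L * m" unfolding m_def[symmetric] by linarith
    then show ?thesis unfolding L_def[symmetric] W_def[symmetric] m_def[symmetric] by (simp add: algebra_simps)
  qed
  then show ?thesis using B0 by blast
qed

end

section \<open>Sup bounds from duality with compactly supported functions\<close>

context denoising
begin

text \<open>A Lebesgue measurable function is an almost everywhere limit of continuous ones;
  clipping to \<open>[-1, 1]\<close> and multiplying by cutoffs that increase to 1 inside
  \<open>\<Omega>\<close> preserve the limit.\<close>

lemma bounded_approx_by_compactly_supported:
  fixes s :: "real^'n \<Rightarrow> real"
  assumes s: "s \<in> borel_measurable M" and s1: "\<And>x. \<bar>s x\<bar> \<le> 1"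
  shows "\<exists>g. (\<forall>n. continuous_on UNIV (g n) \<and> (\<forall>x. \<bar>g n x\<bar> \<le> 1) \<and> compact (supp (g n)) \<and>
    supp (g n) \<subseteq> \<Omega>) \<and> (AE x in M. (\<lambda>n. g n x) \<longlonglongrightarrow> s x)"
proof -
  have Os: "\<Omega> \<in> sets lebesgue" using fmeasurableD[OF Omega_lmeasurable] .
  have "(\<lambda>x. if x \<in> \<Omega> then s x else 0) \<in> borel_measurable lebesgue"
    using s Os by (simp add: borel_measurable_if)
  from lebesgue_measurable_imp_measurable_on_real[OF this Os]
  obtain N G where N: "negligible N" and G: "\<And>n. continuous_on UNIV (G n)"
    "\<And>x. x \<notin> N \<Longrightarrow> (\<lambda>n. G n x) \<longlonglongrightarrow> (if x \<in> \<Omega> then if x \<in> \<Omega> then s x else 0 else 0)"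
    unfolding measurable_on_def by blast
  have cO: "closed (- \<Omega>)" using op by (rule closed_Compl)
  have neO: "- \<Omega> \<noteq> {}"
  proof
    assume "- \<Omega> = {}"
    then have "\<Omega> = UNIV" by auto
    then show False using bd by simp
  qed
  \<comment> \<open>For \<open>n > 0\<close> the cutoff vanishes within distance \<open>1/n\<close>
    of the complement and is 1 beyond distance \<open>2/n\<close>. The shift by 1 keeps the closed
    support inside \<open>\<Omega>\<close>.\<close>
  define c where "c n x = max 0 (min 1 (real n * infdist x (- \<Omega>) - 1))" for n x
  define g where "g n x = c n x * max (-1) (min 1 (G n x))" for n x
  have cc: "continuous_on UNIV (c n)" for n unfolding c_def by (intro continuous_intros)
  have c01: "0 \<le> c n x" "c n x \<le> 1" for n x by (auto simp: c_def)
  have gc: "continuous_on UNIV (g n)" for n unfolding g_def by (intro continuous_intros cc G(1))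
  have g1: "\<bar>g n x\<bar> \<le> 1" for n x
    unfolding g_def abs_mult by (rule mult_le_one) (use c01[of n x] in auto)
  have supp: "supp (g n) \<subseteq> \<Omega>" for n
  proof -
    have "supp (g n) \<subseteq> {x. 1 \<le> real n * infdist x (- \<Omega>)}"
    proof (rule closure_minimal)
      show "{x. g n x \<noteq> 0} \<subseteq> {x. 1 \<le> real n * infdist x (- \<Omega>)}" by (auto simp: g_def c_def)
      show "closed {x. 1 \<le> real n * infdist x (- \<Omega>)}" by (intro closed_Collect_le continuous_intros)
    qed
    also have "\<dots> \<subseteq> \<Omega>"
    proof
      fix x assume x: "x \<in> {x. 1 \<le> real n * infdist x (- \<Omega>)}"
      show "x \<in> \<Omega>" by (rule ccontr) (use x in auto)
    qed
    finally show ?thesis .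
  qed
  have "compact (supp (g n))" for n
    using bounded_subset[OF bd supp[of n]] by (simp add: compact_eq_bounded_closed)
  moreover have "AE x in M. (\<lambda>n. g n x) \<longlonglongrightarrow> s x"
  proof (subst AE_restrict_space_iff)
    show "\<Omega> \<inter> space lebesgue \<in> sets lebesgue" using Os by simp
    have "AE x in lebesgue. x \<notin> N" using N by (intro AE_not_in) (simp add: negligible_iff_null_sets)
    then show "AE x in lebesgue. x \<in> \<Omega> \<longrightarrow> (\<lambda>n. g n x) \<longlonglongrightarrow> s x"
    proof eventually_elim
      case (elim x)
      show ?case
      proof
        assume x: "x \<in> \<Omega>"
        have pos: "0 < infdist x (- \<Omega>)"
          using in_closed_iff_infdist_zero[OF cO neO, of x] x infdist_nonneg[of x "- \<Omega>"] by auto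
        have "\<forall>\<^sub>F n in sequentially. c n x = 1"
        proof -
          obtain n0 :: nat where n0: "2 / infdist x (- \<Omega>) \<le> real n0" using real_arch_simple by blast
          have "c n x = 1" if "n \<ge> n0" for n
          proof -
            have "2 / infdist x (- \<Omega>) \<le> real n" using n0 that by linarith
            then have "2 \<le> real n * infdist x (- \<Omega>)" using pos by (simp add: field_simps)
            then show ?thesis by (simp add: c_def)
          qed
          then show ?thesis unfolding eventually_sequentially by blast
        qed
        then have "(\<lambda>n. c n x) \<longlonglongrightarrow> 1" by (rule tendsto_eventually)
        moreover have "(\<lambda>n. max (-1) (min 1 (G n x))) \<longlonglongrightarrow> max (-1) (min 1 (s x))"
          using G(2)[OF elim] x by (intro tendsto_intros) auto
        ultimately have "(\<lambda>n. g n x) \<longlonglongrightarrow> 1 * max (-1) (min 1 (s x))"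
          unfolding g_def by (intro tendsto_mult)
        moreover have "max (-1) (min 1 (s x)) = s x" using s1[of x] by auto
        ultimately show "(\<lambda>n. g n x) \<longlonglongrightarrow> s x" by simp
      qed
    qed
  qed
  ultimately show ?thesis using gc g1 supp by (intro exI[of _ g]) auto
qed

text \<open>The critical test is the sign of \<open>y\<close> on the set where
  \<open>\<bar>y\<bar> > C\<close>. Approximation carries the duality bound over to this
  discontinuous function \<open>s\<close>; then \<open>s y - C \<bar>s\<bar>\<close> is nonnegative
  with integral at most 0, so it vanishes and the set is null.\<close>

lemma AE_bounded_by_duality:
  fixes y :: "real^'n \<Rightarrow> real"
  assumes y: "integrable M y" and C: "C \<ge> 0"
    and dual: "\<And>g. continuous_on UNIV g \<Longrightarrow> compact (supp g) \<Longrightarrow> supp g \<subseteq> \<Omega> \<Longrightarrow>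
      (LINT x|M. g x * y x) \<le> C * (LINT x|M. \<bar>g x\<bar>)"
  shows "AE x in M. \<bar>y x\<bar> \<le> C"
proof -
  define s where "s x = (if y x > C then 1 else if y x < - C then -1 else 0 :: real)" for x
  have [measurable]: "y \<in> borel_measurable M" using y by auto
  have sm[measurable]: "s \<in> borel_measurable M" unfolding s_def by measurable
  have s1: "\<bar>s x\<bar> \<le> 1" for x by (simp add: s_def)
  obtain g where g: "\<And>n. continuous_on UNIV (g n)" "\<And>n x. \<bar>g n x\<bar> \<le> 1"
    "\<And>n. compact (supp (g n))" "\<And>n. supp (g n) \<subseteq> \<Omega>"
    and lim: "AE x in M. (\<lambda>n. g n x) \<longlonglongrightarrow> s x"
    using bounded_approx_by_compactly_supported[OF sm s1] by auto
  have [measurable]: "g n \<in> borel_measurable M" for n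
    using g(1) by (intro borel_measurable_lebesgue_on borel_measurable_continuous_onI)
  have "(\<lambda>n. \<integral>x. g n x * y x \<partial>M) \<longlonglongrightarrow> (LINT x|M. s x * y x)"
  proof (rule integral_dominated_convergence[where w="\<lambda>x. \<bar>y x\<bar>"])
    show "AE x in M. (\<lambda>n. g n x * y x) \<longlonglongrightarrow> s x * y x"
      using lim by eventually_elim (intro tendsto_mult_right)
    show "AE x in M. norm (g n x * y x) \<le> \<bar>y x\<bar>" for n
      using g(2)[of n] by (auto simp: abs_mult intro!: mult_left_le_one_le)
  qed (use y in auto)
  moreover have "(\<lambda>n. C * (LINT x|M. \<bar>g n x\<bar>)) \<longlonglongrightarrow> C * (LINT x|M. \<bar>s x\<bar>)"
  proof (intro tendsto_mult_left integral_dominated_convergence[where w="\<lambda>x. 1"])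
    show "AE x in M. (\<lambda>n. \<bar>g n x\<bar>) \<longlonglongrightarrow> \<bar>s x\<bar>"
      using lim by eventually_elim (intro tendsto_rabs)
    show "AE x in M. norm \<bar>g n x\<bar> \<le> 1" for n using g(2)[of n] by auto
  qed auto
  ultimately have le: "(LINT x|M. s x * y x) \<le> C * (LINT x|M. \<bar>s x\<bar>)"
    using dual g(1,3,4) by (intro LIMSEQ_le[where X="\<lambda>n. \<integral>x. g n x * y x \<partial>M"]) auto
  have i1: "integrable M (\<lambda>x. s x * y x)" by (rule integrable_bounded_mult[OF y sm s1])
  have i2: "integrable M (\<lambda>x. \<bar>s x\<bar>)" by (rule M.integrable_const_bound[of _ 1]) (use s1 in auto)
  have nn: "0 \<le> s x * y x - C * \<bar>s x\<bar>" for x using C by (auto simp: s_def)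
  have "(LINT x|M. s x * y x - C * \<bar>s x\<bar>) = (LINT x|M. s x * y x) - C * (LINT x|M. \<bar>s x\<bar>)"
    using i1 i2 by simp
  also have "\<dots> \<le> 0" using le by simp
  finally have "(LINT x|M. s x * y x - C * \<bar>s x\<bar>) = 0"
    by (rule antisym) (intro Bochner_Integration.integral_nonneg nn)
  then have "AE x in M. s x * y x - C * \<bar>s x\<bar> = 0"
    using i1 i2 nn by (subst (asm) integral_nonneg_eq_0_iff_AE) auto
  then show ?thesis
    by eventually_elim (auto simp: s_def abs_le_iff split: if_splits)
qed

end

text \<open>Duality bounds each component separately; the dimension factor comes from estimating the
  Euclidean norm by the sum of the components.\<close>

lemma (in denoising_1d) BV_sup_bound:
  "\<exists>C\<ge>0. \<forall>(w :: real^'n \<Rightarrow> real^'m) \<nu> \<sigma>. integrable M w \<longrightarrow> grad_repr \<Omega> w \<nu> \<sigma> \<longrightarrow>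
    (AE x in M. norm (w x) \<le> real CARD('m) * (C * (LINT x|M. norm (w x)) + 2 * measure \<nu> UNIV))"
proof -
  obtain C where C: "C \<ge> 0" and bound: "\<And>(g :: real^'n \<Rightarrow> real) (w :: real^'n \<Rightarrow> real^'m) \<nu> \<sigma> i.
    continuous_on UNIV g \<Longrightarrow> compact (supp g) \<Longrightarrow> supp g \<subseteq> \<Omega> \<Longrightarrow>
    integrable M w \<Longrightarrow> grad_repr \<Omega> w \<nu> \<sigma> \<Longrightarrow>
    (LINT x|M. g x * w x $ i) \<le> (C * (LINT x|M. norm (w x)) + 2 * measure \<nu> UNIV) * (LINT x|M. \<bar>g x\<bar>)"
    using exists_pairing_bound by blast
  have "AE x in M. norm (w x) \<le> real CARD('m) * (C * (LINT x|M. norm (w x)) + 2 * measure \<nu> UNIV)"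
    if w: "integrable M w" and r: "grad_repr \<Omega> w \<nu> \<sigma>" for w :: "real^'n \<Rightarrow> real^'m" and \<nu> \<sigma>
  proof -
    let ?D = "C * (LINT x|M. norm (w x)) + 2 * measure \<nu> UNIV"
    have "AE x in M. \<bar>w x $ i\<bar> \<le> ?D" for i
    proof (rule AE_bounded_by_duality)
      show "integrable M (\<lambda>x. w x $ i)" by (rule integrable_bounded_linear[OF bounded_linear_vec_nth w])
      show "0 \<le> ?D" using C by simp
    qed (rule bound[OF _ _ _ w r])
    then have "AE x in M. \<forall>i. \<bar>w x $ i\<bar> \<le> ?D" by (simp add: AE_all_countable)
    then show ?thesis
    proof eventually_elim
      case (elim x)
      have "norm (w x) \<le> (\<Sum>i\<in>UNIV. \<bar>w x $ i\<bar>)" by (rule norm_le_l1_cart)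
      also have "\<dots> \<le> (\<Sum>i\<in>(UNIV::'m set). ?D)" by (rule sum_mono) (use elim in blast)
      finally show ?case by simp
    qed
  qed
  then show ?thesis using C by blast
qed

section \<open>Convergence\<close>

text \<open>Below \<open>d\<close> the first term dominates; above it, \<open>t powr (p - 2)\<close>
  is at most \<open>d powr (p - 2)\<close> because the exponent is not positive. Integrated, this
  takes the place of Hoelder's inequality, with \<open>d\<close> free to be tuned to the L^2
  error.\<close>

lemma powr_le_of_threshold:
  fixes t d p :: real
  assumes "0 \<le> t" "0 < d" "1 \<le> p" "p \<le> 2"
  shows "t powr p \<le> d powr p + d powr (p - 2) * t\<^sup>2"
proof (cases "t \<le> d")
  case True
  then have "t powr p \<le> d powr p" using assms by (intro powr_mono2) auto
  then show ?thesis using assms by (simp add: add_increasing2)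
next
  case False
  then have t: "t > 0" using assms by simp
  have "t powr p = t powr (p - 2) * t powr 2" by (simp add: powr_add[symmetric])
  also have "\<dots> = t powr (p - 2) * t\<^sup>2" using t by (simp add: powr_numeral)
  also have "t powr (p - 2) \<le> d powr (p - 2)" using False assms by (intro powr_mono2') auto
  finally show ?thesis by (simp add: add_increasing mult_right_mono)
qed

lemma powr_le_of_bound:
  fixes t B p :: real
  assumes "0 \<le> t" "t \<le> B" "2 \<le> p"
  shows "t powr p \<le> B powr (p - 2) * t\<^sup>2"
proof (cases "t = 0")
  case False
  then have t: "t > 0" using assms by simp
  have "t powr p = t powr (p - 2) * t powr 2" by (simp add: powr_add[symmetric])
  also have "\<dots> = t powr (p - 2) * t\<^sup>2" using t by (simp add: powr_numeral)
  also have "\<dots> \<le> B powr (p - 2) * t\<^sup>2" using assms by (intro mult_right_mono powr_mono2) auto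
  finally show ?thesis .
qed (use assms in simp)

section \<open>Distance of an almost minimizer to the minimizer\<close>

context denoising
begin

lemma almost_min_competitor:
  assumes "amin \<epsilon> w"
  obtains \<nu> \<sigma> where "competitor w \<nu> \<sigma>"
    "measure \<nu> UNIV \<le> TV (\<lambda>_. 0) (null_measure borel) + \<epsilon>"
proof -
  obtain \<nu> \<sigma> where c: "competitor w \<nu> \<sigma>"
    and min: "\<And>v \<nu>' \<sigma>'. competitor v \<nu>' \<sigma>' \<Longrightarrow> TV w \<nu> \<le> TV v \<nu>' + \<epsilon>"
    using assms unfolding almost_min_def by blast
  have "measure \<nu> UNIV \<le> TV w \<nu>" using lam by (simp add: TV_value_def)
  with min[OF competitor_zero] have "measure \<nu> UNIV \<le> TV (\<lambda>_. 0) (null_measure borel) + \<epsilon>" by simp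
  with c show ?thesis by (rule that)
qed

context
  fixes u0 :: "real^'n \<Rightarrow> real^'m" and w :: "real^'n \<Rightarrow> real^'m" and \<epsilon> :: real
  assumes u0: "amin 0 u0" and w: "amin \<epsilon> w"
begin

lemma almost_min_diff:
  shows "u0 \<in> borel_measurable M" "w \<in> borel_measurable M" "integrable M w" "integrable M u0"
    "integrable M (\<lambda>x. (norm (w x - u0 x))\<^sup>2)" "integrable M (\<lambda>x. (norm (u0 x))\<^sup>2)" "integrable M (\<lambda>x. (norm (w x))\<^sup>2)"
    "(LINT x|M. (norm (w x - u0 x))\<^sup>2) \<le> 4 * \<epsilon> / lam"
proof -
  obtain \<nu> \<sigma> where c: "competitor u0 \<nu> \<sigma>" using almost_min_competitor[OF u0] .
  obtain \<nu>' \<sigma>' where c': "competitor w \<nu>' \<sigma>'" using almost_min_competitor[OF w] .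
  show "u0 \<in> borel_measurable M" "w \<in> borel_measurable M"
    using competitor_measurable[OF c] competitor_measurable[OF c'] .
  show "integrable M w" "integrable M u0" using c c' by (auto simp: TV_competitor_def)
  show "integrable M (\<lambda>x. (norm (w x - u0 x))\<^sup>2)" by (rule competitor_integrable_diff[OF c' c])
  show "integrable M (\<lambda>x. (norm (u0 x))\<^sup>2)" "integrable M (\<lambda>x. (norm (w x))\<^sup>2)"
    using competitor_integrable_sq[OF c] competitor_integrable_sq[OF c'] .
  show "(LINT x|M. (norm (w x - u0 x))\<^sup>2) \<le> 4 * \<epsilon> / lam" using almost_min_dist[OF w u0] by simp
qed

lemma nn_integral_diff_le: "(\<integral>\<^sup>+x. ennreal ((norm (w x - u0 x))\<^sup>2) \<partial>M) \<le> ennreal (4 * \<epsilon> / lam)"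
  using almost_min_diff(8) by (simp add: nn_integral_eq_integral[OF almost_min_diff(5)] ennreal_leI)

lemma Lp_le_subquadratic:
  assumes "1 \<le> p" "p \<le> 2" "d > 0"
  shows "(\<integral>\<^sup>+x. ennreal ((norm (w x - u0 x)) powr p) \<partial>M)
    \<le> ennreal (d powr p * measure M \<Omega>) + ennreal (d powr (p - 2)) * ennreal (4 * \<epsilon> / lam)"
proof -
  note [measurable] = almost_min_diff(1,2)
  have "(\<integral>\<^sup>+x. ennreal ((norm (w x - u0 x)) powr p) \<partial>M)
    \<le> (\<integral>\<^sup>+x. ennreal (d powr p) + ennreal (d powr (p - 2)) * ennreal ((norm (w x - u0 x))\<^sup>2) \<partial>M)"
  proof (rule nn_integral_mono)
    fix x
    show "ennreal ((norm (w x - u0 x)) powr p)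
      \<le> ennreal (d powr p) + ennreal (d powr (p - 2)) * ennreal ((norm (w x - u0 x))\<^sup>2)"
      using powr_le_of_threshold[OF norm_ge_zero[of "w x - u0 x"] assms(3,1,2)]
      by (simp add: ennreal_mult[symmetric] ennreal_plus[symmetric] ennreal_leI del: ennreal_plus)
  qed
  also have "\<dots> = ennreal (d powr p) * emeasure M \<Omega>
      + ennreal (d powr (p - 2)) * (\<integral>\<^sup>+x. ennreal ((norm (w x - u0 x))\<^sup>2) \<partial>M)"
    by (subst nn_integral_add) (auto simp: nn_integral_cmult)
  also have "ennreal (d powr p) * emeasure M \<Omega> = ennreal (d powr p * measure M \<Omega>)"
    by (simp add: M.emeasure_eq_measure ennreal_mult)
  finally show ?thesis
    using nn_integral_diff_le by (meson add_left_mono mult_left_mono order_trans zero_le)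
qed

lemma Lp_le_bounded:
  assumes B: "AE x in M. norm (w x - u0 x) \<le> B" and p: "2 \<le> p"
  shows "(\<integral>\<^sup>+x. ennreal ((norm (w x - u0 x)) powr p) \<partial>M) \<le> ennreal (B powr (p - 2)) * ennreal (4 * \<epsilon> / lam)"
proof -
  note [measurable] = almost_min_diff(1,2)
  have "(\<integral>\<^sup>+x. ennreal ((norm (w x - u0 x)) powr p) \<partial>M)
    \<le> (\<integral>\<^sup>+x. ennreal (B powr (p - 2)) * ennreal ((norm (w x - u0 x))\<^sup>2) \<partial>M)"
  proof (rule nn_integral_mono_AE)
    show "AE x in M. ennreal ((norm (w x - u0 x)) powr p) \<le> ennreal (B powr (p - 2)) * ennreal ((norm (w x - u0 x))\<^sup>2)"
      using B
    proof eventually_elim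
      case (elim x)
      from powr_le_of_bound[OF norm_ge_zero elim p] show ?case
        by (simp add: ennreal_mult[symmetric] ennreal_leI)
    qed
  qed
  also have "\<dots> = ennreal (B powr (p - 2)) * (\<integral>\<^sup>+x. ennreal ((norm (w x - u0 x))\<^sup>2) \<partial>M)"
    by (rule nn_integral_cmult) auto
  also have "\<dots> \<le> ennreal (B powr (p - 2)) * ennreal (4 * \<epsilon> / lam)"
    by (rule mult_left_mono[OF nn_integral_diff_le]) simp
  finally show ?thesis .
qed

lemma weak_diff_le:
  assumes g: "g \<in> borel_measurable M" "integrable M (\<lambda>x. (norm (g x))\<^sup>2)"
  shows "\<bar>(LINT x|M. w x \<bullet> g x) - (LINT x|M. u0 x \<bullet> g x)\<bar>
    \<le> sqrt (4 * \<epsilon> / lam) * sqrt (LINT x|M. (norm (g x))\<^sup>2)"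
proof -
  note d = almost_min_diff
  have "(LINT x|M. w x \<bullet> g x) - (LINT x|M. u0 x \<bullet> g x) = (LINT x|M. (w x - u0 x) \<bullet> g x)"
    unfolding inner_diff_left
    by (rule Bochner_Integration.integral_diff[symmetric]; rule integrable_inner_L2) (use d g in auto)
  also have "\<bar>\<dots>\<bar> \<le> sqrt (LINT x|M. (norm (w x - u0 x))\<^sup>2) * sqrt (LINT x|M. (norm (g x))\<^sup>2)"
    by (rule integral_Cauchy_Schwarz) (use d g in auto)
  also have "\<dots> \<le> sqrt (4 * \<epsilon> / lam) * sqrt (LINT x|M. (norm (g x))\<^sup>2)"
    using d(8) by (intro mult_right_mono) auto
  finally show ?thesis .
qed

lemma integral_norm_le:
  "(LINT x|M. norm (w x)) \<le> (LINT x|M. norm (u0 x)) + sqrt (measure M \<Omega>) * sqrt (4 * \<epsilon> / lam)"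
proof -
  note d = almost_min_diff
  have "(LINT x|M. norm (w x)) \<le> (LINT x|M. norm (u0 x) + norm (w x - u0 x))"
    using d(3,4) by (intro integral_mono) (auto intro: norm_triangle_sub)
  also have "\<dots> = (LINT x|M. norm (u0 x)) + (LINT x|M. norm (w x - u0 x))" using d(3,4) by simp
  also have "(LINT x|M. norm (w x - u0 x)) \<le> sqrt (measure M \<Omega>) * sqrt (LINT x|M. (norm (w x - u0 x))\<^sup>2)"
    using M.integral_norm_le_L2[of "\<lambda>x. w x - u0 x"] d by simp
  also have "\<dots> \<le> sqrt (measure M \<Omega>) * sqrt (4 * \<epsilon> / lam)"
    using d(8) by (intro mult_left_mono) auto
  finally show ?thesis by simp
qed

end

end

text \<open>The sup bound sees \<open>w\<close> only through its L^1 norm and its mass. Up to error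
  \<open>E\<close>, the first is controlled by the distance to \<open>u0\<close>, the second by
  comparison with the zero function. As \<open>u0\<close> obeys the same bound, the difference costs
  a factor 2.\<close>

lemma (in denoising_1d) almost_min_uniformly_bounded:
  assumes u0: "amin 0 u0"
  shows "\<exists>B. \<forall>w \<epsilon>. amin \<epsilon> w \<longrightarrow> 0 \<le> \<epsilon> \<longrightarrow> \<epsilon> \<le> E \<longrightarrow> (AE x in M. norm (w x - u0 x) \<le> B)"
proof -
  obtain C where C: "C \<ge> 0" and bound: "\<And>(w :: real^'n \<Rightarrow> real^'m) \<nu> \<sigma>. integrable M w \<Longrightarrow> grad_repr \<Omega> w \<nu> \<sigma> \<Longrightarrow>
    (AE x in M. norm (w x) \<le> real CARD('m) * (C * (LINT x|M. norm (w x)) + 2 * measure \<nu> UNIV))"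
    using BV_sup_bound by blast
  define B where "B = real CARD('m) * (C * ((LINT x|M. norm (u0 x)) + sqrt (measure M \<Omega>) * sqrt (4 * E / lam))
    + 2 * (TV (\<lambda>_. 0) (null_measure borel) + E))"
  have bd: "AE x in M. norm (w x) \<le> B" if w: "amin \<epsilon> w" and e: "0 \<le> \<epsilon>" "\<epsilon> \<le> E" for w \<epsilon>
  proof -
    obtain \<nu> \<sigma> where c: "competitor w \<nu> \<sigma>"
      and m: "measure \<nu> UNIV \<le> TV (\<lambda>_. 0) (null_measure borel) + \<epsilon>"
      using almost_min_competitor[OF w] .
    have "(LINT x|M. norm (w x)) \<le> (LINT x|M. norm (u0 x)) + sqrt (measure M \<Omega>) * sqrt (4 * \<epsilon> / lam)"
      by (rule integral_norm_le[OF u0 w])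
    also have "\<dots> \<le> (LINT x|M. norm (u0 x)) + sqrt (measure M \<Omega>) * sqrt (4 * E / lam)"
      using e lam by (intro add_left_mono mult_left_mono) (auto intro: divide_right_mono)
    finally have l1: "(LINT x|M. norm (w x)) \<le> (LINT x|M. norm (u0 x)) + sqrt (measure M \<Omega>) * sqrt (4 * E / lam)" .
    have le: "real CARD('m) * (C * (LINT x|M. norm (w x)) + 2 * measure \<nu> UNIV) \<le> B"
      unfolding B_def using m e C mult_left_mono[OF l1 C] by (intro mult_left_mono) auto
    have "AE x in M. norm (w x) \<le> real CARD('m) * (C * (LINT x|M. norm (w x)) + 2 * measure \<nu> UNIV)"
      by (rule bound) (use c in \<open>auto simp: TV_competitor_def\<close>)
    then show ?thesis by eventually_elim (use le in linarith)
  qed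
  have "AE x in M. norm (w x - u0 x) \<le> 2 * B" if w: "amin \<epsilon> w" and e: "0 \<le> \<epsilon>" "\<epsilon> \<le> E" for w \<epsilon>
    using bd[OF w e] bd[OF u0 order_refl order_trans[OF e]]
  proof eventually_elim
    case (elim x)
    then show ?case using norm_triangle_ineq4[of "w x" "u0 x"] by linarith
  qed
  then show ?thesis by blast
qed

text \<open>The integrals of the powers are extended nonnegative ones, so convergence to 0 includes
  that they are eventually finite. The square integrability clauses make the pairings with
  \<open>g\<close> genuine integrals, so the last clause is weak convergence in L^2.\<close>

theorem theorem2p3:
  fixes \<Omega> :: "(real^'n) set" and f :: "real^'n \<Rightarrow> real^'m"
    and lam :: real and u :: "real \<Rightarrow> real^'n \<Rightarrow> real^'m"
  assumes dom: "bounded \<Omega>" "lipschitz_domain \<Omega>"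
    and lam: "lam > 0"
    and f_L2: "f \<in> borel_measurable (lebesgue_on \<Omega>)"
      "integrable (lebesgue_on \<Omega>) (\<lambda>x. (norm (f x))\<^sup>2)"
    and umin: "\<And>\<mu>. \<mu> > 1 \<Longrightarrow> BV_minimizer \<Omega> (K_energy \<mu> \<Omega> lam f) (u \<mu>)"
  shows "\<exists>u0. BV_minimizer \<Omega> (TV_energy \<Omega> lam f) u0
     \<and> (\<forall>v. BV_minimizer \<Omega> (TV_energy \<Omega> lam f) v \<longrightarrow> (AE x in lebesgue_on \<Omega>. v x = u0 x))
     \<and> (\<forall>p::real. 1 \<le> p \<and> (CARD('n) = 1 \<or> p < real CARD('n) / (real CARD('n) - 1)) \<longrightarrow>
          ((\<lambda>\<mu>. \<integral>\<^sup>+x. ennreal ((norm (u \<mu> x - u0 x)) powr p) \<partial>lebesgue_on \<Omega>) \<longlongrightarrow> 0) at_top)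
     \<and> integrable (lebesgue_on \<Omega>) (\<lambda>x. (norm (u0 x))\<^sup>2)
     \<and> (\<forall>\<mu>>1. integrable (lebesgue_on \<Omega>) (\<lambda>x. (norm (u \<mu> x))\<^sup>2))
     \<and> (\<forall>g. g \<in> borel_measurable (lebesgue_on \<Omega>) \<longrightarrow>
            integrable (lebesgue_on \<Omega>) (\<lambda>x. (norm (g x))\<^sup>2) \<longrightarrow>
            ((\<lambda>\<mu>. \<integral>x. u \<mu> x \<bullet> g x \<partial>lebesgue_on \<Omega>) \<longlongrightarrow> (\<integral>x. u0 x \<bullet> g x \<partial>lebesgue_on \<Omega>)) at_top)"
proof -
  have op: "open \<Omega>" and conn: "connected \<Omega>" and ne: "\<Omega> \<noteq> {}"
    using dom(2) by (auto simp: lipschitz_domain_def)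
  interpret denoising \<Omega> lam f by unfold_locales (fact op dom(1) lam f_L2)+
  define \<epsilon> where "\<epsilon> \<mu> = measure M \<Omega> / (\<mu> - 2)" for \<mu>
  have am: "amin (\<epsilon> \<mu>) (u \<mu>)" if "\<mu> > 2" for \<mu>
    unfolding \<epsilon>_def using that by (intro K_minimizer_almost_min umin) auto
  have \<epsilon>_lim: "(\<epsilon> \<longlongrightarrow> 0) at_top"
    unfolding \<epsilon>_def by real_asymp
  have \<epsilon>0: "0 \<le> \<epsilon> \<mu>" if "\<mu> > 2" for \<mu> using that by (simp add: \<epsilon>_def)
  obtain u0 where u0: "amin 0 u0"
  proof -
    have "\<exists>u0. amin 0 u0"
    proof (rule almost_min_limit)
      \<comment> \<open>The shift by 3 keeps the parameter above 2 from \<open>k = 0\<close>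
        on.\<close>
      show "amin (\<epsilon> (real k + 3)) (u (real k + 3))" for k :: nat by (rule am) simp
      show "decseq (\<lambda>k. \<epsilon> (real k + 3))"
        unfolding decseq_def \<epsilon>_def by (auto intro!: divide_left_mono)
      have "filterlim (\<lambda>k. real k + 3) at_top sequentially" by real_asymp
      from filterlim_compose[OF \<epsilon>_lim this] show "(\<lambda>k. \<epsilon> (real k + 3)) \<longlonglongrightarrow> 0" .
    qed
    then show ?thesis using that by blast
  qed
  have big: "\<forall>\<^sub>F \<mu> in at_top. \<mu> > (2::real)" by (rule eventually_gt_at_top)
  have "AE x in M. v x = u0 x" if v: "BV_minimizer \<Omega> (TV_energy \<Omega> lam f) v" for v
  proof -
    note d = almost_min_diff[OF u0 TV_minimizer_almost_min[OF v]]
    have "(LINT x|M. (norm (v x - u0 x))\<^sup>2) = 0"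
      using d(8) by (intro antisym) auto
    then have "AE x in M. (norm (v x - u0 x))\<^sup>2 = 0"
      using d(5) by (subst (asm) integral_nonneg_eq_0_iff_AE) auto
    then show ?thesis by eventually_elim simp
  qed
  moreover have "((\<lambda>\<mu>. \<integral>\<^sup>+x. ennreal ((norm (u \<mu> x - u0 x)) powr p) \<partial>M) \<longlongrightarrow> 0) at_top"
    if p: "1 \<le> p" "CARD('n) = 1 \<or> p < real CARD('n) / (real CARD('n) - 1)" for p
  proof (cases "p \<le> 2")
    case True
    \<comment> \<open>The threshold \<open>d = (\<mu> - 2) powr (-1/4)\<close> tends to zero more slowly than the \<open>L\<^sup>2\<close> distance.\<close>
    have le: "(\<integral>\<^sup>+x. ennreal ((norm (u \<mu> x - u0 x)) powr p) \<partial>M)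
        \<le> ennreal (measure M \<Omega> * (\<mu> - 2) powr (- p / 4) + 4 * measure M \<Omega> / lam * (\<mu> - 2) powr (- (p + 2) / 4))"
      if mu: "\<mu> > 2" for \<mu>
    proof -
      define d where "d = (\<mu> - 2) powr (-1/4)"
      have d: "d > 0" using mu by (simp add: d_def)
      have d1: "d powr q = (\<mu> - 2) powr (- q / 4)" for q by (simp add: d_def powr_powr)
      have inv: "(\<mu> - 2) powr (-1) = 1 / (\<mu> - 2)" using mu by (simp add: powr_minus_divide)
      have "d powr (p - 2) * (4 * \<epsilon> \<mu> / lam) = 4 * measure M \<Omega> / lam * ((\<mu> - 2) powr (- (p - 2) / 4) * (\<mu> - 2) powr (-1))"
        unfolding d1 inv \<epsilon>_def by (simp add: mult_ac)
      also have "(\<mu> - 2) powr (- (p - 2) / 4) * (\<mu> - 2) powr (-1) = (\<mu> - 2) powr (- (p + 2) / 4)"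
        unfolding powr_add[symmetric] by (rule arg_cong[where f = "(powr) (\<mu> - 2)"]) (simp add: field_simps)
      finally have d2: "d powr (p - 2) * (4 * \<epsilon> \<mu> / lam) = 4 * measure M \<Omega> / lam * (\<mu> - 2) powr (- (p + 2) / 4)" .
      have "(\<integral>\<^sup>+x. ennreal ((norm (u \<mu> x - u0 x)) powr p) \<partial>M)
          \<le> ennreal (d powr p * measure M \<Omega>) + ennreal (d powr (p - 2)) * ennreal (4 * \<epsilon> \<mu> / lam)"
        by (rule Lp_le_subquadratic[OF u0 am[OF mu] p(1) True d])
      also have "\<dots> = ennreal (d powr p * measure M \<Omega> + d powr (p - 2) * (4 * \<epsilon> \<mu> / lam))"
        using \<epsilon>0[OF mu] lam by (simp add: ennreal_mult[symmetric] ennreal_plus[symmetric] del: ennreal_plus)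
      finally show ?thesis unfolding d2 d1[of p] by (simp add: mult.commute)
    qed
    have shift: "filterlim (\<lambda>\<mu>::real. \<mu> - 2) at_top at_top" by real_asymp
    have "((\<lambda>\<mu>. measure M \<Omega> * (\<mu> - 2) powr (- p / 4) + 4 * measure M \<Omega> / lam * (\<mu> - 2) powr (- (p + 2) / 4))
        \<longlongrightarrow> measure M \<Omega> * 0 + 4 * measure M \<Omega> / lam * 0) at_top"
      using p(1) by (intro tendsto_add tendsto_mult tendsto_const tendsto_neg_powr shift) auto
    then have lim: "((\<lambda>\<mu>. ennreal (measure M \<Omega> * (\<mu> - 2) powr (- p / 4) + 4 * measure M \<Omega> / lam * (\<mu> - 2) powr (- (p + 2) / 4)))
        \<longlongrightarrow> 0) at_top"
      by (auto dest: tendsto_ennrealI)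
    show ?thesis
      by (rule tendsto_sandwich[OF _ eventually_mono[OF big le] tendsto_const lim]) simp_all
  next
    case False
    have card1: "CARD('n) = 1"
    proof (rule ccontr)
      assume "CARD('n) \<noteq> 1"
      then have "CARD('n) \<ge> 2" using zero_less_card_finite[where 'a='n] by linarith
      then have "real CARD('n) / (real CARD('n) - 1) \<le> 2" by (simp add: field_simps)
      with p(2) False \<open>CARD('n) \<noteq> 1\<close> show False by simp
    qed
    then obtain j :: 'n where j: "UNIV = {j}" by (rule card_1_singletonE)
    interpret denoising_1d \<Omega> lam f j by unfold_locales (fact j conn ne)+
    obtain B where B: "\<And>w \<epsilon>'. amin \<epsilon>' w \<Longrightarrow> 0 \<le> \<epsilon>' \<Longrightarrow> \<epsilon>' \<le> measure M \<Omega> \<Longrightarrow>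
        (AE x in M. norm (w x - u0 x) \<le> B)"
      using almost_min_uniformly_bounded[OF u0, of "measure M \<Omega>"] by blast
    have le: "(\<integral>\<^sup>+x. ennreal ((norm (u \<mu> x - u0 x)) powr p) \<partial>M) \<le> ennreal (B powr (p - 2) * (4 * \<epsilon> \<mu> / lam))"
      if mu: "\<mu> > 3" for \<mu>
    proof -
      \<comment> \<open>Beyond \<open>\<mu> = 3\<close> the denominator \<open>\<mu> - 2\<close>
        exceeds 1, so one sup bound, for errors up to \<open>measure M \<Omega>\<close>, serves all
        these \<open>\<mu>\<close>.\<close>
      have "\<epsilon> \<mu> \<le> measure M \<Omega>" 
        using mu mult_left_mono[of 1 "\<mu> - 2" "measure M \<Omega>"] by (simp add: \<epsilon>_def divide_le_eq)
      then have "AE x in M. norm (u \<mu> x - u0 x) \<le> B" using mu by (intro B[OF am] \<epsilon>0) auto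
      from Lp_le_bounded[OF u0 am this] False mu
      have "(\<integral>\<^sup>+x. ennreal ((norm (u \<mu> x - u0 x)) powr p) \<partial>M) \<le> ennreal (B powr (p - 2)) * ennreal (4 * \<epsilon> \<mu> / lam)"
        by simp
      then show ?thesis using \<epsilon>0[of \<mu>] mu lam by (simp add: ennreal_mult[symmetric])
    qed
    have "((\<lambda>\<mu>. B powr (p - 2) * (4 * \<epsilon> \<mu> / lam)) \<longlongrightarrow> B powr (p - 2) * (4 * 0 / lam)) at_top"
      using lam by (intro tendsto_intros \<epsilon>_lim) auto
    then have lim: "((\<lambda>\<mu>. ennreal (B powr (p - 2) * (4 * \<epsilon> \<mu> / lam))) \<longlongrightarrow> 0) at_top"
      by (auto dest: tendsto_ennrealI)
    show ?thesis
      by (rule tendsto_sandwich[OF _ eventually_mono[OF eventually_gt_at_top[of 3] le] tendsto_const lim]) simp_all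
  qed
  moreover have "integrable M (\<lambda>x. (norm (u0 x))\<^sup>2)" by (rule almost_min_diff(6)[OF u0 u0])
  moreover have "integrable M (\<lambda>x. (norm (u \<mu> x))\<^sup>2)" if mu: "\<mu> > 1" for \<mu>
  proof -
    note min = umin[OF mu]
    obtain \<nu> \<sigma> where "grad_repr \<Omega> (u \<mu>) \<nu> \<sigma>" "integrable M (u \<mu>)"
      using min by (auto simp: BV_minimizer_def is_BV_def)
    with K_minimizer_integrable[OF min] have "competitor (u \<mu>) \<nu> \<sigma>" by (simp add: TV_competitor_def)
    then show ?thesis by (rule competitor_integrable_sq)
  qed
  moreover have "((\<lambda>\<mu>. \<integral>x. u \<mu> x \<bullet> g x \<partial>M) \<longlongrightarrow> (LINT x|M. u0 x \<bullet> g x)) at_top"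
    if g: "g \<in> borel_measurable M" "integrable M (\<lambda>x. (norm (g x))\<^sup>2)" for g
  proof (rule LIM_zero_cancel, rule Lim_null_comparison)
    let ?G = "sqrt (LINT x|M. (norm (g x))\<^sup>2)"
    show "\<forall>\<^sub>F \<mu> in at_top. norm ((LINT x|M. u \<mu> x \<bullet> g x) - (LINT x|M. u0 x \<bullet> g x)) \<le> sqrt (4 * \<epsilon> \<mu> / lam) * ?G"
      using big by eventually_elim (use weak_diff_le[OF u0 am g] in simp)
    have "((\<lambda>\<mu>. sqrt (4 * \<epsilon> \<mu> / lam) * ?G) \<longlongrightarrow> sqrt (4 * 0 / lam) * ?G) at_top"
      using lam by (intro tendsto_intros \<epsilon>_lim) auto
    then show "((\<lambda>\<mu>. sqrt (4 * \<epsilon> \<mu> / lam) * ?G) \<longlongrightarrow> 0) at_top" by simp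
  qed
  ultimately show ?thesis
    using almost_min_TV_minimizer[OF u0] by (intro exI[of _ u0]) blast
qed

end
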